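(* Let $j,k\in\mathbb{N}$, $j,k\ge1$. Then $A\in\mathcal{L}(F^2_{(j)},F^2_{(k)})$ is compact if and only if $A\in\mathcal{C}_1(F^2_{(j)},F^2_{(k)})$ and $\langle Al_{z,j},l_{z,k}\rangle\to0$ as $|z|\to\infty$.
   Context: Let $\mathrm{d}\mu(z)=\frac1\pi e^{-|z|^2}\,\mathrm{d}z$ on $\mathbb{C}\cong\mathbb{R}^2$. For $n\ge1$, $F_n^2$ is the closed subspace of $L^2(\mathbb{C},\mu)$ of smooth functions $f$ with $\partial^n f/\partial\overline z^n=0$; $F^2_{(1)}:=F^2_1$ and $F^2_{(k)}:=F^2_k\ominus F^2_{k-1}$ for $k\ge2$. $\mathcal{L}$ denotes bounded operators. The Weyl operators $W_zf(w)=e^{w\overline z-|z|^2/2}f(w-z)$ are unitary and leave each $F^2_{(k)}$ invariant, acting irreducibly there. $\mathcal{C}_1(F^2_{(j)},F^2_{(k)})$ is the set of $A\in\mathcal{L}(F^2_{(j)},F^2_{(k)})$ with $\|W_zAW_{-z}-A\|_{op}\to0$ as $|z|\to0$. $\mathfrak{A}_{k,1}\colon F^2_{(1)}\to F^2_{(k)}$ is the unitary operator (unique up to a unimodular constant) with $\mathfrak{A}_{k,1}W_z=W_z\mathfrak{A}_{k,1}$ for all $z\in\mathbb{C}$; concretely $\mathfrak{A}_{k,1}=\frac1{\sqrt{(k-1)!}}\left(-\frac{\partial}{\partial z}+\overline z\right)^{k-1}$. With $k_{z,(1)}(w)=e^{w\overline z-|z|^2/2}$ (the normalized reproducing kernel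 of $F^2_{(1)}$), set $l_{z,k}:=\mathfrak{A}_{k,1}k_{z,(1)}\in F^2_{(k)}$ for $z\in\mathbb{C}$. *)

theory Defs
  imports "HOL-Analysis.Analysis"
begin

section \<open>The Gaussian measure and its inner product\<close>

definition gauss :: "complex measure" where
  "gauss = density lborel (\<lambda>z. ennreal (exp (- (norm z)\<^sup>2) / pi))"

definition gauss_inner :: "(complex \<Rightarrow> complex) \<Rightarrow> (complex \<Rightarrow> complex) \<Rightarrow> complex" where
  "gauss_inner f g = (LINT w|gauss. f w * cnj (g w))"

definition gauss_norm :: "(complex \<Rightarrow> complex) \<Rightarrow> real" where
  "gauss_norm f = sqrt (LINT w|gauss. (norm (f w))\<^sup>2)"

definition gauss_dist :: "(complex \<Rightarrow> complex) \<Rightarrow> (complex \<Rightarrow> complex) \<Rightarrow> real" where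
  "gauss_dist f g = gauss_norm (\<lambda>w. f w - g w)"

definition square_integrable_gauss :: "(complex \<Rightarrow> complex) \<Rightarrow> bool" where
  "square_integrable_gauss f \<longleftrightarrow>
     f \<in> borel_measurable borel \<and> integrable gauss (\<lambda>w. (norm (f w))\<^sup>2)"

section \<open>Real smoothness and Wirtinger derivatives\<close>

definition partial_x :: "(complex \<Rightarrow> complex) \<Rightarrow> complex \<Rightarrow> complex" where
  "partial_x f w = frechet_derivative f (at w) 1"

definition partial_y :: "(complex \<Rightarrow> complex) \<Rightarrow> complex \<Rightarrow> complex" where
  "partial_y f w = frechet_derivative f (at w) \<i>"

text \<open>Differentiability is over the reals (\<open>differentiable\<close>, not
  \<open>field_differentiable\<close>).\<close>

primrec C_k :: "nat \<Rightarrow> (complex \<Rightarrow> complex) \<Rightarrow> bool" where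
  "C_k 0 f \<longleftrightarrow> continuous_on UNIV f"
| "C_k (Suc n) f \<longleftrightarrow>
     (\<forall>w. f differentiable (at w)) \<and> C_k n (partial_x f) \<and> C_k n (partial_y f)"

definition smooth :: "(complex \<Rightarrow> complex) \<Rightarrow> bool" where
  "smooth f \<longleftrightarrow> (\<forall>n. C_k n f)"

definition d_z :: "(complex \<Rightarrow> complex) \<Rightarrow> complex \<Rightarrow> complex" where
  "d_z f w = (partial_x f w - \<i> * partial_y f w) / 2"

definition d_zbar :: "(complex \<Rightarrow> complex) \<Rightarrow> complex \<Rightarrow> complex" where
  "d_zbar f w = (partial_x f w + \<i> * partial_y f w) / 2"

section \<open>Polyanalytic Fock spaces\<close>

text \<open>Elements of the spaces are represented by actual functions rather than by classes modulo
  null sets: every class in question has exactly one smooth representative, because the Gaussian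
  measure charges every nonempty open set.\<close>

definition polyfock :: "nat \<Rightarrow> (complex \<Rightarrow> complex) set" where
  "polyfock n =
     {f. smooth f \<and> square_integrable_gauss f \<and> (d_zbar ^^ n) f = (\<lambda>_. 0)}"

definition true_polyfock :: "nat \<Rightarrow> (complex \<Rightarrow> complex) set" where
  "true_polyfock k =
     (if k = 1 then polyfock 1
      else {f \<in> polyfock k. \<forall>g \<in> polyfock (k - 1). gauss_inner f g = 0})"

section \<open>Operators between spaces of functions\<close>

text \<open>An operator \<open>A : E \<rightarrow> F\<close> is a function on all of
  \<open>complex \<Rightarrow> complex\<close>, of which only the values on \<open>E\<close> matter.\<close>

definition bounded_ops ::
    "(complex \<Rightarrow> complex) set \<Rightarrow> (complex \<Rightarrow> complex) set
      \<Rightarrow> ((complex \<Rightarrow> complex) \<Rightarrow> (complex \<Rightarrow> complex)) set" where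
  "bounded_ops E F = {A.
     (\<forall>f\<in>E. A f \<in> F) \<and>
     (\<forall>f\<in>E. \<forall>g\<in>E. A (\<lambda>w. f w + g w) = (\<lambda>w. A f w + A g w)) \<and>
     (\<forall>c. \<forall>f\<in>E. A (\<lambda>w. c * f w) = (\<lambda>w. c * A f w)) \<and>
     (\<exists>C. \<forall>f\<in>E. gauss_norm (A f) \<le> C * gauss_norm f)}"

definition unit_ball :: "(complex \<Rightarrow> complex) set \<Rightarrow> (complex \<Rightarrow> complex) set" where
  "unit_ball E = {f \<in> E. gauss_norm f \<le> 1}"

definition op_norm ::
    "(complex \<Rightarrow> complex) set \<Rightarrow> ((complex \<Rightarrow> complex) \<Rightarrow> (complex \<Rightarrow> complex)) \<Rightarrow> real" where
  "op_norm E T = (SUP f \<in> unit_ball E. gauss_norm (T f))"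

definition norm_topology ::
    "(complex \<Rightarrow> complex) set \<Rightarrow> (complex \<Rightarrow> complex) topology" where
  "norm_topology F = Metric_space.mtopology F gauss_dist"

text \<open>The image of the unit ball is relatively compact.\<close>

definition compact_operator ::
    "(complex \<Rightarrow> complex) set \<Rightarrow> (complex \<Rightarrow> complex) set
      \<Rightarrow> ((complex \<Rightarrow> complex) \<Rightarrow> (complex \<Rightarrow> complex)) \<Rightarrow> bool" where
  "compact_operator E F A \<longleftrightarrow>
     A \<in> bounded_ops E F \<and>
     compactin (norm_topology F) (norm_topology F closure_of (A ` unit_ball E))"

section \<open>Weyl operators\<close>

definition weyl :: "complex \<Rightarrow> (complex \<Rightarrow> complex) \<Rightarrow> complex \<Rightarrow> complex" where
  "weyl z f w = exp (w * cnj z - of_real ((norm z)\<^sup>2 / 2)) * f (w - z)"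

definition C_1 ::
    "nat \<Rightarrow> nat \<Rightarrow> ((complex \<Rightarrow> complex) \<Rightarrow> (complex \<Rightarrow> complex)) set" where
  "C_1 j k = {A \<in> bounded_ops (true_polyfock j) (true_polyfock k).
     ((\<lambda>z. op_norm (true_polyfock j) (\<lambda>f w. weyl z (A (weyl (- z) f)) w - A f w))
        \<longlongrightarrow> 0) (at 0)}"

section \<open>The functions \<open>l_{z,k}\<close>\<close>

definition creation :: "(complex \<Rightarrow> complex) \<Rightarrow> complex \<Rightarrow> complex" where
  "creation f w = - d_z f w + cnj w * f w"

text \<open>The unitary operator from the first to the \<open>k\<close>-th true polyanalytic Fock space
  which intertwines the Weyl operators; the unimodular constant left free by this property is
  fixed by the explicit formula.\<close>

definition fock_unitary :: "nat \<Rightarrow> (complex \<Rightarrow> complex) \<Rightarrow> complex \<Rightarrow> complex" where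
  "fock_unitary k f w = (creation ^^ (k - 1)) f w / of_real (sqrt (fact (k - 1)))"

definition fock_kernel :: "complex \<Rightarrow> complex \<Rightarrow> complex" where
  "fock_kernel z w = exp (w * cnj z - of_real ((norm z)\<^sup>2 / 2))"

definition l_fun :: "complex \<Rightarrow> nat \<Rightarrow> complex \<Rightarrow> complex" where
  "l_fun z k = fock_unitary k (fock_kernel z)"

end

(*
The functions l_{z,j} are the images of the coherent states of the Fock space under a unitary map which commutes
with the Weyl operators, so A becomes a bounded sesquilinear form b on square summable sequences and
<A l_{z,j}, l_{z,k}> becomes its Berezin transform.  Averaging the translates of b by the Weyl operators against
exp(-|u|^2) gives the Toeplitz form whose symbol is the Berezin transform; if that symbol vanishes at infinity, the
average is compact.  This applies as well to the Gaussian averages of b, whose Berezin transforms still vanish at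
infinity; averaging twice, all averages against exp(-c |u|^2) with c < 1 are compact.  Averages depend continuously on the weight
in L^1, and power series expansion of the weight in c extends compactness to all c > 0.  As c tends to infinity the
normalized averages converge in norm to b, because b lies in C_1.  Conversely, a compact form is a norm limit of
finite rank ones, for which continuity of the orbit is strong continuity of the Weyl operators and the Berezin
transform vanishes at infinity because the normalized coherent states tend weakly to zero.
*)
theory Submission
  imports Defs "HOL-Probability.Distributions" "HOL-Complex_Analysis.Complex_Analysis"
    "HOL-Real_Asymp.Real_Asymp"
begin

text \<open>The obstacle is the direction of the heat flow. Averaging only widens Gaussians, whereas
  recovering the form needs arbitrarily narrow weights, that is, large exponents. The widening is
  undone on the level of weights: differentiating exp(-c|u|^2) in c produces |u|^(2n) exp(-c|u|^2),
  and the Taylor series of exp(-d|u|^2), multiplied by exp(-c|u|^2), converges in L^1 as long as |d|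
  < c. Exponents below c1 thus give all exponents below twice c1, and iteration reaches every
  exponent. The Toeplitz identity for the weight exp(-|u|^2) is checked on rank one forms built from
  coherent states, where both sides are explicit Gaussian integrals; two symmetries of the defect
  and the totality of the coherent states give all rank one forms. The identification with sequences
  rests on one computation: pairing a function of order m+1 with
  \<open>(creation ^^ m) (bimonom p 0)\<close> sees only a Taylor coefficient of the factor of
  \<open>cnj w ^ m\<close>. Isometry, membership and surjectivity all follow from it.\<close>

section \<open>Lebesgue measure on the plane: shears, rotations, radial integrals\<close>

lemma distr_Complex_lborel:
  "distr (lborel \<Otimes>\<^sub>M lborel) borel (\<lambda>(x, y). Complex x y) = lborel"
proof (rule lborel_eqI[symmetric])
  have [measurable]: "(\<lambda>(x, y). Complex x y) \<in> borel_measurable (borel \<Otimes>\<^sub>M borel)"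
    unfolding borel_prod
    by (intro borel_measurable_continuous_onI) (auto simp: case_prod_beta' Complex_eq intro!: continuous_intros)
  fix l u :: complex
  assume le: "\<And>b. b \<in> Basis \<Longrightarrow> l \<bullet> b \<le> u \<bullet> b"
  have ru: "Re l \<le> Re u" "Im l \<le> Im u"
    using le[of 1] le[of \<i>] by (auto simp: Basis_complex_def)
  have "(\<lambda>(x, y). Complex x y) -` box l u \<inter> space (lborel \<Otimes>\<^sub>M lborel)
      = {Re l<..<Re u} \<times> {Im l<..<Im u}"
    by (auto simp: box_def Basis_complex_def space_pair_measure)
  then show "emeasure (distr (lborel \<Otimes>\<^sub>M lborel) borel (\<lambda>(x, y). Complex x y)) (box l u)
     = ennreal (\<Prod>b\<in>Basis. (u - l) \<bullet> b)"
    using ru by (subst emeasure_distr)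
      (auto simp: lborel.emeasure_pair_measure_Times Basis_complex_def ennreal_mult)
qed simp

lemma nn_integral_lborel_Complex:
  assumes [measurable]: "f \<in> borel_measurable borel"
  shows "(\<integral>\<^sup>+z. f z \<partial>lborel) = (\<integral>\<^sup>+y. \<integral>\<^sup>+x. f (Complex x y) \<partial>lborel \<partial>lborel)"
    and "(\<integral>\<^sup>+z. f z \<partial>lborel) = (\<integral>\<^sup>+x. \<integral>\<^sup>+y. f (Complex x y) \<partial>lborel \<partial>lborel)"
proof -
  have C[measurable]: "(\<lambda>p. Complex (fst p) (snd p)) \<in> borel_measurable (borel \<Otimes>\<^sub>M borel)"
    unfolding borel_prod
    by (intro borel_measurable_continuous_onI) (auto simp: Complex_eq intro!: continuous_intros)
  have "(\<integral>\<^sup>+z. f z \<partial>lborel)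
      = (\<integral>\<^sup>+p. f (Complex (fst p) (snd p)) \<partial>(lborel \<Otimes>\<^sub>M lborel))"
    by (subst distr_Complex_lborel[symmetric], subst nn_integral_distr)
       (auto simp: case_prod_beta')
  then show "(\<integral>\<^sup>+z. f z \<partial>lborel) = (\<integral>\<^sup>+y. \<integral>\<^sup>+x. f (Complex x y) \<partial>lborel \<partial>lborel)"
    and "(\<integral>\<^sup>+z. f z \<partial>lborel) = (\<integral>\<^sup>+x. \<integral>\<^sup>+y. f (Complex x y) \<partial>lborel \<partial>lborel)"
    using lborel.nn_integral_fst[of "\<lambda>p. f (Complex (fst p) (snd p))" lborel]
      lborel_pair.nn_integral_snd[of "\<lambda>(x, y). f (Complex x y)"]
    by (simp_all add: case_prod_beta')
qed

lemma nn_integral_lborel_translate: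
  fixes a :: "'a::euclidean_space"
  assumes [measurable]: "f \<in> borel_measurable borel"
  shows "(\<integral>\<^sup>+x. f (a + x) \<partial>lborel) = (\<integral>\<^sup>+x. f x \<partial>lborel)"
  by (subst (2) lborel_distr_plus[symmetric, of a], subst nn_integral_distr) auto

text \<open>Integrating first along the direction of the shear, the inner integral is merely
  translated.\<close>

lemma nn_integral_shear:
  fixes t :: real
  assumes [measurable]: "f \<in> borel_measurable borel"
  shows "(\<integral>\<^sup>+z. f (Complex (Re z + t * Im z) (Im z)) \<partial>lborel) = (\<integral>\<^sup>+z. f z \<partial>lborel)"
    and "(\<integral>\<^sup>+z. f (Complex (Re z) (Im z + t * Re z)) \<partial>lborel) = (\<integral>\<^sup>+z. f z \<partial>lborel)"
proof -
  have [measurable]: "(\<lambda>z. Complex (Re z + t * Im z) (Im z)) \<in> borel_measurable borel"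
    "(\<lambda>z. Complex (Re z) (Im z + t * Re z)) \<in> borel_measurable borel"
    "\<And>x. (\<lambda>y. Complex x y) \<in> borel_measurable borel" "\<And>y. (\<lambda>x. Complex x y) \<in> borel_measurable borel"
    by (intro borel_measurable_continuous_onI, simp add: Complex_eq, intro continuous_intros)+
  have "(\<integral>\<^sup>+z. f (Complex (Re z + t * Im z) (Im z)) \<partial>lborel)
     = (\<integral>\<^sup>+y. \<integral>\<^sup>+x. f (Complex (t * y + x) y) \<partial>lborel \<partial>lborel)"
    by (subst nn_integral_lborel_Complex(1)) (simp_all add: add.commute)
  also have "\<dots> = (\<integral>\<^sup>+y. \<integral>\<^sup>+x. f (Complex x y) \<partial>lborel \<partial>lborel)"
  proof (rule nn_integral_cong)
    fix y
    show "(\<integral>\<^sup>+x. f (Complex (t * y + x) y) \<partial>lborel) = (\<integral>\<^sup>+x. f (Complex x y) \<partial>lborel)"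
      using nn_integral_lborel_translate[of "\<lambda>x. f (Complex x y)" "t * y"] by simp
  qed
  finally show "(\<integral>\<^sup>+z. f (Complex (Re z + t * Im z) (Im z)) \<partial>lborel) = (\<integral>\<^sup>+z. f z \<partial>lborel)"
    by (simp add: nn_integral_lborel_Complex(1)[of f])
  have "(\<integral>\<^sup>+z. f (Complex (Re z) (Im z + t * Re z)) \<partial>lborel)
     = (\<integral>\<^sup>+x. \<integral>\<^sup>+y. f (Complex x (t * x + y)) \<partial>lborel \<partial>lborel)"
    by (subst nn_integral_lborel_Complex(2)) (simp_all add: add.commute)
  also have "\<dots> = (\<integral>\<^sup>+x. \<integral>\<^sup>+y. f (Complex x y) \<partial>lborel \<partial>lborel)"
  proof (rule nn_integral_cong)
    fix x
    show "(\<integral>\<^sup>+y. f (Complex x (t * x + y)) \<partial>lborel) = (\<integral>\<^sup>+y. f (Complex x y) \<partial>lborel)"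
      using nn_integral_lborel_translate[of "\<lambda>y. f (Complex x y)" "t * x"] by simp
  qed
  finally show "(\<integral>\<^sup>+z. f (Complex (Re z) (Im z + t * Re z)) \<partial>lborel) = (\<integral>\<^sup>+z. f z \<partial>lborel)"
    by (simp add: nn_integral_lborel_Complex(2)[of f])
qed

text \<open>A rotation is a product of three shears, except for the rotation by \<open>\<pi>\<close>.\<close>

lemma nn_integral_rotate:
  fixes c :: complex
  assumes [measurable]: "f \<in> borel_measurable borel" and c: "norm c = 1"
  shows "(\<integral>\<^sup>+z. f (c * z) \<partial>lborel) = (\<integral>\<^sup>+z. f z \<partial>lborel)"
proof -
  have gen: "(\<integral>\<^sup>+z. f (c * z) \<partial>lborel) = (\<integral>\<^sup>+z. f z \<partial>lborel)"
    if [measurable]: "f \<in> borel_measurable borel" and c: "norm c = 1" "Re c \<noteq> -1" for f c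
  proof -
    define s where "s = Im c"
    \<comment> \<open>With c = cis \<theta> this is -tan(\<theta>/2), and \<open>s\<close> is sin
      \<theta>; the half angle is what excludes \<open>Re c = -1\<close>.\<close>
    define t where "t = - (Im c / (1 + Re c))"
    have r: "(Re c)\<^sup>2 + (Im c)\<^sup>2 = 1"
      using c(1) by (simp add: norm_complex_def)
    have ts: "t * s = Re c - 1"
      using r c(2) by (simp add: t_def s_def field_simps power2_eq_square)
    have ts2: "t * (2 + t * s) = - s"
      unfolding ts using c(2) by (simp add: t_def s_def divide_simps)
    have meas: "(\<lambda>z. Complex (Re z + t * Im z) (Im z)) \<in> borel_measurable borel"
      "(\<lambda>z. Complex (Re z) (Im z + s * Re z)) \<in> borel_measurable borel"
      by (intro borel_measurable_continuous_onI, simp add: Complex_eq, intro continuous_intros)+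
    note [measurable] = meas
    define X where "X = (\<lambda>z. Complex (Re z + t * Im z) (Im z))"
    define Y where "Y = (\<lambda>z. Complex (Re z) (Im z + s * Re z))"
    have [measurable]: "X \<in> borel_measurable borel" "Y \<in> borel_measurable borel"
      unfolding X_def Y_def by measurable
    have XYX: "X (Y (X z)) = c * z" for z
    proof (rule complex_eqI)
      have "Re (X (Y (X z))) = (1 + t * s) * Re z + t * (2 + t * s) * Im z"
        by (simp add: X_def Y_def algebra_simps)
      also have "\<dots> = Re (c * z)"
        by (subst ts2, subst ts) (simp add: s_def)
      finally show "Re (X (Y (X z))) = Re (c * z)" .
      have "Im (X (Y (X z))) = s * Re z + (1 + t * s) * Im z"
        by (simp add: X_def Y_def algebra_simps)
      also have "\<dots> = Im (c * z)"
        unfolding ts by (simp add: s_def)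
      finally show "Im (X (Y (X z))) = Im (c * z)" .
    qed
    have "(\<integral>\<^sup>+z. f (c * z) \<partial>lborel) = (\<integral>\<^sup>+z. f (X (Y (X z))) \<partial>lborel)"
      by (simp add: XYX)
    also have "\<dots> = (\<integral>\<^sup>+z. f (X (Y z)) \<partial>lborel)"
      using nn_integral_shear(1)[of "\<lambda>z. f (X (Y z))" t] by (simp add: X_def)
    also have "\<dots> = (\<integral>\<^sup>+z. f (X z) \<partial>lborel)"
      using nn_integral_shear(2)[of "\<lambda>z. f (X z)" s] by (simp add: Y_def)
    also have "\<dots> = (\<integral>\<^sup>+z. f z \<partial>lborel)"
      using nn_integral_shear(1)[of "\<lambda>z. f z" t] by (simp add: X_def)
    finally show ?thesis .
  qed
  show ?thesis
  proof (cases "Re c = -1")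
    case True
    then have "c = \<i> * \<i>"
      using c by (auto simp: complex_eq_iff norm_complex_def)
    then have "(\<integral>\<^sup>+z. f (c * z) \<partial>lborel) = (\<integral>\<^sup>+z. f (\<i> * (\<i> * z)) \<partial>lborel)"
      by (simp add: mult.assoc)
    also have "\<dots> = (\<integral>\<^sup>+z. f (\<i> * z) \<partial>lborel)"
      using gen[of "\<lambda>z. f (\<i> * z)" \<i>] by simp
    also have "\<dots> = (\<integral>\<^sup>+z. f z \<partial>lborel)"
      by (rule gen) auto
    finally show ?thesis .
  qed (use gen c in auto)
qed

lemma distr_rotate_lborel:
  assumes "norm (c::complex) = 1"
  shows "distr lborel borel ((*) c) = lborel"
proof (rule measure_eqI)
  fix A assume "A \<in> sets (distr lborel borel ((*) c))"
  then have [measurable]: "A \<in> sets borel" by simp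
  have "(*) c -` A \<in> sets borel"
    using measurable_sets[of "(*) c" borel borel A] by simp
  then have "emeasure (distr lborel borel ((*) c)) A = (\<integral>\<^sup>+z. indicator ((*) c -` A) z \<partial>lborel)"
    by (subst emeasure_distr) auto
  also have "\<dots> = (\<integral>\<^sup>+z. indicator A (c * z) \<partial>lborel)"
    by (simp add: indicator_def)
  also have "\<dots> = emeasure lborel A"
    by (subst nn_integral_rotate) (use assms in auto)
  finally show "emeasure (distr lborel borel ((*) c)) A = emeasure lborel A" .
qed simp

lemma borel_lessThan_sets: "sets (borel :: real measure) = sigma_sets UNIV (range lessThan)"
  unfolding borel_Iio by simp

text \<open>Polar coordinates with the angle integrated out: the disc where |z|^2 < a has area pi*a,
  linear in a, so |z|^2 has constant density pi on the half line. The rays \<open>{..<a}\<close> are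
  closed under intersection and generate the Borel sets.\<close>

lemma distr_norm_power2_lborel:
  "distr lborel borel (\<lambda>z::complex. (norm z)\<^sup>2) = density lborel (\<lambda>t. ennreal pi * indicator {0..} t)"
proof (rule measure_eqI_generator_eq[where E="range (lessThan :: real \<Rightarrow> real set)" and \<Omega>=UNIV and A="\<lambda>i. {..<real i}"])
  have ball: "{z::complex. (norm z)\<^sup>2 < a} = ball 0 (sqrt a)" for a
    by (auto simp: real_less_rsqrt) (metis norm_ge_zero real_sqrt_abs real_sqrt_less_iff abs_of_nonneg)
  have L: "emeasure (distr lborel borel (\<lambda>z::complex. (norm z)\<^sup>2)) {..<a} = ennreal (pi * max a 0)" for a
  proof (cases "a \<le> 0")
    case True
    then have "{z::complex. (norm z)\<^sup>2 < a} = {}"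
      by (auto simp: not_less intro: order_trans)
    with True show ?thesis by (subst emeasure_distr) (auto simp: vimage_def)
  next
    case False
    then show ?thesis
      by (subst emeasure_distr) (auto simp: vimage_def ball emeasure_ball unit_ball_vol_2 max_def)
  qed
  have R: "emeasure (density lborel (\<lambda>t. ennreal pi * indicator {0..} t)) {..<a} = ennreal (pi * max a 0)" for a :: real
  proof -
    have "emeasure (density lborel (\<lambda>t. ennreal pi * indicator {0..} t)) {..<a}
        = (\<integral>\<^sup>+t. ennreal pi * indicator {0..<a} t \<partial>lborel)"
      by (subst emeasure_density) (auto intro!: nn_integral_cong split: split_indicator)
    also have "\<dots> = ennreal (pi * max a 0)"
      by (subst nn_integral_cmult_indicator) (auto simp: ennreal_mult max_def)
    finally show ?thesis .
  qed
  fix X assume "X \<in> range (lessThan :: real \<Rightarrow> real set)"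
  then show "emeasure (distr lborel borel (\<lambda>z::complex. (norm z)\<^sup>2)) X
      = emeasure (density lborel (\<lambda>t. ennreal pi * indicator {0..} t)) X"
    using L R by auto
next
  show "Int_stable (range (lessThan :: real \<Rightarrow> real set))"
    unfolding Int_stable_def
  proof safe
    fix a b :: real
    have "{..<a} \<inter> {..<b} = {..<min a b}" by auto
    then show "{..<a} \<inter> {..<b} \<in> range lessThan" by blast
  qed
  show "sets (distr lborel borel (\<lambda>z::complex. (norm z)\<^sup>2)) = sigma_sets UNIV (range lessThan)"
    by (simp add: borel_lessThan_sets)
  show "sets (density lborel (\<lambda>t::real. ennreal pi * indicator {0..} t)) = sigma_sets UNIV (range lessThan)"
    by (simp add: borel_lessThan_sets)
  show "(\<Union>i. {..<real i}) = UNIV"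
    by (auto intro: reals_Archimedean2)
  fix i show "emeasure (distr lborel borel (\<lambda>z::complex. (norm z)\<^sup>2)) {..<real i} \<noteq> \<infinity>"
  proof -
    have "{z::complex. (norm z)\<^sup>2 < real i} = ball 0 (sqrt (real i))"
      by (auto simp: real_less_rsqrt) (metis norm_ge_zero real_sqrt_abs real_sqrt_less_iff abs_of_nonneg)
    then show ?thesis
      by (subst emeasure_distr) (auto simp: vimage_def emeasure_ball)
  qed
qed auto

text \<open>In the variable t = |z|^2 this is pi times the Gamma integral for n!, rescaled by
  p.\<close>

lemma nn_integral_radial_moment:
  assumes "p > 0"
  shows "(\<integral>\<^sup>+z. ennreal ((norm (z::complex)) ^ (2 * n) * exp (- p * (norm z)\<^sup>2)) \<partial>lborel)
     = ennreal (pi * fact n / p ^ Suc n)"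
proof -
  have "(\<integral>\<^sup>+z. ennreal ((norm (z::complex)) ^ (2 * n) * exp (- p * (norm z)\<^sup>2)) \<partial>lborel)
     = (\<integral>\<^sup>+t. ennreal (t ^ n * exp (- p * t)) \<partial>distr lborel borel (\<lambda>z::complex. (norm z)\<^sup>2))"
    by (subst nn_integral_distr) (auto simp: power_mult)
  also have "\<dots> = (\<integral>\<^sup>+t. ennreal pi * (ennreal (t ^ n * exp (- p * t)) * indicator {0..} t) \<partial>lborel)"
    unfolding distr_norm_power2_lborel
    by (subst nn_integral_density) (auto intro!: nn_integral_cong simp: ac_simps)
  also have "\<dots> = ennreal pi * (\<integral>\<^sup>+t. ennreal (t ^ n * exp (- p * t)) * indicator {0..} t \<partial>lborel)"
    by (rule nn_integral_cmult) auto
  also have "(\<integral>\<^sup>+t. ennreal (t ^ n * exp (- p * t)) * indicator {0..} t \<partial>lborel)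
      = ennreal (fact n / p ^ Suc n)"
  proof -
    have "ennreal (fact n) = (\<integral>\<^sup>+t. ennreal (t ^ n * exp (- t)) * indicator {0..} t \<partial>lborel)"
      using nn_intergal_power_times_exp_Ici[of n] by simp
    also have "\<dots> = ennreal p * (\<integral>\<^sup>+t. ennreal ((p * t) ^ n * exp (- (p * t))) * indicator {0..} (p * t) \<partial>lborel)"
      using assms nn_integral_real_affine[of "\<lambda>t. ennreal (t ^ n * exp (- t)) * indicator {0..} t" p 0] by simp
    also have "(\<integral>\<^sup>+t. ennreal ((p * t) ^ n * exp (- (p * t))) * indicator {0..} (p * t) \<partial>lborel)
        = (\<integral>\<^sup>+t. ennreal (p ^ n) * (ennreal (t ^ n * exp (- p * t)) * indicator {0..} t) \<partial>lborel)"
      using assms by (intro nn_integral_cong)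
        (auto simp: power_mult_distrib ennreal_mult'[symmetric] ac_simps zero_le_mult_iff split: split_indicator)
    also have "\<dots> = ennreal (p ^ n) * (\<integral>\<^sup>+t. ennreal (t ^ n * exp (- p * t)) * indicator {0..} t \<partial>lborel)"
      by (rule nn_integral_cmult) auto
    finally have "ennreal (fact n) = ennreal (p ^ Suc n) * (\<integral>\<^sup>+t. ennreal (t ^ n * exp (- p * t)) * indicator {0..} t \<partial>lborel)"
      using assms by (simp add: ennreal_mult mult.assoc)
    then have "ennreal (1 / p ^ Suc n) * ennreal (fact n) = (ennreal (1 / p ^ Suc n) * ennreal (p ^ Suc n))
       * (\<integral>\<^sup>+t. ennreal (t ^ n * exp (- p * t)) * indicator {0..} t \<partial>lborel)"
      by (simp add: mult.assoc)
    also have "ennreal (1 / p ^ Suc n) * ennreal (p ^ Suc n) = 1"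
      using assms by (subst ennreal_mult'[symmetric]) auto
    finally show ?thesis
      using assms by (simp add: ennreal_mult'[symmetric])
  qed
  finally show ?thesis
    using assms by (simp add: ennreal_mult'[symmetric])
qed

section \<open>Rotation invariance and moments of the Gaussian measure\<close>

lemma borel_measurable_cnj' [measurable (raw)]:
  "f \<in> borel_measurable M \<Longrightarrow> (\<lambda>x. cnj (f x)) \<in> borel_measurable M"
  by (rule borel_measurable_continuous_on[of cnj]) (auto intro!: continuous_intros)

lemma sets_gauss [simp, measurable_cong]: "sets gauss = sets borel"
  and space_gauss [simp]: "space gauss = UNIV"
  by (simp_all add: gauss_def)

lemma measurable_gauss_iff [simp]: "borel_measurable gauss = borel_measurable borel"
  by (rule measurable_cong_sets) auto

lemma integrable_gauss_iff:
  fixes f :: "complex \<Rightarrow> 'b::{banach, second_countable_topology}"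
  assumes "f \<in> borel_measurable borel"
  shows "integrable gauss f \<longleftrightarrow> integrable lborel (\<lambda>z. (exp (- (norm z)\<^sup>2) / pi) *\<^sub>R f z)"
  unfolding gauss_def using assms by (subst integrable_density) auto

lemma integral_gauss_eq:
  fixes f :: "complex \<Rightarrow> 'b::{banach, second_countable_topology}"
  assumes "f \<in> borel_measurable borel"
  shows "(LINT z|gauss. f z) = (LINT z|lborel. (exp (- (norm z)\<^sup>2) / pi) *\<^sub>R f z)"
  unfolding gauss_def using assms by (subst integral_density) auto

lemma integral_gauss_rotate:
  fixes f :: "complex \<Rightarrow> 'b::{banach, second_countable_topology}"
  assumes [measurable]: "f \<in> borel_measurable borel" and "norm c = 1"
  shows "(LINT z|gauss. f (c * z)) = (LINT z|gauss. f z)"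
proof -
  have "(LINT z|gauss. f z) = (LINT z|distr lborel borel ((*) c). (exp (- (norm z)\<^sup>2) / pi) *\<^sub>R f z)"
    using assms by (simp add: integral_gauss_eq distr_rotate_lborel)
  also have "\<dots> = (LINT z|gauss. f (c * z))"
    using assms by (subst integral_distr) (auto simp: integral_gauss_eq norm_mult)
  finally show ?thesis ..
qed

text \<open>By rotation invariance the integral equals \<mu> times itself. This is the source of
  every orthogonality relation below.\<close>

lemma integral_gauss_rotate_eq_0:
  fixes f :: "complex \<Rightarrow> complex"
  assumes "f \<in> borel_measurable borel" "norm c = 1" "\<And>z. f (c * z) = \<mu> * f z" "\<mu> \<noteq> 1"
  shows "(LINT z|gauss. f z) = 0"
proof -
  have "(LINT z|gauss. f z) = \<mu> * (LINT z|gauss. f z)"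
    using integral_gauss_rotate[OF assms(1,2)] assms(3) by simp
  then show ?thesis
    using assms(4) by simp
qed

lemma has_bochner_integral_gauss_moment:
  "has_bochner_integral gauss (\<lambda>z. (norm z) ^ (2 * n)) (fact n)"
proof (rule has_bochner_integral_nn_integral)
  have "(\<integral>\<^sup>+z. ennreal ((norm z) ^ (2 * n)) \<partial>gauss)
     = (\<integral>\<^sup>+z. ennreal (1 / pi) * ennreal ((norm (z::complex)) ^ (2 * n) * exp (- 1 * (norm z)\<^sup>2)) \<partial>lborel)"
    unfolding gauss_def
    by (subst nn_integral_density) (auto simp: ennreal_mult'[symmetric] intro!: nn_integral_cong)
  also have "\<dots> = ennreal (1 / pi) * ennreal (pi * fact n / 1 ^ Suc n)"
    by (subst nn_integral_cmult) (simp_all only: nn_integral_radial_moment[OF zero_less_one], measurable)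
  also have "\<dots> = ennreal (fact n)"
    by (simp add: ennreal_mult'[symmetric])
  finally show "(\<integral>\<^sup>+z. ennreal ((norm z) ^ (2 * n)) \<partial>gauss) = ennreal (fact n)" .
qed auto

lemma integrable_gauss_norm_power: "integrable gauss (\<lambda>z. (norm z) ^ n)"
proof (rule Bochner_Integration.integrable_bound)
  show "integrable gauss (\<lambda>z. (norm z) ^ (2 * 0) + (norm z) ^ (2 * n))"
    using has_bochner_integral_gauss_moment by (intro Bochner_Integration.integrable_add) (blast intro: integrable.intros)+
  have "x ^ n \<le> 1 + x ^ (2 * n)" if "x \<ge> 0" for x :: real
  proof (cases "x \<ge> 1")
    case True
    then show ?thesis using power_increasing[of n "2 * n" x] by simp
  next
    case False
    then have "x ^ n \<le> 1" using that by (simp add: power_le_one)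
    then show ?thesis using that zero_le_power[of x "2 * n"] by linarith
  qed
  then show "AE z in gauss. norm ((norm z) ^ n) \<le> norm ((norm z) ^ (2 * 0) + (norm z) ^ (2 * n))"
    by auto
qed auto

section \<open>Square integrable functions\<close>

lemma sqi_measurable [measurable_dest]: "square_integrable_gauss f \<Longrightarrow> f \<in> borel_measurable borel"
  by (simp add: square_integrable_gauss_def)

lemma integrable_sqi: "square_integrable_gauss f \<Longrightarrow> integrable gauss (\<lambda>w. (norm (f w))\<^sup>2)"
  by (simp add: square_integrable_gauss_def)

lemma sqi_add:
  assumes "square_integrable_gauss f" "square_integrable_gauss g"
  shows "square_integrable_gauss (\<lambda>w. f w + g w)"
  unfolding square_integrable_gauss_def
proof
  note [measurable] = assms[THEN sqi_measurable]
  show "(\<lambda>w. f w + g w) \<in> borel_measurable borel" by simp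
  show "integrable gauss (\<lambda>w. (norm (f w + g w))\<^sup>2)"
  proof (rule Bochner_Integration.integrable_bound)
    show "integrable gauss (\<lambda>w. 2 * (norm (f w))\<^sup>2 + 2 * (norm (g w))\<^sup>2)"
      using assms by (simp add: integrable_sqi)
    have "(norm (a + b))\<^sup>2 \<le> 2 * (norm a)\<^sup>2 + 2 * (norm b)\<^sup>2" for a b :: complex
    proof -
      have "(norm (a + b))\<^sup>2 \<le> (norm a + norm b)\<^sup>2"
        by (intro power_mono norm_triangle_ineq) simp
      also have "\<dots> \<le> 2 * (norm a)\<^sup>2 + 2 * (norm b)\<^sup>2"
        using sum_squares_bound[of "norm a" "norm b"] by (simp add: power2_sum)
      finally show ?thesis .
    qed
    then show "AE w in gauss. norm ((norm (f w + g w))\<^sup>2) \<le> norm (2 * (norm (f w))\<^sup>2 + 2 * (norm (g w))\<^sup>2)"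
      by simp
  qed simp
qed

lemma sqi_cmult:
  "square_integrable_gauss f \<Longrightarrow> square_integrable_gauss (\<lambda>w. c * f w)"
  by (auto simp: square_integrable_gauss_def norm_mult power_mult_distrib)

lemma sqi_diff:
  assumes "square_integrable_gauss f" "square_integrable_gauss g"
  shows "square_integrable_gauss (\<lambda>w. f w - g w)"
  using sqi_add[OF assms(1) sqi_cmult[OF assms(2), of "-1"]] by simp

lemma sqi_zero: "square_integrable_gauss (\<lambda>w. 0)"
  by (simp add: square_integrable_gauss_def)

lemma sqi_sum:
  "(\<And>i. i \<in> I \<Longrightarrow> square_integrable_gauss (f i)) \<Longrightarrow> square_integrable_gauss (\<lambda>w. \<Sum>i\<in>I. f i w)"
  by (induction I rule: infinite_finite_induct) (auto intro: sqi_zero sqi_add)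

lemma integrable_sqi_mult:
  assumes "square_integrable_gauss f" "square_integrable_gauss g"
  shows "integrable gauss (\<lambda>w. norm (f w) * norm (g w))"
proof (rule Bochner_Integration.integrable_bound)
  note [measurable] = assms[THEN sqi_measurable]
  show "integrable gauss (\<lambda>w. (norm (f w))\<^sup>2 + (norm (g w))\<^sup>2)"
    using assms by (simp add: integrable_sqi)
  have "a * b \<le> a\<^sup>2 + b\<^sup>2" if "a \<ge> 0" "b \<ge> 0" for a b :: real
    using sum_squares_bound[of a b] that mult_nonneg_nonneg[of a b] by linarith
  then show "AE w in gauss. norm (norm (f w) * norm (g w)) \<le> norm ((norm (f w))\<^sup>2 + (norm (g w))\<^sup>2)"
    by simp
  show "(\<lambda>w. norm (f w) * norm (g w)) \<in> borel_measurable gauss" by simp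
qed

lemma integrable_sqi_inner:
  assumes "square_integrable_gauss f" "square_integrable_gauss g"
  shows "integrable gauss (\<lambda>w. f w * cnj (g w))"
proof (rule Bochner_Integration.integrable_bound[OF integrable_sqi_mult[OF assms]])
  note [measurable] = assms[THEN sqi_measurable]
  show "(\<lambda>w. f w * cnj (g w)) \<in> borel_measurable gauss" by simp
qed (simp add: norm_mult)

lemma gauss_norm_nonneg [simp]: "gauss_norm f \<ge> 0"
  by (simp add: gauss_norm_def)

lemma gauss_norm_power2: "(gauss_norm f)\<^sup>2 = (LINT w|gauss. (norm (f w))\<^sup>2)"
  by (simp add: gauss_norm_def)

lemma gauss_inner_self: "gauss_inner f f = of_real ((gauss_norm f)\<^sup>2)"
  unfolding gauss_norm_power2 gauss_inner_def
  by (simp flip: integral_complex_of_real add: complex_norm_square[symmetric])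

lemma gauss_inner_cnj: "cnj (gauss_inner f g) = gauss_inner g f"
proof -
  have "(\<lambda>w. cnj (f w * cnj (g w))) = (\<lambda>w. g w * cnj (f w))"
    by (simp add: mult.commute fun_eq_iff)
  then show ?thesis
    unfolding gauss_inner_def using Bochner_Integration.integral_cnj[of gauss "\<lambda>w. f w * cnj (g w)"] by simp
qed

lemma gauss_inner_add_left:
  assumes "square_integrable_gauss f" "square_integrable_gauss g" "square_integrable_gauss h"
  shows "gauss_inner (\<lambda>w. f w + g w) h = gauss_inner f h + gauss_inner g h"
  using assms by (simp add: gauss_inner_def distrib_right integrable_sqi_inner)

lemma gauss_inner_diff_left:
  assumes "square_integrable_gauss f" "square_integrable_gauss g" "square_integrable_gauss h"
  shows "gauss_inner (\<lambda>w. f w - g w) h = gauss_inner f h - gauss_inner g h"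
  using assms by (simp add: gauss_inner_def left_diff_distrib integrable_sqi_inner)

lemma gauss_inner_cmult_left: "gauss_inner (\<lambda>w. c * f w) h = c * gauss_inner f h"
  by (simp add: gauss_inner_def mult.assoc)

lemma gauss_inner_cmult_right: "gauss_inner f (\<lambda>w. c * h w) = cnj c * gauss_inner f h"
  by (simp add: gauss_inner_def mult_ac)

lemma gauss_inner_diff_right:
  assumes "square_integrable_gauss f" "square_integrable_gauss g" "square_integrable_gauss h"
  shows "gauss_inner h (\<lambda>w. f w - g w) = gauss_inner h f - gauss_inner h g"
  using assms by (simp add: gauss_inner_def right_diff_distrib integrable_sqi_inner)

lemma gauss_inner_sum_right:
  assumes "\<And>i. i \<in> I \<Longrightarrow> square_integrable_gauss (f i)" "square_integrable_gauss h"
  shows "gauss_inner h (\<lambda>w. \<Sum>i\<in>I. f i w) = (\<Sum>i\<in>I. gauss_inner h (f i))"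
  using assms by (simp add: gauss_inner_def sum_distrib_left integrable_sqi_inner)

lemma integral_norm_mult_le:
  assumes "square_integrable_gauss f" "square_integrable_gauss g"
  shows "(LINT w|gauss. norm (f w) * norm (g w)) \<le> gauss_norm f * gauss_norm g"
proof -
  note [measurable] = assms[THEN sqi_measurable]
  have "(\<integral>\<^sup>+w. ennreal (norm (f w)) * ennreal (norm (g w)) \<partial>gauss)\<^sup>2
      \<le> (\<integral>\<^sup>+w. (ennreal (norm (f w)))\<^sup>2 \<partial>gauss) * (\<integral>\<^sup>+w. (ennreal (norm (g w)))\<^sup>2 \<partial>gauss)"
    by (rule Cauchy_Schwarz_nn_integral) auto
  also have "(\<integral>\<^sup>+w. (ennreal (norm (f w)))\<^sup>2 \<partial>gauss) = ennreal ((gauss_norm f)\<^sup>2)"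
    unfolding gauss_norm_power2 using integrable_sqi[OF assms(1)]
    by (subst nn_integral_eq_integral[symmetric]) (auto simp: ennreal_power)
  also have "(\<integral>\<^sup>+w. (ennreal (norm (g w)))\<^sup>2 \<partial>gauss) = ennreal ((gauss_norm g)\<^sup>2)"
    unfolding gauss_norm_power2 using integrable_sqi[OF assms(2)]
    by (subst nn_integral_eq_integral[symmetric]) (auto simp: ennreal_power)
  also have "(\<integral>\<^sup>+w. ennreal (norm (f w)) * ennreal (norm (g w)) \<partial>gauss)
      = ennreal (LINT w|gauss. norm (f w) * norm (g w))"
    using integrable_sqi_mult[OF assms]
    by (subst nn_integral_eq_integral[symmetric]) (auto simp: ennreal_mult)
  finally have "ennreal ((LINT w|gauss. norm (f w) * norm (g w))\<^sup>2) \<le> ennreal ((gauss_norm f * gauss_norm g)\<^sup>2)"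
    by (simp add: ennreal_power flip: ennreal_mult add: power_mult_distrib)
  then have "(LINT w|gauss. norm (f w) * norm (g w))\<^sup>2 \<le> (gauss_norm f * gauss_norm g)\<^sup>2"
    by simp
  then show ?thesis
    by (rule power2_le_imp_le) simp
qed

lemma norm_gauss_inner_le:
  assumes "square_integrable_gauss f" "square_integrable_gauss g"
  shows "norm (gauss_inner f g) \<le> gauss_norm f * gauss_norm g"
proof -
  have "norm (gauss_inner f g) \<le> (LINT w|gauss. norm (f w * cnj (g w)))"
    unfolding gauss_inner_def by (rule integral_norm_bound)
  also have "\<dots> \<le> gauss_norm f * gauss_norm g"
    using integral_norm_mult_le[OF assms] by (simp add: norm_mult)
  finally show ?thesis .
qed

text \<open>The Gaussian density is positive everywhere, so a null set contains no ball, while the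
  nonzero set of a continuous function is open.\<close>

lemma gauss_norm_eq_0_imp:
  assumes "square_integrable_gauss f" "continuous_on UNIV f" "gauss_norm f = 0"
  shows "f = (\<lambda>w. 0)"
proof (rule ccontr)
  note [measurable] = assms(1)[THEN sqi_measurable]
  assume "f \<noteq> (\<lambda>w. 0)"
  then obtain z where "f z \<noteq> 0" by auto
  have "open {w. f w \<noteq> 0}"
    using assms(2) by (intro open_Collect_neq continuous_intros)
  then obtain r where r: "r > 0" "ball z r \<subseteq> {w. f w \<noteq> 0}"
    using \<open>f z \<noteq> 0\<close> by (metis (mono_tags) mem_Collect_eq openE)
  have "(LINT w|gauss. (norm (f w))\<^sup>2) = 0"
    using assms(3) gauss_norm_power2[of f] by simp
  then have "AE w in gauss. f w = 0"
    using integral_nonneg_eq_0_iff_AE[OF integrable_sqi[OF assms(1)]] by simp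
  then have "AE w in lborel. f w = 0"
    unfolding gauss_def by (subst (asm) AE_density) auto
  then have "emeasure lborel {w. f w \<noteq> 0} = 0"
    by (subst (asm) AE_iff_measurable[OF _ refl]) auto
  then have "emeasure lborel (ball z r) = 0"
    using emeasure_mono[OF r(2), of lborel] by simp
  then show False
    using r(1) by (simp add: emeasure_ball unit_ball_vol_2)
qed

section \<open>Monomials\<close>

definition bimonom :: "nat \<Rightarrow> nat \<Rightarrow> complex \<Rightarrow> complex" where
  "bimonom a b w = w ^ a * cnj w ^ b"

lemma bimonom_measurable [measurable]: "bimonom a b \<in> borel_measurable borel"
  unfolding bimonom_def[abs_def] by measurable

lemma norm_bimonom: "norm (bimonom a b w) = (norm w) ^ (a + b)"
  by (simp add: bimonom_def norm_mult norm_power power_add)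

lemma sqi_bimonom [simp]: "square_integrable_gauss (bimonom a b)"
  using integrable_gauss_norm_power[of "(a + b) * 2"]
  by (simp add: square_integrable_gauss_def norm_bimonom power_mult[symmetric])

text \<open>On the unit circle \<open>c ^ a * cnj c ^ b\<close> is a power of c with nonzero
  exponent a - b; the angle pi/|a - b| gives the value -1, which differs from 1 as
  \<open>integral_gauss_rotate_eq_0\<close> requires.\<close>

lemma rotation_character:
  assumes "a \<noteq> (b::nat)"
  obtains c :: complex where "norm c = 1" "c ^ a * cnj c ^ b = -1"
proof -
  have *: "\<exists>c::complex. norm c = 1 \<and> c ^ a * cnj c ^ b = -1 \<and> c ^ b * cnj c ^ a = -1"
    if "b < a" for a b :: nat
  proof -
    define c where "c = cis (pi / real (a - b))"
    have n: "c * cnj c = 1" by (simp add: c_def cis_mult cis_cnj)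
    have e: "c ^ (a - b) = -1"
      using that unfolding c_def Complex.DeMoivre by (simp del: of_nat_diff)
    have a: "a = b + (a - b)" using that by simp
    have "c ^ a * cnj c ^ b = (c * cnj c) ^ b * c ^ (a - b)"
      by (subst a) (simp add: power_add power_mult_distrib)
    then have 1: "c ^ a * cnj c ^ b = -1" by (simp add: n e)
    have "cnj (c ^ a * cnj c ^ b) = -1" unfolding 1 by simp
    then have "c ^ b * cnj c ^ a = -1" by (simp add: mult.commute)
    with 1 show ?thesis by (intro exI[of _ c]) (simp add: c_def)
  qed
  show ?thesis
    using *[of a b] *[of b a] assms that by (metis linorder_neqE_nat)
qed

lemma gauss_inner_bimonom:
  "gauss_inner (bimonom a b) (bimonom c d) = (if a + d = b + c then fact (a + d) else 0)"
proof (cases "a + d = b + c")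
  case True
  have "gauss_inner (bimonom a b) (bimonom c d) = (LINT w|gauss. of_real ((norm w) ^ (2 * (a + d))))"
    unfolding gauss_inner_def
  proof (rule Bochner_Integration.integral_cong[OF refl])
    fix w :: complex
    have "bimonom a b w * cnj (bimonom c d w) = w ^ (a + d) * cnj w ^ (b + c)"
      by (simp add: bimonom_def power_add)
    also have "\<dots> = (w * cnj w) ^ (a + d)"
      unfolding True[symmetric] by (simp add: power_mult_distrib)
    also have "\<dots> = of_real ((norm w) ^ (2 * (a + d)))"
      by (simp only: complex_norm_square[symmetric] power_mult of_real_power)
    finally show "bimonom a b w * cnj (bimonom c d w) = of_real ((norm w) ^ (2 * (a + d)))" .
  qed
  also have "\<dots> = of_real (fact (a + d))"
    unfolding integral_complex_of_real
    by (simp only: has_bochner_integral_integral_eq[OF has_bochner_integral_gauss_moment])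
  finally show ?thesis using True by simp
next
  case False
  obtain e where e: "norm e = 1" "e ^ (a + d) * cnj e ^ (b + c) = -1"
    using rotation_character[OF False] .
  have "(LINT w|gauss. bimonom a b w * cnj (bimonom c d w)) = 0"
  proof (rule integral_gauss_rotate_eq_0[where c=e and \<mu>="-1"])
    fix z
    have "bimonom a b (e * z) * cnj (bimonom c d (e * z))
        = (e ^ (a + d) * cnj e ^ (b + c)) * (bimonom a b z * cnj (bimonom c d z))"
      by (simp add: bimonom_def power_mult_distrib power_add mult_ac)
    then show "bimonom a b (e * z) * cnj (bimonom c d (e * z)) = -1 * (bimonom a b z * cnj (bimonom c d z))"
      by (simp add: e)
  qed (auto simp: e)
  with False show ?thesis by (simp add: gauss_inner_def)
qed

section \<open>Wirtinger calculus and polyanalytic functions\<close>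

text \<open>Every real linear map of the plane has the form v -> a v + b cnj v with unique a and b,
  which are the two Wirtinger derivatives. As a relation it carries differentiability along with the
  values, so the rules below compute both at once.\<close>

definition has_wirtinger :: "(complex \<Rightarrow> complex) \<Rightarrow> complex \<Rightarrow> complex \<Rightarrow> complex \<Rightarrow> bool" where
  "has_wirtinger f a b w \<longleftrightarrow> (f has_derivative (\<lambda>v. a * v + b * cnj v)) (at w)"

lemma has_wirtingerD:
  assumes "has_wirtinger f a b w"
  shows "f differentiable (at w)" "partial_x f w = a + b" "partial_y f w = \<i> * (a - b)"
    "d_z f w = a" "d_zbar f w = b"
proof -
  have D: "(f has_derivative (\<lambda>v. a * v + b * cnj v)) (at w)"
    using assms by (simp add: has_wirtinger_def)
  then show "f differentiable (at w)"
    by (auto simp: differentiable_def)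
  show x: "partial_x f w = a + b" and y: "partial_y f w = \<i> * (a - b)"
    unfolding partial_x_def partial_y_def frechet_derivative_at[OF D, symmetric]
    by (simp_all add: algebra_simps)
  show "d_z f w = a" "d_zbar f w = b"
    unfolding d_z_def d_zbar_def x y by (simp_all add: algebra_simps)
qed

lemma has_wirtinger_differentiable:
  assumes "f differentiable (at w)"
  shows "has_wirtinger f (d_z f w) (d_zbar f w) w"
proof -
  let ?L = "frechet_derivative f (at w)"
  have D: "(f has_derivative ?L) (at w)"
    using assms by (simp add: frechet_derivative_works)
  then have lin: "linear ?L"
    by (rule has_derivative_linear)
  have "?L v = d_z f w * v + d_zbar f w * cnj v" for v
  proof -
    have "v = Re v *\<^sub>R 1 + Im v *\<^sub>R \<i>"
      by (simp add: complex_eq_iff)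
    then have "?L v = ?L (Re v *\<^sub>R 1 + Im v *\<^sub>R \<i>)" by simp
    also have "\<dots> = Re v *\<^sub>R partial_x f w + Im v *\<^sub>R partial_y f w"
      by (simp only: linear_add[OF lin] linear_scale[OF lin] partial_x_def partial_y_def)
    also have "\<dots> = d_z f w * v + d_zbar f w * cnj v"
      by (simp add: d_z_def d_zbar_def complex_eq_iff algebra_simps diff_divide_distrib add_divide_distrib)
    finally show ?thesis .
  qed
  then have "?L = (\<lambda>v. d_z f w * v + d_zbar f w * cnj v)" by auto
  with D show ?thesis by (simp add: has_wirtinger_def)
qed

lemma has_wirtinger_holomorphic:
  assumes "(f has_field_derivative a) (at w)"
  shows "has_wirtinger f a 0 w"
  using assms by (simp add: has_wirtinger_def has_field_derivative_def)

lemma has_wirtinger_cnj: "has_wirtinger cnj 0 1 w"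
  unfolding has_wirtinger_def by (auto intro!: derivative_eq_intros)

lemma has_wirtinger_add:
  assumes "has_wirtinger f a b w" "has_wirtinger g a' b' w"
  shows "has_wirtinger (\<lambda>w. f w + g w) (a + a') (b + b') w"
  using has_derivative_add[OF assms[unfolded has_wirtinger_def]]
  by (simp add: has_wirtinger_def algebra_simps)

lemma has_wirtinger_mult:
  assumes "has_wirtinger f a b w" "has_wirtinger g a' b' w"
  shows "has_wirtinger (\<lambda>w. f w * g w) (a * g w + f w * a') (b * g w + f w * b') w"
  using has_derivative_mult[OF assms[unfolded has_wirtinger_def]]
  by (simp add: has_wirtinger_def algebra_simps)

lemma has_wirtinger_const: "has_wirtinger (\<lambda>w. c) 0 0 w"
  by (simp add: has_wirtinger_def)

lemma has_wirtinger_cmult: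
  "has_wirtinger f a b w \<Longrightarrow> has_wirtinger (\<lambda>w. c * f w) (c * a) (c * b) w"
  using has_wirtinger_mult[OF has_wirtinger_const] by simp

lemma has_wirtinger_sum:
  assumes "\<And>i. i \<in> I \<Longrightarrow> has_wirtinger (f i) (a i) (b i) w"
  shows "has_wirtinger (\<lambda>w. \<Sum>i\<in>I. f i w) (\<Sum>i\<in>I. a i) (\<Sum>i\<in>I. b i) w"
  using assms
  by (induction I rule: infinite_finite_induct) (auto intro: has_wirtinger_add has_wirtinger_const)

lemma has_wirtinger_cnj_power:
  "has_wirtinger (\<lambda>w. cnj w ^ n) 0 (of_nat n * cnj w ^ (n - 1)) w"
proof (induction n)
  case (Suc n)
  have "has_wirtinger (\<lambda>w. cnj w * cnj w ^ n) (0 * cnj w ^ n + cnj w * 0)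
     (1 * cnj w ^ n + cnj w * (of_nat n * cnj w ^ (n - 1))) w"
    by (rule has_wirtinger_mult[OF has_wirtinger_cnj Suc])
  moreover have "1 * cnj w ^ n + cnj w * (of_nat n * cnj w ^ (n - 1)) = of_nat (Suc n) * cnj w ^ (Suc n - 1)"
    by (cases n) (auto simp: algebra_simps)
  ultimately show ?case by simp
qed (simp add: has_wirtinger_const)

text \<open>The solutions of the n-th order equation in \<open>d_zbar\<close>, written as
  polynomials in \<open>cnj w\<close> with entire coefficients. In this form the spaces are handled
  by algebra on coefficients.\<close>

definition polyanalytic :: "nat \<Rightarrow> (complex \<Rightarrow> complex) \<Rightarrow> bool" where
  "polyanalytic n f \<longleftrightarrow>
     (\<exists>h. (\<forall>i. h i holomorphic_on UNIV) \<and> f = (\<lambda>w. \<Sum>i<n. cnj w ^ i * h i w))"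

lemma polyanalyticI:
  "(\<And>i. h i holomorphic_on UNIV) \<Longrightarrow> polyanalytic n (\<lambda>w. \<Sum>i<n. cnj w ^ i * h i w)"
  by (auto simp: polyanalytic_def)

lemma polyanalyticE:
  assumes "polyanalytic n f"
  obtains h where "\<And>i. h i holomorphic_on UNIV" "f = (\<lambda>w. \<Sum>i<n. cnj w ^ i * h i w)"
  using assms by (auto simp: polyanalytic_def)

lemma polyanalytic_0 [simp]: "polyanalytic 0 f \<longleftrightarrow> f = (\<lambda>w. 0)"
  by (auto simp: polyanalytic_def intro!: exI[of _ "\<lambda>_ _. 0"])

lemma polyanalytic_1: "polyanalytic (Suc 0) f \<longleftrightarrow> f holomorphic_on UNIV"
  by (auto simp: polyanalytic_def intro!: exI[of _ "\<lambda>_. f"])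

lemma polyanalytic_add:
  assumes "polyanalytic n f" "polyanalytic n g"
  shows "polyanalytic n (\<lambda>w. f w + g w)"
proof -
  obtain h where h: "\<And>i. h i holomorphic_on UNIV" "f = (\<lambda>w. \<Sum>i<n. cnj w ^ i * h i w)"
    using polyanalyticE[OF assms(1)] by metis
  obtain k where k: "\<And>i. k i holomorphic_on UNIV" "g = (\<lambda>w. \<Sum>i<n. cnj w ^ i * k i w)"
    using polyanalyticE[OF assms(2)] by metis
  have "polyanalytic n (\<lambda>w. \<Sum>i<n. cnj w ^ i * (h i w + k i w))"
    by (intro polyanalyticI holomorphic_intros h k)
  then show ?thesis
    by (simp add: h k distrib_left sum.distrib)
qed

lemma polyanalytic_cmult:
  assumes "polyanalytic n f"
  shows "polyanalytic n (\<lambda>w. c * f w)"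
proof -
  obtain h where h: "\<And>i. h i holomorphic_on UNIV" "f = (\<lambda>w. \<Sum>i<n. cnj w ^ i * h i w)"
    using polyanalyticE[OF assms(1)] by metis
  have "polyanalytic n (\<lambda>w. \<Sum>i<n. cnj w ^ i * (c * h i w))"
    by (intro polyanalyticI holomorphic_intros h)
  then show ?thesis
    by (simp add: h sum_distrib_left mult_ac)
qed

lemma polyanalytic_diff:
  "polyanalytic n f \<Longrightarrow> polyanalytic n g \<Longrightarrow> polyanalytic n (\<lambda>w. f w - g w)"
  using polyanalytic_add[of n f "\<lambda>w. -1 * g w"] polyanalytic_cmult[of n g "-1"] by simp

lemma polyanalytic_mono:
  assumes "polyanalytic n f" "n \<le> m"
  shows "polyanalytic m f"
proof -
  obtain h where h: "\<And>i. h i holomorphic_on UNIV" "f = (\<lambda>w. \<Sum>i<n. cnj w ^ i * h i w)"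
    using polyanalyticE[OF assms(1)] by metis
  have "polyanalytic m (\<lambda>w. \<Sum>i<m. cnj w ^ i * (if i < n then h i else (\<lambda>_. 0)) w)"
    by (intro polyanalyticI) (auto intro: h)
  moreover have "(\<Sum>i<m. cnj w ^ i * (if i < n then h i else (\<lambda>_. 0)) w) = f w" for w
    unfolding h(2) using assms(2) by (intro sum.mono_neutral_cong_right) auto
  ultimately show ?thesis by simp
qed

lemma polyanalytic_cnj_mult:
  assumes "polyanalytic n f"
  shows "polyanalytic (Suc n) (\<lambda>w. cnj w * f w)"
proof -
  obtain h where h: "\<And>i. h i holomorphic_on UNIV" "f = (\<lambda>w. \<Sum>i<n. cnj w ^ i * h i w)"
    using polyanalyticE[OF assms(1)] by metis
  have "polyanalytic (Suc n) (\<lambda>w. \<Sum>i<Suc n. cnj w ^ i * (case i of 0 \<Rightarrow> (\<lambda>_. 0) | Suc j \<Rightarrow> h j) w)"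
    by (intro polyanalyticI) (auto intro: h split: nat.split)
  moreover have "(\<Sum>i<Suc n. cnj w ^ i * (case i of 0 \<Rightarrow> (\<lambda>_. 0) | Suc j \<Rightarrow> h j) w) = cnj w * f w" for w
    unfolding h(2) by (subst sum.lessThan_Suc_shift) (simp add: sum_distrib_left mult.assoc)
  ultimately show ?thesis by simp
qed

lemma polyanalytic_term:
  assumes "g holomorphic_on UNIV" "i < n"
  shows "polyanalytic n (\<lambda>w. cnj w ^ i * g w)"
proof -
  have "polyanalytic (Suc i) (\<lambda>w. cnj w ^ i * g w)"
    by (induction i) (use assms polyanalytic_cnj_mult in \<open>auto simp: polyanalytic_1 mult.assoc\<close>)
  then show ?thesis
    using assms(2) polyanalytic_mono by (meson Suc_leI)
qed

lemma has_wirtinger_polyanalytic: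
  assumes "\<And>i. h i holomorphic_on UNIV"
  shows "has_wirtinger (\<lambda>w. \<Sum>i<n. cnj w ^ i * h i w) (\<Sum>i<n. cnj w ^ i * deriv (h i) w)
     (\<Sum>i<n. of_nat i * cnj w ^ (i - 1) * h i w) w"
proof (rule has_wirtinger_sum)
  fix i
  have "(h i has_field_derivative deriv (h i) w) (at w)"
    using assms by (meson UNIV_I holomorphic_derivI open_UNIV)
  then have "has_wirtinger (h i) (deriv (h i) w) 0 w"
    by (rule has_wirtinger_holomorphic)
  from has_wirtinger_mult[OF has_wirtinger_cnj_power this]
  show "has_wirtinger (\<lambda>w. cnj w ^ i * h i w) (cnj w ^ i * deriv (h i) w) (of_nat i * cnj w ^ (i - 1) * h i w) w"
    by simp
qed

lemma polyanalytic_differentiable: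
  assumes "polyanalytic n f"
  shows "f differentiable (at w)"
  by (rule polyanalyticE[OF assms]) (use has_wirtingerD(1)[OF has_wirtinger_polyanalytic] in auto)

lemma polyanalytic_continuous: "polyanalytic n f \<Longrightarrow> continuous_on UNIV f"
  by (meson polyanalytic_differentiable differentiable_imp_continuous_within continuous_at_imp_continuous_on)

lemma polyanalytic_d_z:
  assumes "polyanalytic n f"
  shows "polyanalytic n (d_z f)"
proof -
  obtain h where h: "\<And>i. h i holomorphic_on UNIV" "f = (\<lambda>w. \<Sum>i<n. cnj w ^ i * h i w)"
    using polyanalyticE[OF assms(1)] by metis
  have "d_z f = (\<lambda>w. \<Sum>i<n. cnj w ^ i * deriv (h i) w)"
    unfolding h(2) by (intro ext has_wirtingerD(4)[OF has_wirtinger_polyanalytic] h)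
  then show ?thesis
    by (simp only:) (intro polyanalyticI holomorphic_deriv h open_UNIV)
qed

lemma polyanalytic_d_zbar:
  assumes "polyanalytic (Suc n) f"
  shows "polyanalytic n (d_zbar f)"
proof -
  obtain h where h: "\<And>i. h i holomorphic_on UNIV" "f = (\<lambda>w. \<Sum>i<Suc n. cnj w ^ i * h i w)"
    using polyanalyticE[OF assms(1)] by metis
  have "d_zbar f = (\<lambda>w. \<Sum>i<Suc n. of_nat i * cnj w ^ (i - 1) * h i w)"
    unfolding h(2) by (intro ext has_wirtingerD(5)[OF has_wirtinger_polyanalytic] h)
  also have "\<dots> = (\<lambda>w. \<Sum>i<n. cnj w ^ i * (of_nat (Suc i) * h (Suc i) w))"
    by (subst sum.lessThan_Suc_shift) (simp add: mult_ac)
  finally show ?thesis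
    by (simp only:) (intro polyanalyticI holomorphic_intros h)
qed

lemma polyanalytic_d_zbar': "polyanalytic n f \<Longrightarrow> polyanalytic n (d_zbar f)"
  using polyanalytic_d_zbar polyanalytic_mono by (meson lessI less_imp_le)

lemma partial_x_eq:
  "f differentiable (at w) \<Longrightarrow> partial_x f w = d_z f w + d_zbar f w"
  and partial_y_eq:
  "f differentiable (at w) \<Longrightarrow> partial_y f w = \<i> * (d_z f w + (-1) * d_zbar f w)"
  using has_wirtingerD(2,3)[OF has_wirtinger_differentiable] by auto

lemma polyanalytic_smooth:
  assumes "polyanalytic n f"
  shows "smooth f"
  unfolding smooth_def
proof
  fix m
  show "C_k m f"
    using assms
  proof (induction m arbitrary: f)
    case (Suc m)
    note d = polyanalytic_differentiable[OF Suc.prems]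
    have "partial_x f = (\<lambda>w. d_z f w + d_zbar f w)"
      "partial_y f = (\<lambda>w. \<i> * (d_z f w + (-1) * d_zbar f w))"
      using partial_x_eq[OF d] partial_y_eq[OF d] by auto
    then have "polyanalytic n (partial_x f)" "polyanalytic n (partial_y f)"
      by (simp_all only:)
        (intro polyanalytic_add polyanalytic_cmult polyanalytic_d_z polyanalytic_d_zbar' Suc.prems)+
    with Suc d show ?case by simp
  qed (simp add: polyanalytic_continuous)
qed

lemma polyanalytic_d_zbar_power:
  "polyanalytic n f \<Longrightarrow> (d_zbar ^^ n) f = (\<lambda>w. 0)"
proof (induction n arbitrary: f)
  case (Suc n)
  then show ?case
    using polyanalytic_d_zbar[OF Suc.prems] by (simp add: funpow_Suc_right del: funpow.simps)
qed simp

lemma C_k_lincomb: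
  "C_k n f \<Longrightarrow> C_k n g \<Longrightarrow> C_k n (\<lambda>w. a * f w + b * g w)"
proof (induction n arbitrary: f g)
  case 0
  then show ?case by (auto intro!: continuous_intros)
next
  case (Suc n)
  then have d: "f differentiable (at w)" "g differentiable (at w)" for w by auto
  have W: "has_wirtinger (\<lambda>w. a * f w + b * g w) (a * d_z f w + b * d_z g w) (a * d_zbar f w + b * d_zbar g w) w" for w
    by (intro has_wirtinger_add has_wirtinger_cmult has_wirtinger_differentiable d)
  have "partial_x (\<lambda>w. a * f w + b * g w) = (\<lambda>w. a * partial_x f w + b * partial_x g w)"
    "partial_y (\<lambda>w. a * f w + b * g w) = (\<lambda>w. a * partial_y f w + b * partial_y g w)"
    using has_wirtingerD(2,3)[OF W] by (auto simp: partial_x_eq[OF d(1)] partial_x_eq[OF d(2)]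
      partial_y_eq[OF d(1)] partial_y_eq[OF d(2)] algebra_simps)
  then show ?case
    using Suc has_wirtingerD(1)[OF W] by simp
qed

lemma smooth_d_zbar:
  assumes "smooth f"
  shows "smooth (d_zbar f)"
proof -
  have "d_zbar f = (\<lambda>w. (1/2) * partial_x f w + (\<i>/2) * partial_y f w)"
    by (auto simp: d_zbar_def field_simps)
  moreover have "C_k n (partial_x f)" "C_k n (partial_y f)" for n
    using assms unfolding smooth_def by (metis C_k.simps(2))+
  ultimately show ?thesis
    unfolding smooth_def by (metis C_k_lincomb)
qed

text \<open>By induction \<open>d_zbar f\<close> has order n. It has an explicit primitive F of
  order n+1 for \<open>d_zbar\<close>, and f - F satisfies the Cauchy-Riemann equations, hence is
  entire.\<close>

lemma smooth_imp_polyanalytic: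
  "smooth f \<Longrightarrow> (d_zbar ^^ n) f = (\<lambda>w. 0) \<Longrightarrow> polyanalytic n f"
proof (induction n arbitrary: f)
  case (Suc n)
  have "(d_zbar ^^ n) (d_zbar f) = (\<lambda>w. 0)"
    using Suc.prems(2) by (simp add: funpow_Suc_right del: funpow.simps)
  then have "polyanalytic n (d_zbar f)"
    using Suc smooth_d_zbar by blast
  then obtain h where h: "\<And>i. h i holomorphic_on UNIV" "d_zbar f = (\<lambda>w. \<Sum>i<n. cnj w ^ i * h i w)"
    using polyanalyticE by metis
  \<comment> \<open>Integration in \<open>cnj w\<close>: the term \<open>cnj w ^ j\<close> with
    coefficient \<open>h j\<close> comes from \<open>cnj w ^ Suc j\<close> with coefficient
    \<open>h j / Suc j\<close>.\<close>
  define k where "k = (\<lambda>i. case i of 0 \<Rightarrow> (\<lambda>_. 0) | Suc j \<Rightarrow> (\<lambda>w. h j w / of_nat (Suc j)))"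
  have k: "k i holomorphic_on UNIV" for i
    by (auto simp: k_def split: nat.split intro!: holomorphic_intros h)
  define F where "F = (\<lambda>w. \<Sum>i<Suc n. cnj w ^ i * k i w)"
  have F: "polyanalytic (Suc n) F"
    unfolding F_def by (rule polyanalyticI[OF k])
  have "d_zbar F = (\<lambda>w. \<Sum>i<Suc n. of_nat i * cnj w ^ (i - 1) * k i w)"
    unfolding F_def by (intro ext has_wirtingerD(5)[OF has_wirtinger_polyanalytic] k)
  also have "\<dots> = d_zbar f"
    unfolding h(2) by (subst sum.lessThan_Suc_shift) (simp add: k_def field_simps del: of_nat_Suc)
  finally have dF: "d_zbar F = d_zbar f" .
  have df: "f differentiable (at w)" for w
    using Suc.prems(1) unfolding smooth_def by (metis C_k.simps(2))
  have "((\<lambda>w. f w + (-1) * F w) has_field_derivative (d_z f w + (-1) * d_z F w)) (at w)" for w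
  proof -
    have "has_wirtinger (\<lambda>w. f w + (-1) * F w) (d_z f w + (-1) * d_z F w) (d_zbar f w + (-1) * d_zbar F w) w"
      by (intro has_wirtinger_add has_wirtinger_cmult has_wirtinger_differentiable df
          polyanalytic_differentiable[OF F])
    then show ?thesis
      by (simp add: dF has_wirtinger_def has_field_derivative_def)
  qed
  then have "(\<lambda>w. f w + (-1) * F w) holomorphic_on UNIV"
    by (meson holomorphic_on_open open_UNIV)
  then have "polyanalytic (Suc n) (\<lambda>w. f w + (-1) * F w)"
    using polyanalytic_1 polyanalytic_mono by (meson Suc_le_mono le0)
  from polyanalytic_add[OF this F] show ?case by simp
qed simp

lemma mem_polyfock_iff: "f \<in> polyfock n \<longleftrightarrow> polyanalytic n f \<and> square_integrable_gauss f"
  unfolding polyfock_def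
  using smooth_imp_polyanalytic polyanalytic_smooth polyanalytic_d_zbar_power by blast

section \<open>Powers of the creation operator\<close>

lemma creation_eqI: "has_wirtinger f a b w \<Longrightarrow> creation f w = - a + cnj w * f w"
  by (simp add: creation_def has_wirtingerD(4))

lemma polyanalytic_creation:
  assumes "polyanalytic n f"
  shows "polyanalytic (Suc n) (creation f)"
proof -
  have "creation f = (\<lambda>w. (-1) * d_z f w + cnj w * f w)"
    by (auto simp: creation_def)
  moreover have "polyanalytic (Suc n) (d_z f)"
    by (rule polyanalytic_mono[OF polyanalytic_d_z[OF assms]]) simp
  ultimately show ?thesis
    using assms by (simp only:) (intro polyanalytic_add polyanalytic_cmult polyanalytic_cnj_mult)
qed

lemma polyanalytic_creation_power:
  "polyanalytic n f \<Longrightarrow> polyanalytic (n + m) ((creation ^^ m) f)"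
  by (induction m) (auto intro: polyanalytic_creation)

lemma creation_lincomb:
  assumes "f differentiable (at w)" "g differentiable (at w)"
  shows "creation (\<lambda>w. a * f w + b * g w) w = a * creation f w + b * creation g w"
proof -
  have "has_wirtinger (\<lambda>w. a * f w + b * g w) (a * d_z f w + b * d_z g w) (a * d_zbar f w + b * d_zbar g w) w"
    by (intro has_wirtinger_add has_wirtinger_cmult has_wirtinger_differentiable assms)
  from creation_eqI[OF this] show ?thesis
    by (simp add: creation_def algebra_simps)
qed

lemma creation_power_lincomb:
  assumes "polyanalytic n f" "polyanalytic n g"
  shows "(creation ^^ m) (\<lambda>w. a * f w + b * g w) = (\<lambda>w. a * (creation ^^ m) f w + b * (creation ^^ m) g w)"
proof (induction m)
  case (Suc m)
  have "(creation ^^ m) f differentiable (at w)" "(creation ^^ m) g differentiable (at w)" for w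
    using assms polyanalytic_creation_power polyanalytic_differentiable by blast+
  then show ?case
    using Suc by (auto intro!: creation_lincomb)
qed simp

text \<open>Of the two parts of \<open>creation\<close> only multiplication by \<open>cnj w\<close>
  raises the order; differentiation in z leaves it unchanged. The top coefficient of
  \<open>(creation ^^ m) g\<close> is therefore g itself.\<close>

lemma creation_power_leading:
  assumes "g holomorphic_on UNIV"
  shows "polyanalytic m (\<lambda>w. (creation ^^ m) g w - cnj w ^ m * g w)"
proof (induction m)
  case (Suc m)
  let ?l = "\<lambda>w. (creation ^^ m) g w - cnj w ^ m * g w"
  have g: "(g has_field_derivative deriv g w) (at w)" for w
    using assms by (meson UNIV_I holomorphic_derivI open_UNIV)
  have lead: "has_wirtinger (\<lambda>w. cnj w ^ m * g w) (cnj w ^ m * deriv g w) (of_nat m * cnj w ^ (m - 1) * g w) w" for w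
    using has_wirtinger_mult[OF has_wirtinger_cnj_power has_wirtinger_holomorphic[OF g]] by simp
  have "creation ((creation ^^ m) g) w = creation ?l w - cnj w ^ m * deriv g w + cnj w ^ Suc m * g w" for w
  proof -
    have "creation (\<lambda>w. 1 * ?l w + 1 * (cnj w ^ m * g w)) w = 1 * creation ?l w + 1 * creation (\<lambda>w. cnj w ^ m * g w) w"
      by (intro creation_lincomb polyanalytic_differentiable[OF Suc] has_wirtingerD(1)[OF lead])
    then show ?thesis
      by (simp add: creation_eqI[OF lead])
  qed
  then have "(\<lambda>w. (creation ^^ Suc m) g w - cnj w ^ Suc m * g w)
     = (\<lambda>w. creation ?l w - cnj w ^ m * deriv g w)"
    by auto
  moreover have "polyanalytic (Suc m) (\<lambda>w. creation ?l w - cnj w ^ m * deriv g w)"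
    by (intro polyanalytic_diff polyanalytic_creation Suc polyanalytic_term holomorphic_deriv assms) auto
  ultimately show ?case by simp
qed simp

lemma measurable_ball [measurable]: "Measurable.pred borel (\<lambda>x::complex. x \<in> ball a r)"
  by (simp add: pred_def)

lemma gauss_inner_lincomb_right:
  assumes "square_integrable_gauss f" "square_integrable_gauss g" "square_integrable_gauss h"
  shows "gauss_inner h (\<lambda>w. a * f w + b * g w) = cnj a * gauss_inner h f + cnj b * gauss_inner h g"
proof -
  have "integrable gauss (\<lambda>w. h w * cnj (a * f w))" "integrable gauss (\<lambda>w. h w * cnj (b * g w))"
    using assms by (intro integrable_sqi_inner sqi_cmult; simp)+
  then have "gauss_inner h (\<lambda>w. a * f w + b * g w) = gauss_inner h (\<lambda>w. a * f w) + gauss_inner h (\<lambda>w. b * g w)"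
    by (simp add: gauss_inner_def distrib_left del: complex_cnj_mult)
  then show ?thesis by (simp only: gauss_inner_cmult_right)
qed

section \<open>Pairing monomials with powers of the creation operator\<close>

lemma has_wirtinger_mono:
  "has_wirtinger (bimonom a b) (of_nat a * bimonom (a - 1) b w) (of_nat b * bimonom a (b - 1) w) w"
proof -
  have "((\<lambda>w. w ^ a) has_field_derivative of_nat a * w ^ (a - 1)) (at w)"
    by (auto intro!: derivative_eq_intros)
  from has_wirtinger_mult[OF has_wirtinger_holomorphic[OF this] has_wirtinger_cnj_power, of b]
  show ?thesis by (simp add: bimonom_def[abs_def] mult_ac)
qed

lemma polyanalytic_monomial: "polyanalytic (Suc b) (bimonom a b)"
proof -
  have "polyanalytic (Suc b) (\<lambda>w. cnj w ^ b * w ^ a)"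
    by (intro polyanalytic_term holomorphic_intros) simp
  then show ?thesis by (simp add: bimonom_def[abs_def] mult.commute)
qed

lemma creation_mono: "creation (bimonom a b) = (\<lambda>w. 1 * bimonom a (Suc b) w + (- of_nat a) * bimonom (a - 1) b w)"
  by (rule ext) (simp add: creation_eqI[OF has_wirtinger_mono], simp add: bimonom_def)

text \<open>Peeling off the innermost factor keeps inductions on m inside the monomials, with a and
  b arbitrary. The truncated \<open>a - 1\<close> is harmless, since at a = 0 its factor
  vanishes.\<close>

lemma creation_power_Suc_mono:
  "(creation ^^ Suc m) (bimonom a b)
     = (\<lambda>w. 1 * (creation ^^ m) (bimonom a (Suc b)) w + (- of_nat a) * (creation ^^ m) (bimonom (a - 1) b) w)"
proof -
  have "polyanalytic (Suc (Suc b)) (bimonom (a - 1) b)"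
    by (rule polyanalytic_mono[OF polyanalytic_monomial]) simp
  then show ?thesis
    unfolding funpow_Suc_right o_def creation_mono
    by (rule creation_power_lincomb[OF polyanalytic_monomial])
qed

lemma sqi_creation_power_mono: "square_integrable_gauss ((creation ^^ m) (bimonom a b))"
  by (induction m arbitrary: a b) (auto simp: creation_power_Suc_mono simp del: funpow.simps(2) intro!: sqi_diff sqi_cmult)

lemma creation_power_mono_rotate:
  assumes "norm c = 1"
  shows "(creation ^^ m) (bimonom a b) (c * w) = c ^ a * cnj c ^ (b + m) * (creation ^^ m) (bimonom a b) w"
proof (induction m arbitrary: a b)
  case 0
  then show ?case by (simp add: bimonom_def power_mult_distrib)
next
  case (Suc m)
  have "c * cnj c = 1"
    using assms by (simp flip: complex_norm_square)
  then have "of_nat a * (c ^ (a - 1) * cnj c ^ (b + m)) = of_nat a * (c ^ a * cnj c ^ (b + Suc m))"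
    by (cases a) (auto simp: mult_ac)
  then have "- of_nat a * (c ^ (a - 1) * cnj c ^ (b + m) * y) = c ^ a * cnj c ^ (b + Suc m) * (- of_nat a * y)" for y
    by (metis (no_types, lifting) mult.assoc mult.commute mult_minus_left)
  then show ?case
    unfolding creation_power_Suc_mono Suc by (simp only: distrib_left) simp
qed

text \<open>The adjoint of \<open>creation\<close> is \<open>d_zbar\<close>, which takes
  \<open>bimonom c d\<close> to d times \<open>bimonom c (d - 1)\<close>. On monomials this reduces
  to comparing factorials.\<close>

lemma gauss_inner_creation_mono:
  "gauss_inner (bimonom c d) (creation (bimonom a b)) = of_nat d * gauss_inner (bimonom c (d - 1)) (bimonom a b)"
proof -
  have *: "gauss_inner (bimonom c d) (creation (bimonom a b))
    = gauss_inner (bimonom c d) (bimonom a (Suc b)) - of_nat a * gauss_inner (bimonom c d) (bimonom (a - 1) b)"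
    unfolding creation_mono
    by (subst gauss_inner_lincomb_right) (auto simp: sqi_creation_power_mono)
  show ?thesis
  proof (cases "c + Suc b = d + a")
    case True
    have "of_nat d * (fact (c + b) :: complex) = fact (c + Suc b) - of_nat a * fact (c + b)"
    proof -
      have "of_nat (c + Suc b) = (of_nat (d + a) :: complex)" unfolding True ..
      then have d: "of_nat d = (of_nat (c + Suc b) - of_nat a :: complex)" by simp
      have "fact (c + Suc b) = (of_nat (c + Suc b) * fact (c + b) :: complex)"
        by (simp only: add_Suc_right fact_Suc)
      then show ?thesis unfolding d left_diff_distrib by simp
    qed
    moreover have "a > 0 \<Longrightarrow> c + b = d + (a - 1)" "d > 0 \<Longrightarrow> c + b = d - 1 + a"
      using True by auto
    ultimately show ?thesis
      unfolding * gauss_inner_bimonom using True by (cases "a = 0"; cases "d = 0") (simp_all)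
  next
    case False
    then have "a > 0 \<Longrightarrow> c + b \<noteq> d + (a - 1)" "d > 0 \<Longrightarrow> c + b \<noteq> d - 1 + a"
      by auto
    with False show ?thesis
      unfolding * gauss_inner_bimonom by (cases "a = 0"; cases "d = 0") simp_all
  qed
qed

text \<open>Iterating the adjoint relation produces the falling factorial. The vanishing for d < m
  is what makes powers of \<open>creation\<close> blind to lower orders.\<close>

lemma gauss_inner_creation_power_mono:
  "gauss_inner (bimonom c d) ((creation ^^ m) (bimonom a b))
     = (if m \<le> d then fact d / fact (d - m) * gauss_inner (bimonom c (d - m)) (bimonom a b) else 0)"
proof (induction m arbitrary: a b)
  case (Suc m)
  have "gauss_inner (bimonom c d) ((creation ^^ Suc m) (bimonom a b))
    = gauss_inner (bimonom c d) ((creation ^^ m) (bimonom a (Suc b)))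
      - of_nat a * gauss_inner (bimonom c d) ((creation ^^ m) (bimonom (a - 1) b))"
    unfolding creation_power_Suc_mono
    by (subst gauss_inner_lincomb_right) (auto simp: sqi_creation_power_mono)
  also have "\<dots> = (if m \<le> d then fact d / fact (d - m) * (gauss_inner (bimonom c (d - m)) (bimonom a (Suc b))
      - of_nat a * gauss_inner (bimonom c (d - m)) (bimonom (a - 1) b)) else 0)"
    unfolding Suc by (simp add: algebra_simps)
  also have "gauss_inner (bimonom c (d - m)) (bimonom a (Suc b)) - of_nat a * gauss_inner (bimonom c (d - m)) (bimonom (a - 1) b)
     = gauss_inner (bimonom c (d - m)) (creation (bimonom a b))"
    unfolding creation_mono
    by (subst gauss_inner_lincomb_right) (auto simp: sqi_creation_power_mono)
  also have "\<dots> = of_nat (d - m) * gauss_inner (bimonom c (d - m - 1)) (bimonom a b)"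
    by (rule gauss_inner_creation_mono)
  finally have fin: "gauss_inner (bimonom c d) ((creation ^^ Suc m) (bimonom a b))
     = (if m \<le> d then fact d / fact (d - m) * (of_nat (d - m) * gauss_inner (bimonom c (d - m - 1)) (bimonom a b)) else 0)" .
  show ?case
  proof (cases "m < d")
    case True
    then have "(fact (d - m) :: complex) = of_nat (d - m) * fact (d - Suc m)"
      by (subst fact_reduce) auto
    with True show ?thesis
      using fin by (simp del: funpow.simps of_nat_diff)
  qed (use fin in \<open>simp del: funpow.simps\<close>)
qed simp

section \<open>Reading off the leading coefficient of a polyanalytic function\<close>

lemma entire_sums:
  assumes "g holomorphic_on UNIV"
  shows "(\<lambda>n. (deriv ^^ n) g 0 / fact n * w ^ n) sums g w"
  using holomorphic_power_series[of g 0 "norm w + 1" w] assms holomorphic_on_subset by force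

text \<open>Integrating over a disc, all Taylor coefficients of \<open>g\<close> but one are killed by rotation
  invariance.\<close>

lemma integral_disc_creation_power:
  assumes g: "g holomorphic_on UNIV"
  shows "(LINT w|gauss. indicator (ball 0 R) w * (cnj w ^ i * g w * cnj ((creation ^^ m) (bimonom p 0) w)))
    = (if m \<le> i + p then (deriv ^^ (i + p - m)) g 0 / fact (i + p - m) *
         (LINT w|gauss. indicator (ball 0 R) w * (bimonom (i + p - m) i w * cnj ((creation ^^ m) (bimonom p 0) w))) else 0)"
proof -
  define q where "q = (creation ^^ m) (bimonom p 0)"
  have q: "square_integrable_gauss q"
    unfolding q_def by (rule sqi_creation_power_mono)
  note [measurable] = q[THEN sqi_measurable]
  define c where "c = (\<lambda>n. (deriv ^^ n) g 0 / fact n)"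
  define T where "T = (\<lambda>n w. indicator (ball 0 R) w * (bimonom n i w * cnj (q w)) :: complex)"
  have [measurable]: "g \<in> borel_measurable borel"
    using holomorphic_on_imp_continuous_on[OF g] by (rule borel_measurable_continuous_onI)
  have T_int: "integrable gauss (T n)" for n
    unfolding T_def using integrable_sqi_inner[OF sqi_bimonom q]
    by (rule Bochner_Integration.integrable_bound) (measurable, auto simp: indicator_def)
  \<comment> \<open>Under rotation by e the integrand gains the factor
    \<open>e ^ (n + m) * cnj e ^ (i + p)\<close>, so only the index n = i + p - m can
    contribute.\<close>
  have T0: "(LINT w|gauss. T n w) = 0" if "n + m \<noteq> i + p" for n
  proof -
    obtain e where e: "norm e = 1" "e ^ (n + m) * cnj e ^ (i + p) = -1"
      using rotation_character[OF \<open>n + m \<noteq> i + p\<close>] .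
    have "T n (e * z) = (e ^ (n + m) * cnj e ^ (i + p)) * T n z" for z
      unfolding T_def q_def
      by (simp add: creation_power_mono_rotate[OF e(1)] bimonom_def power_mult_distrib power_add mult_ac norm_mult e(1) indicator_def)
    moreover have "T n \<in> borel_measurable borel"
      unfolding T_def by measurable
    ultimately show ?thesis
      using integral_gauss_rotate_eq_0[of "T n" e "-1"] e by simp
  qed
  have bnd: "norm (c n * T n w) \<le> norm (c n * (of_real (\<bar>R\<bar>)) ^ n) * (\<bar>R\<bar> ^ i * norm (q w))" for n w
  proof (cases "w \<in> ball 0 R")
    case True
    then have "norm w ^ (n + i) \<le> \<bar>R\<bar> ^ (n + i)" by (intro power_mono) auto
    then show ?thesis
      using True mult_left_mono[of "norm w ^ (n + i)" "\<bar>R\<bar> ^ (n + i)" "norm (c n) * norm (q w)"]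
      by (simp add: T_def norm_mult norm_bimonom norm_power power_add mult_ac)
  qed (simp add: T_def)
  \<comment> \<open>The Taylor series converges at radius |R| + 1, hence absolutely at |R|; this
    dominates the whole series on the disc.\<close>
  have "summable (\<lambda>n. c n * (of_real (\<bar>R\<bar> + 1)) ^ n)"
    unfolding c_def by (rule sums_summable[OF entire_sums[OF g]])
  then have sum1: "summable (\<lambda>n. norm (c n * (of_real (\<bar>R\<bar>)) ^ n))"
    by (rule powser_insidea) (simp flip: of_real_add add: norm_of_real del: of_real_add)
  have q1: "integrable gauss (\<lambda>w. norm (q w))"
    using integrable_sqi_mult[OF q sqi_bimonom[of 0 0]] by (simp add: bimonom_def)
  have "(\<lambda>n. LINT w|gauss. c n * T n w) sums (LINT w|gauss. (\<Sum>n. c n * T n w))"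
  proof (rule sums_integral)
    show "integrable gauss (\<lambda>w. c n * T n w)" for n
      using T_int by simp
    show "AE w in gauss. summable (\<lambda>n. norm (c n * T n w))"
      by (intro AE_I2 summable_comparison_test'[OF summable_mult2[OF sum1], where N=0]) (use bnd in auto)
    show "summable (\<lambda>n. LINT w|gauss. norm (c n * T n w))"
    proof (rule summable_comparison_test'[OF summable_mult2[OF sum1], where N=0])
      fix n
      have "norm (LINT w|gauss. norm (c n * T n w)) = (LINT w|gauss. norm (c n * T n w))"
        by simp
      also have "\<dots> \<le> (LINT w|gauss. norm (c n * (of_real (\<bar>R\<bar>)) ^ n) * (\<bar>R\<bar> ^ i * norm (q w)))"
        by (intro integral_mono) (use T_int q1 bnd in auto)
      finally show "norm (LINT w|gauss. norm (c n * T n w))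
          \<le> norm (c n * (of_real (\<bar>R\<bar>)) ^ n) * (\<bar>R\<bar> ^ i * (LINT w|gauss. norm (q w)))"
        by simp
    qed
  qed
  moreover have "(\<Sum>n. c n * T n w) = indicator (ball 0 R) w * (cnj w ^ i * g w * cnj (q w))" for w
  proof -
    have "(\<lambda>n. c n * w ^ n * (indicator (ball 0 R) w * (cnj w ^ i * cnj (q w)))) sums
       (g w * (indicator (ball 0 R) w * (cnj w ^ i * cnj (q w))))"
      unfolding c_def by (rule sums_mult2[OF entire_sums[OF g]])
    then show ?thesis
      by (auto simp: T_def bimonom_def mult_ac sums_iff)
  qed
  ultimately have S: "(\<lambda>n. c n * (LINT w|gauss. T n w)) sums
      (LINT w|gauss. indicator (ball 0 R) w * (cnj w ^ i * g w * cnj (q w)))"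
    by simp
  show ?thesis
  proof (cases "m \<le> i + p")
    case True
    have "(\<lambda>n. c n * (LINT w|gauss. T n w)) sums (c (i + p - m) * (LINT w|gauss. T (i + p - m) w))"
      using sums_finite[of "{i + p - m}" "\<lambda>n. c n * (LINT w|gauss. T n w)"] T0 True by auto
    from sums_unique2[OF S this] True show ?thesis
      by (simp add: q_def c_def T_def)
  next
    case False
    then have "(\<lambda>n. c n * (LINT w|gauss. T n w)) = (\<lambda>n. 0)"
      using T0 by fastforce
    with S have "(\<lambda>n. 0) sums (LINT w|gauss. indicator (ball 0 R) w * (cnj w ^ i * g w * cnj (q w)))"
      by simp
    from sums_unique2[OF this sums_zero] False show ?thesis
      by (simp add: q_def)
  qed
qed

lemma integral_disc_tendsto:
  fixes f :: "complex \<Rightarrow> complex"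
  assumes "integrable gauss f"
  shows "(\<lambda>n. LINT w|gauss. indicator (ball 0 (real n)) w * f w) \<longlonglongrightarrow> (LINT w|gauss. f w)"
proof (rule integral_dominated_convergence[where w="\<lambda>w. norm (f w)"])
  show "AE w in gauss. (\<lambda>n. indicator (ball 0 (real n)) w * f w) \<longlonglongrightarrow> f w"
  proof (rule AE_I2)
    fix w :: complex
    obtain N where N: "norm w < real N" using reals_Archimedean2 by blast
    have "eventually (\<lambda>n. indicator (ball 0 (real n)) w * f w = f w) sequentially"
      using eventually_ge_at_top[of N] by eventually_elim (use N in auto)
    then show "(\<lambda>n. indicator (ball 0 (real n)) w * f w) \<longlonglongrightarrow> f w"
      by (rule tendsto_eventually)
  qed
  have [measurable]: "f \<in> borel_measurable borel"
    using borel_measurable_integrable[OF assms] by simp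
  show "(\<lambda>w. indicator (ball 0 (real n)) w * f w) \<in> borel_measurable gauss" for n
    by measurable
qed (use assms in \<open>auto simp: indicator_def\<close>)

text \<open>Only the sum f is known to be square integrable; its terms
  \<open>cnj w ^ i * h i w\<close> need not be. The expansion is therefore made on discs, where each
  term is bounded, and the radius then tends to infinity on both sides of a finite formula.\<close>

lemma gauss_inner_creation_power:
  assumes h: "\<And>i. h i holomorphic_on UNIV"
    and f: "f = (\<lambda>w. \<Sum>i<Suc m. cnj w ^ i * h i w)" "square_integrable_gauss f"
  shows "gauss_inner f ((creation ^^ m) (bimonom p 0)) = fact m * (deriv ^^ p) (h m) 0"
proof -
  define q where "q = (creation ^^ m) (bimonom p 0)"
  have q: "square_integrable_gauss q"
    unfolding q_def by (rule sqi_creation_power_mono)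
  note [measurable] = q[THEN sqi_measurable]
  have [measurable]: "h i \<in> borel_measurable borel" for i
    using holomorphic_on_imp_continuous_on[OF h] by (rule borel_measurable_continuous_onI)
  define c where "c = (\<lambda>i. if m \<le> i + p then (deriv ^^ (i + p - m)) (h i) 0 / fact (i + p - m) else 0)"
  have q1: "integrable gauss (\<lambda>w. norm (q w))"
    using integrable_sqi_mult[OF q sqi_bimonom[of 0 0]] by (simp add: bimonom_def)
  have int: "integrable gauss (\<lambda>w. indicator (ball 0 R) w * (cnj w ^ i * h i w * cnj (q w)))" for i R
  proof -
    have "compact ((\<lambda>w. cnj w ^ i * h i w) ` cball 0 R)"
      by (intro compact_continuous_image continuous_intros
           holomorphic_on_imp_continuous_on[OF holomorphic_on_subset[OF h]]) auto
    then have "bounded ((\<lambda>w. cnj w ^ i * h i w) ` cball 0 R)"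
      by (rule compact_imp_bounded)
    then obtain B where "\<forall>x\<in>(\<lambda>w. cnj w ^ i * h i w) ` cball 0 R. norm x \<le> B"
      unfolding bounded_iff by blast
    then have B: "norm (cnj w ^ i * h i w) \<le> B" if "w \<in> cball 0 R" for w
      using that by blast
    show ?thesis
    proof (rule Bochner_Integration.integrable_bound)
      show "integrable gauss (\<lambda>w. B * norm (q w))" using q1 by simp
      have "norm (indicator (ball 0 R) w * (cnj w ^ i * h i w * cnj (q w))) \<le> norm (B * norm (q w))" for w
      proof (cases "w \<in> ball 0 R")
        case True
        then have "norm (cnj w ^ i * h i w) * norm (q w) \<le> B * norm (q w)"
          by (intro mult_right_mono B) auto
        with True show ?thesis
          by (simp add: norm_mult)
      qed simp
      then show "AE w in gauss. norm (indicator (ball 0 R) w * (cnj w ^ i * h i w * cnj (q w))) \<le> norm (B * norm (q w))"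
        by simp
    qed measurable
  qed
  have "(LINT w|gauss. indicator (ball 0 R) w * (f w * cnj (q w)))
    = (\<Sum>i<Suc m. c i * (LINT w|gauss. indicator (ball 0 R) w * (bimonom (i + p - m) i w * cnj (q w))))" for R
  proof -
    have "(LINT w|gauss. indicator (ball 0 R) w * (f w * cnj (q w)))
      = (LINT w|gauss. (\<Sum>i<Suc m. indicator (ball 0 R) w * (cnj w ^ i * h i w * cnj (q w))))"
      by (simp add: f sum_distrib_left sum_distrib_right del: sum.lessThan_Suc)
    also have "\<dots> = (\<Sum>i<Suc m. LINT w|gauss. indicator (ball 0 R) w * (cnj w ^ i * h i w * cnj (q w)))"
      by (rule Bochner_Integration.integral_sum) (rule int)
    also have "\<dots> = (\<Sum>i<Suc m. c i * (LINT w|gauss. indicator (ball 0 R) w * (bimonom (i + p - m) i w * cnj (q w))))"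
      unfolding q_def integral_disc_creation_power[OF h] by (intro sum.cong refl) (auto simp: c_def)
    finally show ?thesis .
  qed
  moreover have "(\<lambda>n. \<Sum>i<Suc m. c i * (LINT w|gauss. indicator (ball 0 (real n)) w * (bimonom (i + p - m) i w * cnj (q w))))
     \<longlonglongrightarrow> (\<Sum>i<Suc m. c i * (LINT w|gauss. bimonom (i + p - m) i w * cnj (q w)))"
    by (intro tendsto_sum tendsto_mult tendsto_const integral_disc_tendsto integrable_sqi_inner q sqi_bimonom)
  moreover have "(\<lambda>n. LINT w|gauss. indicator (ball 0 (real n)) w * (f w * cnj (q w))) \<longlonglongrightarrow> gauss_inner f q"
    unfolding gauss_inner_def by (intro integral_disc_tendsto integrable_sqi_inner q f)
  ultimately have "gauss_inner f q = (\<Sum>i<Suc m. c i * (LINT w|gauss. bimonom (i + p - m) i w * cnj (q w)))"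
    by (simp only:) (rule LIMSEQ_unique)
  also have "\<dots> = (\<Sum>i<Suc m. c i * gauss_inner (bimonom (i + p - m) i) q)"
    by (simp add: gauss_inner_def)
  \<comment> \<open>For i < m the pairing with \<open>(creation ^^ m) (bimonom p 0)\<close>
    vanishes, so only the leading coefficient \<open>h m\<close> is left.\<close>
  also have "\<dots> = c m * gauss_inner (bimonom p m) q"
    by (subst sum.lessThan_Suc, subst sum.neutral) (auto simp: q_def gauss_inner_creation_power_mono)
  also have "\<dots> = fact m * (deriv ^^ p) (h m) 0"
    by (simp add: q_def gauss_inner_creation_power_mono gauss_inner_bimonom c_def)
  finally show ?thesis
    by (simp add: q_def)
qed

section \<open>The Hilbert space of square summable sequences\<close>

typedef ell2 = "{x :: nat \<Rightarrow> complex. summable (\<lambda>n. (norm (x n))\<^sup>2)}"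
  morphisms coef Abs_ell2
  by (rule exI[of _ "\<lambda>_. 0"]) simp

lemma Re_mult_cnj: "Re (c * cnj c) = (norm c)\<^sup>2"
  unfolding complex_norm_square[symmetric] by simp

lemma summable_coef_power2: "summable (\<lambda>n. (norm (coef x n))\<^sup>2)"
  using coef[of x] by simp

lemma ell2_eqI: "(\<And>n. coef x n = coef y n) \<Longrightarrow> x = y"
  by (auto simp flip: coef_inject)

lemma summable_power2_add:
  fixes x y :: "nat \<Rightarrow> complex"
  assumes "summable (\<lambda>n. (norm (x n))\<^sup>2)" "summable (\<lambda>n. (norm (y n))\<^sup>2)"
  shows "summable (\<lambda>n. (norm (x n + y n))\<^sup>2)"
proof (rule summable_comparison_test')
  show "summable (\<lambda>n. 2 * (norm (x n))\<^sup>2 + 2 * (norm (y n))\<^sup>2)"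
    using assms by (intro summable_add summable_mult)
  fix n
  have "(norm (x n + y n))\<^sup>2 \<le> (norm (x n) + norm (y n))\<^sup>2"
    by (intro power_mono norm_triangle_ineq) simp
  also have "\<dots> \<le> 2 * (norm (x n))\<^sup>2 + 2 * (norm (y n))\<^sup>2"
    using sum_squares_bound[of "norm (x n)" "norm (y n)"] by (simp add: power2_sum)
  finally show "norm ((norm (x n + y n))\<^sup>2) \<le> 2 * (norm (x n))\<^sup>2 + 2 * (norm (y n))\<^sup>2"
    by simp
qed

lemma summable_power2_cmult:
  fixes x :: "nat \<Rightarrow> complex"
  shows "summable (\<lambda>n. (norm (x n))\<^sup>2) \<Longrightarrow> summable (\<lambda>n. (norm (c * x n))\<^sup>2)"
  by (auto simp: norm_mult power_mult_distrib intro: summable_mult)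

lemma summable_norm_mult:
  fixes x y :: "nat \<Rightarrow> complex"
  assumes "summable (\<lambda>n. (norm (x n))\<^sup>2)" "summable (\<lambda>n. (norm (y n))\<^sup>2)"
  shows "summable (\<lambda>n. norm (x n * cnj (y n)))"
proof (rule summable_comparison_test')
  show "summable (\<lambda>n. (norm (x n))\<^sup>2 + (norm (y n))\<^sup>2)"
    using assms by (rule summable_add)
  fix n
  have "0 \<le> norm (x n) * norm (y n)" by simp
  then have "norm (x n) * norm (y n) \<le> (norm (x n))\<^sup>2 + (norm (y n))\<^sup>2"
    using sum_squares_bound[of "norm (x n)" "norm (y n)"] by linarith
  then show "norm (norm (x n * cnj (y n))) \<le> (norm (x n))\<^sup>2 + (norm (y n))\<^sup>2"
    by (simp add: norm_mult)
qed

text \<open>The class \<open>real_inner\<close> knows only real scalars. The complex structure is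
  carried by \<open>cscale\<close> and by \<open>cin\<close>, linear in its first argument, whose
  real part is the inner product of the class.\<close>

definition cscale :: "complex \<Rightarrow> ell2 \<Rightarrow> ell2" where
  "cscale c x = Abs_ell2 (\<lambda>n. c * coef x n)"

definition cin :: "ell2 \<Rightarrow> ell2 \<Rightarrow> complex" where
  "cin x y = (\<Sum>n. coef x n * cnj (coef y n))"

lemma coef_Abs_ell2: "summable (\<lambda>n. (norm (x n))\<^sup>2) \<Longrightarrow> coef (Abs_ell2 x) = x"
  by (simp add: Abs_ell2_inverse)

lemma coef_cscale [simp]: "coef (cscale c x) n = c * coef x n"
  by (simp add: cscale_def coef_Abs_ell2 summable_power2_cmult[OF summable_coef_power2])

lemma sums_cin: "(\<lambda>n. coef x n * cnj (coef y n)) sums cin x y"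
  unfolding cin_def
  by (rule summable_sums) (rule summable_norm_cancel[OF summable_norm_mult[OF summable_coef_power2 summable_coef_power2]])

instantiation ell2 :: real_inner
begin

definition zero_ell2 :: ell2 where "0 = Abs_ell2 (\<lambda>n. 0)"
definition plus_ell2 :: "ell2 \<Rightarrow> ell2 \<Rightarrow> ell2" where "x + y = Abs_ell2 (\<lambda>n. coef x n + coef y n)"
definition uminus_ell2 :: "ell2 \<Rightarrow> ell2" where "- x = cscale (- 1) x"
definition minus_ell2 :: "ell2 \<Rightarrow> ell2 \<Rightarrow> ell2" where "x - y = x + (- y :: ell2)"
definition scaleR_ell2 :: "real \<Rightarrow> ell2 \<Rightarrow> ell2" where "r *\<^sub>R x = cscale (of_real r) x"
definition inner_ell2 :: "ell2 \<Rightarrow> ell2 \<Rightarrow> real" where "x \<bullet> y = Re (cin x y)"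
definition norm_ell2 :: "ell2 \<Rightarrow> real" where "norm x = sqrt (x \<bullet> (x :: ell2))"
definition sgn_ell2 :: "ell2 \<Rightarrow> ell2" where "sgn x = cscale (of_real (inverse (norm x))) x"
definition dist_ell2 :: "ell2 \<Rightarrow> ell2 \<Rightarrow> real" where "dist x y = norm (x - y :: ell2)"
definition uniformity_ell2 :: "(ell2 \<times> ell2) filter" where
  "uniformity = (INF e\<in>{0<..}. principal {(x, y). dist x (y :: ell2) < e})"
definition open_ell2 :: "ell2 set \<Rightarrow> bool" where
  "open S = (\<forall>x\<in>S. \<forall>\<^sub>F (x', y) in uniformity. x' = x \<longrightarrow> y \<in> (S :: ell2 set))"

lemma coef_zero: "coef 0 n = 0"
  by (simp add: zero_ell2_def coef_Abs_ell2)

lemma coef_plus: "coef (x + y) n = coef x n + coef y n"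
  by (simp add: plus_ell2_def coef_Abs_ell2 summable_power2_add summable_coef_power2)

lemma coef_uminus: "coef (- x) n = - coef x n"
  by (simp add: uminus_ell2_def)

lemma coef_minus: "coef (x - y) n = coef x n - coef y n"
  by (simp add: minus_ell2_def coef_plus coef_uminus)

lemma coef_scaleR: "coef (r *\<^sub>R x) n = of_real r * coef x n"
  by (simp add: scaleR_ell2_def)

instance
proof
  note defs = coef_zero coef_plus coef_uminus coef_minus coef_scaleR
  fix x y z :: ell2 and r s :: real
  show "x + y + z = x + (y + z)" "x + y = y + x" "0 + x = x" "- x + x = 0" "x - y = x + - y"
    "r *\<^sub>R (x + y) = r *\<^sub>R x + r *\<^sub>R y" "(r + s) *\<^sub>R x = r *\<^sub>R x + s *\<^sub>R x"
    "r *\<^sub>R s *\<^sub>R x = (r * s) *\<^sub>R x" "1 *\<^sub>R x = x"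
    by (rule ell2_eqI, simp add: defs algebra_simps)+
  show "sgn x = inverse (norm x) *\<^sub>R x" by (simp add: sgn_ell2_def scaleR_ell2_def)
  show "dist x y = norm (x - y)" by (rule dist_ell2_def)
  show "norm x = sqrt (x \<bullet> x)" by (rule norm_ell2_def)
  show "uniformity = (INF e\<in>{0<..}. principal {(x, y :: ell2). dist x y < e})" by (rule uniformity_ell2_def)
  show "open S = (\<forall>x\<in>S. \<forall>\<^sub>F (x', y) in uniformity. x' = x \<longrightarrow> y \<in> S)" for S :: "ell2 set"
    by (rule open_ell2_def)
  have sums_inner: "(\<lambda>n. Re (coef x n * cnj (coef y n))) sums (x \<bullet> y)" for x y :: ell2
    unfolding inner_ell2_def by (rule sums_Re[OF sums_cin])
  show "x \<bullet> y = y \<bullet> x"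
    using sums_unique2[OF sums_inner[of x y]] sums_inner[of y x] by (simp add: mult.commute)
  show "(x + y) \<bullet> z = x \<bullet> z + y \<bullet> z"
    using sums_unique2[OF sums_inner[of "x + y" z]] sums_add[OF sums_inner[of x z] sums_inner[of y z]]
    by (simp add: defs algebra_simps)
  show "(r *\<^sub>R x) \<bullet> y = r * (x \<bullet> y)"
    using sums_unique2[OF sums_inner[of "r *\<^sub>R x" y]] sums_mult[OF sums_inner[of x y], of r]
    by (simp add: defs algebra_simps)
  have sq: "(\<lambda>n. (norm (coef x n))\<^sup>2) sums (x \<bullet> x)"
    using sums_inner[of x x] by (simp only: Re_mult_cnj)
  show "0 \<le> x \<bullet> x"
    by (rule sums_le[OF _ sums_zero sq]) simp
  show "(x \<bullet> x = 0) = (x = 0)"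
  proof
    assume "x \<bullet> x = 0"
    with sq have "(\<Sum>n. (norm (coef x n))\<^sup>2) = 0" by (simp add: sums_iff)
    then have "(norm (coef x n))\<^sup>2 = 0" for n
      using suminf_eq_zero_iff[OF summable_coef_power2] by simp
    then show "x = 0" by (intro ell2_eqI) (simp add: coef_zero)
  next
    assume "x = 0"
    with sq have "(\<lambda>n. 0) sums (x \<bullet> x)" by (simp add: coef_zero)
    from sums_unique2[OF this sums_zero] show "x \<bullet> x = 0" .
  qed
qed

end

lemmas coef_simps [simp] = coef_zero coef_plus coef_uminus coef_minus coef_scaleR

lemma coef_sum [simp]: "coef (\<Sum>i\<in>I. f i) n = (\<Sum>i\<in>I. coef (f i) n)"
  by (induction I rule: infinite_finite_induct) auto

lemma sums_norm_power2: "(\<lambda>n. (norm (coef x n))\<^sup>2) sums (norm x)\<^sup>2"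
proof -
  have "(\<lambda>n. Re (coef x n * cnj (coef x n))) sums (x \<bullet> x)"
    unfolding inner_ell2_def by (rule sums_Re[OF sums_cin])
  then show ?thesis
    by (simp only: Re_mult_cnj power2_norm_eq_inner)
qed

lemma cin_add_left: "cin (x + y) z = cin x z + cin y z"
  by (rule sums_unique2[OF sums_cin])
     (use sums_add[OF sums_cin[of x z] sums_cin[of y z]] in \<open>simp add: algebra_simps\<close>)

lemma cin_cscale_left: "cin (cscale c x) z = c * cin x z"
  by (rule sums_unique2[OF sums_cin]) (use sums_mult[OF sums_cin[of x z], of c] in \<open>simp add: algebra_simps\<close>)

lemma cnj_cin: "cnj (cin x y) = cin y x"
proof -
  have "(\<lambda>n. cnj (coef x n * cnj (coef y n))) sums cnj (cin x y)"
    using sums_cin by (simp only: sums_cnj)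
  then show ?thesis
    by (intro sums_unique2[OF _ sums_cin]) (simp add: mult.commute)
qed

lemma cin_add_right: "cin z (x + y) = cin z x + cin z y"
  using arg_cong[OF cin_add_left[of x y z], of cnj] by (simp add: cnj_cin)

lemma cin_cscale_right: "cin z (cscale c x) = cnj c * cin z x"
  using arg_cong[OF cin_cscale_left[of c x z], of cnj] by (simp add: cnj_cin)

lemma cin_self: "cin x x = of_real ((norm x)\<^sup>2)"
  by (rule sums_unique2[OF sums_cin])
     (use sums_of_real[OF sums_norm_power2[of x], where 'a=complex] in \<open>simp flip: complex_norm_square\<close>)

lemma cin_uminus_left: "cin (- x) y = - cin x y"
  using cin_cscale_left[of "-1" x y] by (simp flip: uminus_ell2_def)

lemma cin_diff_left: "cin (x - y) z = cin x z - cin y z"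
  using cin_add_left[of x "- y" z] by (simp add: cin_uminus_left)

lemma cin_diff_right: "cin z (x - y) = cin z x - cin z y"
  using arg_cong[OF cin_diff_left[of x y z], of cnj] by (simp add: cnj_cin)

lemma cscale_one [simp]: "cscale 1 x = x"
  by (rule ell2_eqI) simp

lemma cscale_cscale [simp]: "cscale a (cscale b x) = cscale (a * b) x"
  by (rule ell2_eqI) simp

lemma norm_cscale [simp]: "norm (cscale c x) = norm c * norm x"
proof -
  have "cin (cscale c x) (cscale c x) = (c * cnj c) * cin x x"
    by (simp add: cin_cscale_left cin_cscale_right)
  then have "complex_of_real ((norm (cscale c x))\<^sup>2) = of_real ((norm c * norm x)\<^sup>2)"
    unfolding cin_self complex_norm_square[symmetric] by (simp add: power_mult_distrib)
  then have "(norm (cscale c x))\<^sup>2 = (norm c * norm x)\<^sup>2"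
    by (simp only: of_real_eq_iff)
  then show ?thesis by (rule power2_eq_imp_eq) auto
qed

text \<open>Multiplying x by a unimodular number makes \<open>cin x y\<close> real and nonnegative,
  which reduces the claim to the real Cauchy-Schwarz inequality.\<close>

lemma norm_cin_le: "norm (cin x y) \<le> norm x * norm y"
proof (cases "cin x y = 0")
  case False
  define c where "c = cnj (sgn (cin x y))"
  have c: "norm c = 1" using False by (simp add: c_def norm_sgn)
  have "c * cin x y = of_real (norm (cin x y))"
  proof -
    have "c * cin x y = cin x y * cnj (cin x y) / of_real (norm (cin x y))"
      by (simp add: c_def sgn_eq mult.commute)
    also have "\<dots> = of_real (norm (cin x y))"
      using False unfolding complex_norm_square[symmetric] by (simp add: power2_eq_square)
    finally show ?thesis .
  qed
  then have "norm (cin x y) = cscale c x \<bullet> y"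
    by (simp add: inner_ell2_def cin_cscale_left)
  also have "\<dots> \<le> norm (cscale c x) * norm y" by (rule norm_cauchy_schwarz)
  finally show ?thesis using c by simp
qed simp

lemma norm_coef_le: "norm (coef x n) \<le> norm x"
proof -
  have "(norm (coef x n))\<^sup>2 \<le> (norm x)\<^sup>2"
    using sum_le_suminf[OF summable_coef_power2, of "{n}" x] sums_norm_power2[of x] by (simp add: sums_iff)
  then show ?thesis by (rule power2_le_imp_le) simp
qed

definition unit_vec :: "nat \<Rightarrow> ell2" where
  "unit_vec n = Abs_ell2 (\<lambda>i. if i = n then 1 else 0)"

lemma coef_unit_vec: "coef (unit_vec n) i = (if i = n then 1 else 0)"
proof -
  have "summable (\<lambda>i. (norm (if i = n then 1 else 0 :: complex))\<^sup>2)"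
    by (rule summable_finite[of "{n}"]) auto
  then show ?thesis by (simp add: unit_vec_def coef_Abs_ell2)
qed

lemma cin_unit_vec: "cin x (unit_vec n) = coef x n"
  using sums_unique2[OF sums_cin[of x "unit_vec n"]]
    sums_finite[of "{n}" "\<lambda>i. coef x i * cnj (coef (unit_vec n) i)"] by (simp add: coef_unit_vec)

lemma norm_unit_vec [simp]: "norm (unit_vec n) = 1"
proof -
  have "complex_of_real ((norm (unit_vec n))\<^sup>2) = 1"
    unfolding cin_self[symmetric] cin_unit_vec by (simp add: coef_unit_vec)
  then have "(norm (unit_vec n))\<^sup>2 = 1" by (metis of_real_eq_1_iff)
  then show ?thesis using norm_ge_zero[of "unit_vec n"] by (simp add: power2_eq_1_iff)
qed

text \<open>The orthogonal projection onto the first N coordinates. It is self-adjoint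
  (\<open>cin_trunc\<close>) and converges strongly to the identity; compactness will mean that a
  form absorbs its tails uniformly.\<close>

definition trunc :: "nat \<Rightarrow> ell2 \<Rightarrow> ell2" where
  "trunc N x = (\<Sum>n<N. cscale (coef x n) (unit_vec n))"

lemma coef_trunc: "coef (trunc N x) n = (if n < N then coef x n else 0)"
  by (simp add: trunc_def coef_unit_vec if_distrib cong: if_cong)

lemma norm_diff_trunc_power2: "(norm (x - trunc N x))\<^sup>2 = (\<Sum>n. (norm (coef x (n + N)))\<^sup>2)"
proof -
  have "(\<lambda>n. (norm (coef (x - trunc N x) (n + N)))\<^sup>2) sums ((norm (x - trunc N x))\<^sup>2 - (\<Sum>n<N. (norm (coef (x - trunc N x) n))\<^sup>2))"
    using sums_norm_power2 by (rule sums_split_initial_segment)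
  then show ?thesis
    by (simp add: coef_trunc sums_iff)
qed

lemma trunc_tendsto: "(\<lambda>N. trunc N x) \<longlonglongrightarrow> x"
proof -
  have "(\<lambda>N. (norm (x - trunc N x))\<^sup>2) \<longlonglongrightarrow> 0"
    unfolding norm_diff_trunc_power2 by (rule suminf_exist_split2[OF summable_coef_power2])
  then have "(\<lambda>N. sqrt ((norm (x - trunc N x))\<^sup>2)) \<longlonglongrightarrow> sqrt 0"
    by (rule tendsto_real_sqrt)
  then show ?thesis
    by (subst tendsto_dist_iff) (simp add: dist_norm norm_minus_commute)
qed

lemma norm_diff_trunc_le: "norm (x - trunc N x) \<le> norm x"
proof -
  have "(norm (x - trunc N x))\<^sup>2 \<le> (norm x)\<^sup>2"
    by (rule sums_le[OF _ sums_norm_power2 sums_norm_power2]) (simp add: coef_trunc)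
  then show ?thesis by (rule power2_le_imp_le) simp
qed

lemma norm_trunc_le: "norm (trunc N x) \<le> norm x"
proof -
  have "(norm (trunc N x))\<^sup>2 \<le> (norm x)\<^sup>2"
    by (rule sums_le[OF _ sums_norm_power2 sums_norm_power2]) (simp add: coef_trunc)
  then show ?thesis by (rule power2_le_imp_le) simp
qed

lemma trunc_add: "trunc N (x + y) = trunc N x + trunc N y"
  and trunc_cscale: "trunc N (cscale c x) = cscale c (trunc N x)"
  by (rule ell2_eqI, simp add: coef_trunc)+

lemma cin_trunc: "cin (trunc N x) y = cin x (trunc N y)"
  by (rule sums_unique2[OF sums_cin]) (use sums_cin[of x "trunc N y"] in \<open>simp add: coef_trunc if_distrib if_distribR cong: if_cong\<close>)

text \<open>The representing vector must have coordinates \<open>cnj (f (unit_vec n))\<close>. Their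
  square summability comes from testing f on the truncations of this very candidate.\<close>

lemma riesz_ell2:
  assumes add: "\<And>x y. f (x + y) = f x + f y" and cs: "\<And>c x. f (cscale c x) = c * f x"
    and bd: "\<And>x. norm (f x :: complex) \<le> C * norm x"
  obtains b where "\<And>x. f x = cin x b"
proof -
  have f0: "f 0 = 0" using add[of 0 0] by simp
  have fsum: "f (\<Sum>i\<in>I. g i) = (\<Sum>i\<in>I. f (g i))" for g and I :: "nat set"
    by (induction I rule: infinite_finite_induct) (auto simp: f0 add)
  have C: "C \<ge> 0" using order_trans[OF norm_ge_zero bd[of "unit_vec 0"]] by simp
  have sum: "summable (\<lambda>n. (norm (cnj (f (unit_vec n))))\<^sup>2)"
  proof (rule bounded_imp_summable[where B="C\<^sup>2"])
    fix N
    \<comment> \<open>For this x both \<open>f x\<close> and the squared norm of x equal S, so the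
      bound on f reads S \<le> C sqrt S, giving S \<le> C^2 for every N.\<close>
    define x where "x = (\<Sum>n<Suc N. cscale (cnj (f (unit_vec n))) (unit_vec n))"
    define S where "S = (\<Sum>n<Suc N. (norm (f (unit_vec n)))\<^sup>2)"
    have S0: "S \<ge> 0" unfolding S_def by (intro sum_nonneg) auto
    have "f x = (\<Sum>n<Suc N. cnj (f (unit_vec n)) * f (unit_vec n))"
      unfolding x_def fsum cs ..
    also have "\<dots> = of_real S"
      unfolding S_def of_real_sum complex_norm_square by (intro sum.cong refl mult.commute)
    finally have fx: "norm (f x) = S" using S0 by simp
    have "coef x n = (if n < Suc N then cnj (f (unit_vec n)) else 0)" for n
      by (simp add: x_def coef_unit_vec if_distrib cong: if_cong del: sum.lessThan_Suc)
    then have "(\<lambda>n. (norm (coef x n))\<^sup>2) sums S"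
      using sums_finite[of "{..<Suc N}" "\<lambda>n. (norm (coef x n))\<^sup>2"] by (simp add: S_def del: sum.lessThan_Suc)
    then have 2: "(norm x)\<^sup>2 = S"
      using sums_norm_power2 sums_unique2 by blast
    have "norm x * norm x \<le> C * norm x"
      using bd[of x] unfolding fx 2[symmetric] power2_eq_square .
    then have "norm x \<le> C"
      using C by (cases "norm x = 0") (auto dest: mult_right_le_imp_le)
    then have "S \<le> C\<^sup>2"
      unfolding 2[symmetric] by (intro power_mono) auto
    then show "(\<Sum>n\<le>N. (norm (cnj (f (unit_vec n))))\<^sup>2) \<le> C\<^sup>2"
      by (simp add: S_def lessThan_Suc_atMost)
  qed simp
  define b where "b = Abs_ell2 (\<lambda>n. cnj (f (unit_vec n)))"
  have cb: "coef b n = cnj (f (unit_vec n))" for n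
    by (simp only: b_def coef_Abs_ell2[OF sum])
  have "(\<lambda>p. coef x p * f (unit_vec p)) sums f x" for x
    unfolding sums_def
  proof (rule LIM_zero_cancel, rule Lim_null_comparison)
    have diff: "f (x - y) = f x - f y" for x y
      using add[of "x - y" y] by simp
    have "f (trunc N x) = (\<Sum>p<N. coef x p * f (unit_vec p))" for N
      by (simp add: trunc_def fsum cs)
    then have "norm ((\<Sum>p<N. coef x p * f (unit_vec p)) - f x) \<le> C * norm (trunc N x - x)" for N
      using bd[of "trunc N x - x"] by (simp add: diff)
    then show "\<forall>\<^sub>F N in sequentially. norm ((\<Sum>p<N. coef x p * f (unit_vec p)) - f x) \<le> C * norm (trunc N x - x)"
      by simp
    have "(\<lambda>N. C * norm (trunc N x - x)) \<longlonglongrightarrow> C * norm (x - x)"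
      by (intro tendsto_intros trunc_tendsto)
    then show "(\<lambda>N. C * norm (trunc N x - x)) \<longlonglongrightarrow> 0" by simp
  qed
  then have "f x = cin x b" for x
    using sums_unique2[OF _ sums_cin[of x b]] by (simp add: cb)
  then show ?thesis by (rule that)
qed

section \<open>Coherent states and the identification with the polyanalytic Fock spaces\<close>

text \<open>The unnormalized coherent state: pairing a sequence with \<open>kvec w\<close> evaluates
  at w the entire function whose coordinates refer to the orthonormal basis w^p / sqrt(p!).\<close>

definition kvec :: "complex \<Rightarrow> ell2" where
  "kvec z = Abs_ell2 (\<lambda>p. cnj z ^ p / of_real (sqrt (fact p)))"

lemma sums_exp_fact: "(\<lambda>p. z ^ p / fact p) sums exp (z::'a::{real_normed_field,banach})"
  using exp_converges[of z] by (simp add: scaleR_conv_of_real field_simps)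

lemma coef_kvec: "coef (kvec z) p = cnj z ^ p / of_real (sqrt (fact p))"
proof -
  have "(norm (cnj z ^ p / of_real (sqrt (fact p))))\<^sup>2 = ((norm z)\<^sup>2) ^ p / fact p" for p
    by (simp add: norm_divide norm_power power_divide flip: power_mult) (simp add: mult.commute)
  then have "summable (\<lambda>p. (norm (cnj z ^ p / of_real (sqrt (fact p))))\<^sup>2)"
    using sums_summable[OF sums_exp_fact[of "(norm z)\<^sup>2"]] by simp
  then show ?thesis by (simp add: kvec_def coef_Abs_ell2)
qed

lemma of_real_sqrt_fact_mult: "of_real (sqrt (fact p)) * of_real (sqrt (fact p)) = (fact p :: complex)"
  by (simp flip: of_real_mult)

lemma cin_kvec_kvec: "cin (kvec z) (kvec w) = exp (w * cnj z)"
proof (rule sums_unique2[OF sums_cin])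
  have "coef (kvec z) p * cnj (coef (kvec w) p) = (w * cnj z) ^ p / fact p" for p
    by (simp add: coef_kvec power_mult_distrib of_real_sqrt_fact_mult)
  then show "(\<lambda>n. coef (kvec z) n * cnj (coef (kvec w) n)) sums exp (w * cnj z)"
    using sums_exp_fact[of "w * cnj z"] by simp
qed

lemma norm_kvec: "norm (kvec z) = exp ((norm z)\<^sup>2 / 2)"
proof -
  have "complex_of_real ((norm (kvec z))\<^sup>2) = of_real (exp ((norm z)\<^sup>2))"
    unfolding cin_self[symmetric] cin_kvec_kvec complex_norm_square[symmetric]
    by (simp add: exp_of_real del: of_real_power)
  then have "(norm (kvec z))\<^sup>2 = (exp ((norm z)\<^sup>2 / 2))\<^sup>2"
    unfolding of_real_eq_iff by (simp add: exp_double[symmetric])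
  then show ?thesis by (rule power2_eq_imp_eq) auto
qed

definition fock_fun :: "ell2 \<Rightarrow> complex \<Rightarrow> complex" where
  "fock_fun x w = cin x (kvec w)"

lemma sums_fock_fun: "(\<lambda>p. coef x p / of_real (sqrt (fact p)) * w ^ p) sums fock_fun x w"
  using sums_cin[of x "kvec w"] by (simp add: fock_fun_def coef_kvec)

lemma fock_fun_lincomb: "fock_fun (cscale a x + cscale b y) = (\<lambda>w. a * fock_fun x w + b * fock_fun y w)"
  by (auto simp: fock_fun_def cin_add_left cin_cscale_left)

lemma fock_fun_unit_vec: "fock_fun (unit_vec p) = (\<lambda>w. bimonom p 0 w / of_real (sqrt (fact p)))"
proof
  fix w
  have "fock_fun (unit_vec p) w = cnj (coef (kvec w) p)"
    unfolding fock_fun_def by (metis cin_unit_vec cnj_cin)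
  then show "fock_fun (unit_vec p) w = bimonom p 0 w / of_real (sqrt (fact p))"
    by (simp add: coef_kvec bimonom_def)
qed

lemma fock_fun_kvec: "fock_fun (kvec z) = (\<lambda>w. exp (w * cnj z))"
  by (simp add: fock_fun_def cin_kvec_kvec fun_eq_iff)

lemma holomorphic_on_UNIV_power_series:
  assumes "\<And>w. (\<lambda>n. a n * w ^ n) sums f w"
  shows "f holomorphic_on UNIV"
proof -
  have "f holomorphic_on ball 0 (real n)" for n
    using power_series_holomorphic[of 0 "real n" a f] assms by simp
  moreover have "(\<Union>n. ball (0::complex) (real n)) = UNIV"
    by (auto intro: reals_Archimedean2)
  moreover from calculation(1) have "f holomorphic_on (\<Union>n. ball 0 (real n))"
    by (intro holomorphic_on_UN_open) auto
  ultimately show ?thesis by simp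
qed

lemma higher_deriv_power_series:
  assumes "\<And>w. (\<lambda>n. a n * w ^ n) sums f w"
  shows "(deriv ^^ n) f 0 = fact n * (a n :: complex)"
proof -
  have "f has_fps_expansion Abs_fps a"
    by (rule has_fps_expansionI) (simp add: assms)
  from fps_nth_fps_expansion[OF this, of n] show ?thesis
    by (simp add: field_simps)
qed

lemma fock_fun_holomorphic: "fock_fun x holomorphic_on UNIV"
  by (rule holomorphic_on_UNIV_power_series[OF sums_fock_fun])

lemma norm_fock_fun_le: "norm (fock_fun x w) \<le> norm x * exp ((norm w)\<^sup>2 / 2)"
  using norm_cin_le[of x "kvec w"] by (simp add: fock_fun_def norm_kvec)

text \<open>The reproducing kernel bound turns norm convergence into uniform convergence on discs.
  For entire functions this passes to all derivatives, as needed for the creation operator.\<close>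

lemma uniform_limit_fock_fun_trunc:
  "uniform_limit (ball 0 r) (\<lambda>N. fock_fun (trunc N x)) (fock_fun x) sequentially"
proof (rule uniform_limitI)
  fix e :: real assume "e > 0"
  have "(\<lambda>N. norm (x - trunc N x) * exp (r\<^sup>2 / 2)) \<longlonglongrightarrow> norm (x - x) * exp (r\<^sup>2 / 2)"
    by (intro tendsto_intros trunc_tendsto)
  then have "eventually (\<lambda>N. norm (x - trunc N x) * exp (r\<^sup>2 / 2) < e) sequentially"
    using \<open>e > 0\<close> by (intro order_tendstoD(2)) auto
  then show "\<forall>\<^sub>F N in sequentially. \<forall>w\<in>ball 0 r. dist (fock_fun (trunc N x) w) (fock_fun x w) < e"
  proof eventually_elim
    case (elim N)
    show ?case
    proof
      fix w assume "w \<in> ball (0::complex) r"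
      then have "(norm w)\<^sup>2 \<le> r\<^sup>2" by (intro power_mono) auto
      then have "norm (x - trunc N x) * exp ((norm w)\<^sup>2 / 2) \<le> norm (x - trunc N x) * exp (r\<^sup>2 / 2)"
        by (intro mult_left_mono) auto
      moreover have "dist (fock_fun (trunc N x) w) (fock_fun x w) = norm (fock_fun (x - trunc N x) w)"
        by (simp add: dist_norm fock_fun_def cin_diff_left norm_minus_commute)
      ultimately show "dist (fock_fun (trunc N x) w) (fock_fun x w) < e"
        using elim norm_fock_fun_le[of "x - trunc N x" w] by linarith
    qed
  qed
qed

text \<open>The coefficients are chosen before g and w. Hence pointwise limits of all derivatives of
  g yield pointwise limits of \<open>(creation ^^ m) g\<close>.\<close>

lemma creation_power_expand:
  "\<exists>k. \<forall>g w. g holomorphic_on UNIV \<longrightarrow>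
     (creation ^^ m) g w = (\<Sum>i<Suc m. k i * cnj w ^ (m - i) * (deriv ^^ i) g w)"
proof (induction m)
  case 0
  show ?case by (rule exI[of _ "\<lambda>_. 1"]) simp
next
  case (Suc m)
  then obtain k :: "nat \<Rightarrow> complex" where k: "\<And>g w. g holomorphic_on UNIV \<Longrightarrow>
     (creation ^^ m) g w = (\<Sum>i<Suc m. k i * cnj w ^ (m - i) * (deriv ^^ i) g w)"
    by blast
  \<comment> \<open>One more \<open>creation\<close> either multiplies by \<open>cnj w\<close>,
    keeping the index i, or differentiates with a minus sign, raising i by one.\<close>
  define k' where "k' = (\<lambda>i. (if i < Suc m then k i else 0) - (case i of 0 \<Rightarrow> 0 | Suc j \<Rightarrow> k j))"
  have "(creation ^^ Suc m) g w = (\<Sum>i<Suc (Suc m). k' i * cnj w ^ (Suc m - i) * (deriv ^^ i) g w)"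
    if g: "g holomorphic_on UNIV" for g w
  proof -
    have d: "((deriv ^^ i) g has_field_derivative (deriv ^^ Suc i) g w) (at w)" for i w
      using holomorphic_derivI[OF holomorphic_higher_deriv[OF g open_UNIV] open_UNIV, of w i] by simp
    have W: "has_wirtinger (\<lambda>w. \<Sum>i<Suc m. k i * cnj w ^ (m - i) * (deriv ^^ i) g w)
        (\<Sum>i<Suc m. k i * cnj w ^ (m - i) * (deriv ^^ Suc i) g w)
        (\<Sum>i<Suc m. k i * (of_nat (m - i) * cnj w ^ (m - i - 1)) * (deriv ^^ i) g w) w"
    proof (rule has_wirtinger_sum)
      fix i
      show "has_wirtinger (\<lambda>w. k i * cnj w ^ (m - i) * (deriv ^^ i) g w)
        (k i * cnj w ^ (m - i) * (deriv ^^ Suc i) g w)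
        (k i * (of_nat (m - i) * cnj w ^ (m - i - 1)) * (deriv ^^ i) g w) w"
        using has_wirtinger_mult[OF has_wirtinger_cmult[OF has_wirtinger_cnj_power[of "m - i"], of "k i"]
            has_wirtinger_holomorphic[OF d[of i w]]]
        by simp
    qed
    have "(creation ^^ Suc m) g w = creation (\<lambda>w. \<Sum>i<Suc m. k i * cnj w ^ (m - i) * (deriv ^^ i) g w) w"
    proof -
      have "(creation ^^ m) g = (\<lambda>w. \<Sum>i<Suc m. k i * cnj w ^ (m - i) * (deriv ^^ i) g w)"
        by (rule ext) (rule k[OF g])
      then show ?thesis by simp
    qed
    also have "\<dots> = - (\<Sum>i<Suc m. k i * cnj w ^ (m - i) * (deriv ^^ Suc i) g w)
        + (\<Sum>i<Suc m. k i * cnj w ^ (Suc m - i) * (deriv ^^ i) g w)"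
      unfolding creation_eqI[OF W] sum_distrib_left
      by (intro arg_cong2[of _ _ _ _ "(+)"] refl sum.cong) (auto simp: Suc_diff_le)
    also have "(\<Sum>i<Suc m. k i * cnj w ^ (Suc m - i) * (deriv ^^ i) g w)
      = (\<Sum>i<Suc (Suc m). (if i < Suc m then k i else 0) * cnj w ^ (Suc m - i) * (deriv ^^ i) g w)"
      by simp
    also have "(\<Sum>i<Suc m. k i * cnj w ^ (m - i) * (deriv ^^ Suc i) g w)
      = (\<Sum>i<Suc (Suc m). (case i of 0 \<Rightarrow> 0 | Suc j \<Rightarrow> k j) * cnj w ^ (Suc m - i) * (deriv ^^ i) g w)"
      by (subst (2) sum.lessThan_Suc_shift) simp
    finally show ?thesis
      by (simp add: k'_def left_diff_distrib sum_subtractf del: sum.lessThan_Suc)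
  qed
  then show ?case by blast
qed

text \<open>The unitary map from sequences to a true polyanalytic Fock space. The index is the
  number of creation operators, so \<open>fock_map m\<close> belongs to level
  \<open>Suc m\<close>.\<close>

definition fock_map :: "nat \<Rightarrow> ell2 \<Rightarrow> complex \<Rightarrow> complex" where
  "fock_map m x w = (creation ^^ m) (fock_fun x) w / of_real (sqrt (fact m))"

lemma fock_unitary_fock_fun: "fock_unitary (Suc m) (fock_fun x) = fock_map m x"
  by (simp add: fock_map_def fock_unitary_def fun_eq_iff)

lemma fock_map_0: "fock_map 0 x = fock_fun x"
  by (simp add: fock_map_def fun_eq_iff)

lemma fock_map_lincomb:
  "fock_map m (cscale a x + cscale b y) = (\<lambda>w. a * fock_map m x w + b * fock_map m y w)"
  unfolding fock_map_def fock_fun_lincomb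
  using creation_power_lincomb[of "Suc 0" "fock_fun x" "fock_fun y" m a b]
  by (simp add: polyanalytic_1 fock_fun_holomorphic add_divide_distrib fun_eq_iff)

lemma fock_map_add: "fock_map m (x + y) = (\<lambda>w. fock_map m x w + fock_map m y w)"
  using fock_map_lincomb[of m 1 x 1 y] by simp

lemma fock_map_diff: "fock_map m (x - y) = (\<lambda>w. fock_map m x w - fock_map m y w)"
proof -
  have "x - y = cscale 1 x + cscale (-1) y" by (rule ell2_eqI) simp
  then show ?thesis by (simp only: fock_map_lincomb) simp
qed

lemma fock_map_cscale: "fock_map m (cscale c x) = (\<lambda>w. c * fock_map m x w)"
proof -
  have "cscale c x + cscale 0 x = cscale c x" by (rule ell2_eqI) simp
  then show ?thesis using fock_map_lincomb[of m c x 0 x] by simp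
qed

lemma fock_map_zero: "fock_map m 0 = (\<lambda>w. 0)"
  using fock_map_diff[of m 0 0] by simp

lemma fock_map_sum: "fock_map m (\<Sum>i\<in>I. f i) = (\<lambda>w. \<Sum>i\<in>I. fock_map m (f i) w)"
  by (induction I rule: infinite_finite_induct) (auto simp: fock_map_zero fock_map_add)

lemma polyanalytic_fock_map: "polyanalytic (Suc m) (fock_map m x)"
proof -
  have "polyanalytic (Suc 0 + m) ((creation ^^ m) (fock_fun x))"
    by (intro polyanalytic_creation_power) (simp add: polyanalytic_1 fock_fun_holomorphic)
  then have "polyanalytic (Suc m) (\<lambda>w. (1 / of_real (sqrt (fact m))) * (creation ^^ m) (fock_fun x) w)"
    by (intro polyanalytic_cmult) simp
  then show ?thesis by (simp add: fock_map_def[abs_def])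
qed

lemma fock_map_leading:
  "polyanalytic m (\<lambda>w. fock_map m x w - cnj w ^ m * (fock_fun x w / of_real (sqrt (fact m))))"
proof -
  have "polyanalytic m (\<lambda>w. (1 / of_real (sqrt (fact m))) * ((creation ^^ m) (fock_fun x) w - cnj w ^ m * fock_fun x w))"
    by (intro polyanalytic_cmult creation_power_leading fock_fun_holomorphic)
  then show ?thesis by (simp add: fock_map_def diff_divide_distrib)
qed

lemma fock_map_measurable [measurable]: "fock_map m x \<in> borel_measurable borel"
  using polyanalytic_continuous[OF polyanalytic_fock_map] by (rule borel_measurable_continuous_onI)

lemma fock_map_unit_vec:
  "fock_map m (unit_vec p) = (\<lambda>w. 1 / (of_real (sqrt (fact m)) * of_real (sqrt (fact p))) * (creation ^^ m) (bimonom p 0) w)"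
proof -
  have "fock_fun (unit_vec p) = (\<lambda>w. (1 / of_real (sqrt (fact p))) * bimonom p 0 w + 0 * bimonom p 0 w)"
    by (simp add: fock_fun_unit_vec)
  then have "(creation ^^ m) (fock_fun (unit_vec p)) = (\<lambda>w. (1 / of_real (sqrt (fact p))) * (creation ^^ m) (bimonom p 0) w + 0 * (creation ^^ m) (bimonom p 0) w)"
    by (simp only:) (rule creation_power_lincomb[OF polyanalytic_monomial polyanalytic_monomial])
  then show ?thesis by (simp add: fock_map_def[abs_def] field_simps)
qed

lemma sqi_fock_map_unit_vec: "square_integrable_gauss (fock_map m (unit_vec p))"
  unfolding fock_map_unit_vec by (intro sqi_cmult sqi_creation_power_mono)

text \<open>Only the leading coefficient g enters; whatever f contains of lower order is orthogonal
  to every basis vector of level \<open>Suc m\<close>.\<close>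

lemma gauss_inner_fock_map_unit_vec:
  assumes g: "g holomorphic_on UNIV" and f: "polyanalytic m (\<lambda>w. f w - cnj w ^ m * g w)" "square_integrable_gauss f"
  shows "gauss_inner f (fock_map m (unit_vec p)) = of_real (sqrt (fact m)) * (deriv ^^ p) g 0 / of_real (sqrt (fact p))"
proof -
  obtain h where h: "\<And>i. h i holomorphic_on UNIV" "(\<lambda>w. f w - cnj w ^ m * g w) = (\<lambda>w. \<Sum>i<m. cnj w ^ i * h i w)"
    using polyanalyticE[OF f(1)] by metis
  have "f = (\<lambda>w. \<Sum>i<Suc m. cnj w ^ i * (h(m := g)) i w)"
  proof
    fix w
    have "f w = (\<Sum>i<m. cnj w ^ i * h i w) + cnj w ^ m * g w"
      using fun_cong[OF h(2), of w] by (simp add: diff_eq_eq)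
    then show "f w = (\<Sum>i<Suc m. cnj w ^ i * (h(m := g)) i w)" by simp
  qed
  moreover have "(h(m := g)) i holomorphic_on UNIV" for i
    using h g by simp
  ultimately have "gauss_inner f ((creation ^^ m) (bimonom p 0)) = fact m * (deriv ^^ p) g 0"
    using gauss_inner_creation_power[of "h(m := g)" f m p] f(2) by simp
  then show ?thesis
    unfolding fock_map_unit_vec gauss_inner_cmult_right
    by (simp add: field_simps flip: of_real_sqrt_fact_mult)
qed

lemma gauss_inner_fock_map_unit_vec':
  assumes "square_integrable_gauss (fock_map m x)"
  shows "gauss_inner (fock_map m x) (fock_map m (unit_vec p)) = coef x p"
proof -
  have "(\<lambda>q. coef x q / of_real (sqrt (fact q)) / of_real (sqrt (fact m)) * w ^ q) sums (fock_fun x w / of_real (sqrt (fact m)))" for w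
    using sums_divide[OF sums_fock_fun[of x w], of "of_real (sqrt (fact m))"] by simp
  from higher_deriv_power_series[OF this]
  have "(deriv ^^ p) (\<lambda>w. fock_fun x w / of_real (sqrt (fact m))) 0 = fact p * (coef x p / of_real (sqrt (fact p)) / of_real (sqrt (fact m)))" .
  moreover have "(\<lambda>w. fock_fun x w / of_real (sqrt (fact m))) holomorphic_on UNIV"
    by (intro holomorphic_intros fock_fun_holomorphic) auto
  ultimately have "gauss_inner (fock_map m x) (fock_map m (unit_vec p)) =
      of_real (sqrt (fact m)) * (fact p * (coef x p / of_real (sqrt (fact p)) / of_real (sqrt (fact m)))) / of_real (sqrt (fact p))"
    using gauss_inner_fock_map_unit_vec[OF _ fock_map_leading assms] by simp
  also have "\<dots> = coef x p"
    by (simp add: field_simps flip: of_real_sqrt_fact_mult)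
  finally show ?thesis .
qed

lemma fock_map_trunc: "fock_map m (trunc N x) = (\<lambda>w. \<Sum>p<N. coef x p * fock_map m (unit_vec p) w)"
  by (simp add: trunc_def fock_map_sum fock_map_cscale)

lemma sqi_fock_map_trunc: "square_integrable_gauss (fock_map m (trunc N x))"
  unfolding fock_map_trunc by (intro sqi_sum sqi_cmult sqi_fock_map_unit_vec)

lemma gauss_inner_fock_map_trunc:
  assumes "square_integrable_gauss (fock_map m x)"
  shows "gauss_inner (fock_map m x) (fock_map m (trunc N y)) = (\<Sum>p<N. coef x p * cnj (coef y p))"
  unfolding fock_map_trunc
  using assms by (subst gauss_inner_sum_right)
    (auto intro: sqi_cmult sqi_fock_map_unit_vec simp: gauss_inner_cmult_right gauss_inner_fock_map_unit_vec' mult.commute)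

lemma gauss_norm_fock_map_trunc: "gauss_norm (fock_map m (trunc N x)) = norm (trunc N x)"
proof -
  have "complex_of_real ((gauss_norm (fock_map m (trunc N x)))\<^sup>2) = (\<Sum>p<N. coef x p * cnj (coef x p))"
    unfolding gauss_inner_self[symmetric]
    by (simp add: gauss_inner_fock_map_trunc[OF sqi_fock_map_trunc] coef_trunc)
  also have "\<dots> = cin (trunc N x) (trunc N x)"
  proof (rule sums_unique2[OF _ sums_cin])
    show "(\<lambda>n. coef (trunc N x) n * cnj (coef (trunc N x) n)) sums (\<Sum>p<N. coef x p * cnj (coef x p))"
      using sums_finite[of "{..<N}" "\<lambda>n. coef (trunc N x) n * cnj (coef (trunc N x) n)"] by (simp add: coef_trunc)
  qed
  finally have "(gauss_norm (fock_map m (trunc N x)))\<^sup>2 = (norm (trunc N x))\<^sup>2"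
    by (simp add: cin_self del: of_real_power)
  then show ?thesis by (rule power2_eq_imp_eq) auto
qed

lemma fock_map_trunc_tendsto: "(\<lambda>N. fock_map m (trunc N x) w) \<longlonglongrightarrow> fock_map m x w"
proof -
  obtain k :: "nat \<Rightarrow> complex" where k: "\<And>g w. g holomorphic_on UNIV \<Longrightarrow>
     (creation ^^ m) g w = (\<Sum>i<Suc m. k i * cnj w ^ (m - i) * (deriv ^^ i) g w)"
    using creation_power_expand[of m] by blast
  have "(\<lambda>N. (deriv ^^ i) (fock_fun (trunc N x)) w) \<longlonglongrightarrow> (deriv ^^ i) (fock_fun x) w" for i
    by (rule higher_deriv_complex_uniform_limit[OF uniform_limit_fock_fun_trunc[where r="norm w + 1"]])
       (auto intro!: always_eventually holomorphic_on_subset[OF fock_fun_holomorphic])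
  then show ?thesis
    unfolding fock_map_def k[OF fock_fun_holomorphic] by (intro tendsto_intros) auto
qed

text \<open>Truncations are finite combinations of an orthonormal family, so their norms are known
  exactly; they converge pointwise, and Fatou's lemma yields the bound. Equality of norms follows
  later from the inner products.\<close>

lemma sqi_fock_map: "square_integrable_gauss (fock_map m x)"
  and gauss_norm_fock_map_le: "gauss_norm (fock_map m x) \<le> norm x"
proof -
  have "(\<integral>\<^sup>+w. ennreal ((norm (fock_map m x w))\<^sup>2) \<partial>gauss) = (\<integral>\<^sup>+w. liminf (\<lambda>N. ennreal ((norm (fock_map m (trunc N x) w))\<^sup>2)) \<partial>gauss)"
  proof (rule nn_integral_cong)
    fix w
    have "(\<lambda>N. ennreal ((norm (fock_map m (trunc N x) w))\<^sup>2)) \<longlonglongrightarrow> ennreal ((norm (fock_map m x w))\<^sup>2)"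
      by (intro tendsto_ennrealI tendsto_intros fock_map_trunc_tendsto)
    then show "ennreal ((norm (fock_map m x w))\<^sup>2) = liminf (\<lambda>N. ennreal ((norm (fock_map m (trunc N x) w))\<^sup>2))"
      by (rule lim_imp_Liminf[OF sequentially_bot, symmetric])
  qed
  also have "\<dots> \<le> liminf (\<lambda>N. \<integral>\<^sup>+w. ennreal ((norm (fock_map m (trunc N x) w))\<^sup>2) \<partial>gauss)"
    by (rule nn_integral_liminf) auto
  also have "\<dots> \<le> liminf (\<lambda>N. ennreal ((norm x)\<^sup>2))"
  proof (rule Liminf_mono, rule always_eventually, rule allI)
    fix N
    have "(\<integral>\<^sup>+w. ennreal ((norm (fock_map m (trunc N x) w))\<^sup>2) \<partial>gauss) = ennreal ((norm (trunc N x))\<^sup>2)"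
      unfolding gauss_norm_fock_map_trunc[of m N x, symmetric] gauss_norm_power2
      by (rule nn_integral_eq_integral) (auto intro: integrable_sqi sqi_fock_map_trunc)
    also have "\<dots> \<le> ennreal ((norm x)\<^sup>2)"
      by (intro ennreal_leI power_mono norm_trunc_le) auto
    finally show "(\<integral>\<^sup>+w. ennreal ((norm (fock_map m (trunc N x) w))\<^sup>2) \<partial>gauss) \<le> ennreal ((norm x)\<^sup>2)" .
  qed
  finally have le: "(\<integral>\<^sup>+w. ennreal ((norm (fock_map m x w))\<^sup>2) \<partial>gauss) \<le> ennreal ((norm x)\<^sup>2)"
    by (simp add: Liminf_const)
  have int: "integrable gauss (\<lambda>w. (norm (fock_map m x w))\<^sup>2)"
    using order.strict_trans1[OF le ennreal_less_top] by (intro integrableI_bounded) auto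
  then show "square_integrable_gauss (fock_map m x)"
    by (simp add: square_integrable_gauss_def)
  have "ennreal ((gauss_norm (fock_map m x))\<^sup>2) \<le> ennreal ((norm x)\<^sup>2)"
    using le unfolding gauss_norm_power2 by (subst nn_integral_eq_integral[OF int, symmetric]) auto
  then have "(gauss_norm (fock_map m x))\<^sup>2 \<le> (norm x)\<^sup>2" by simp
  then show "gauss_norm (fock_map m x) \<le> norm x"
    by (rule power2_le_imp_le) simp
qed

lemma gauss_inner_fock_map_tendsto:
  assumes "square_integrable_gauss f"
  shows "(\<lambda>N. gauss_inner f (fock_map m (trunc N x))) \<longlonglongrightarrow> gauss_inner f (fock_map m x)"
proof -
  have b: "norm (gauss_inner f (fock_map m (trunc N x)) - gauss_inner f (fock_map m x)) \<le> gauss_norm f * norm (trunc N x - x)" for N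
  proof -
    have "norm (gauss_inner f (fock_map m (trunc N x)) - gauss_inner f (fock_map m x)) = norm (gauss_inner f (fock_map m (trunc N x - x)))"
      by (simp add: fock_map_diff gauss_inner_diff_right assms sqi_fock_map)
    also have "\<dots> \<le> gauss_norm f * gauss_norm (fock_map m (trunc N x - x))"
      by (intro norm_gauss_inner_le assms sqi_fock_map)
    also have "\<dots> \<le> gauss_norm f * norm (trunc N x - x)"
      by (intro mult_left_mono gauss_norm_fock_map_le) simp
    finally show ?thesis .
  qed
  have "(\<lambda>N. gauss_norm f * norm (trunc N x - x)) \<longlonglongrightarrow> gauss_norm f * norm (x - x)"
    by (intro tendsto_intros trunc_tendsto)
  then have lim: "(\<lambda>N. gauss_norm f * norm (trunc N x - x)) \<longlonglongrightarrow> 0" by simp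
  have "(\<lambda>N. gauss_inner f (fock_map m (trunc N x)) - gauss_inner f (fock_map m x)) \<longlonglongrightarrow> 0"
    by (rule Lim_null_comparison[OF always_eventually lim]) (use b in simp)
  then show ?thesis by (rule LIM_zero_cancel)
qed

lemma gauss_inner_fock_map: "gauss_inner (fock_map m x) (fock_map m y) = cin x y"
proof (rule LIMSEQ_unique)
  show "(\<lambda>N. \<Sum>p<N. coef x p * cnj (coef y p)) \<longlonglongrightarrow> cin x y"
    using sums_cin unfolding sums_def .
  show "(\<lambda>N. \<Sum>p<N. coef x p * cnj (coef y p)) \<longlonglongrightarrow> gauss_inner (fock_map m x) (fock_map m y)"
    using gauss_inner_fock_map_tendsto[OF sqi_fock_map[of m x], of m y]
    by (simp only: gauss_inner_fock_map_trunc[OF sqi_fock_map])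
qed

lemma gauss_norm_fock_map [simp]: "gauss_norm (fock_map m x) = norm x"
proof -
  have "(gauss_norm (fock_map m x))\<^sup>2 = (norm x)\<^sup>2"
    using gauss_inner_self[of "fock_map m x"] by (simp add: gauss_inner_fock_map cin_self del: of_real_power)
  then show ?thesis by (rule power2_eq_imp_eq) auto
qed

lemma gauss_dist_fock_map: "gauss_dist (fock_map m x) (fock_map m y) = dist x y"
  using gauss_norm_fock_map[of m "x - y"] by (simp add: gauss_dist_def fock_map_diff dist_norm)

lemma fock_map_eq_iff: "fock_map m x = fock_map m y \<longleftrightarrow> x = y"
  using gauss_dist_fock_map[of m x y] gauss_dist_fock_map[of m x x] by auto

text \<open>A function in \<open>polyfock m\<close> has leading coefficient 0 when regarded as one
  of order m+1, so it is orthogonal to all basis vectors, and by continuity to their limits.\<close>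

lemma fock_map_mem: "fock_map m x \<in> true_polyfock (Suc m)"
proof -
  have "gauss_inner (fock_map m x) g = 0" if "g \<in> polyfock m" for g
  proof -
    have g: "polyanalytic m g" "square_integrable_gauss g" using that by (auto simp: mem_polyfock_iff)
    have e: "gauss_inner g (fock_map m (unit_vec p)) = 0" for p
      using gauss_inner_fock_map_unit_vec[of "\<lambda>_. 0" m g p] g by (simp add: higher_deriv_const)
    have "gauss_inner g (fock_map m (trunc N x)) = 0" for N
      unfolding fock_map_trunc
      using g by (subst gauss_inner_sum_right) (auto intro: sqi_cmult sqi_fock_map_unit_vec simp: gauss_inner_cmult_right e)
    then have "(\<lambda>N. 0) \<longlonglongrightarrow> gauss_inner g (fock_map m x)"
      using gauss_inner_fock_map_tendsto[OF g(2), of m x] by simp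
    then have "gauss_inner g (fock_map m x) = 0"
      by (simp add: tendsto_const_iff)
    then show ?thesis using gauss_inner_cnj[of g "fock_map m x"] by simp
  qed
  then show ?thesis
    by (auto simp: true_polyfock_def mem_polyfock_iff polyanalytic_fock_map sqi_fock_map)
qed

text \<open>The Riesz vector of \<open>\<langle>\<cdot>, f\<rangle>\<close> determines the leading coefficient of \<open>f\<close>, so what is left is
  both in \<open>polyfock m\<close> and orthogonal to it.\<close>

lemma fock_map_surj:
  assumes "f \<in> true_polyfock (Suc m)"
  obtains x where "f = fock_map m x"
proof -
  have f: "polyanalytic (Suc m) f" "square_integrable_gauss f"
    using assms by (auto simp: true_polyfock_def mem_polyfock_iff split: if_splits)
  have orth: "gauss_inner f g = 0" if "g \<in> polyfock m" "m > 0" for g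
    using assms that by (auto simp: true_polyfock_def)
  obtain h where h: "\<And>i. h i holomorphic_on UNIV" "f = (\<lambda>w. \<Sum>i<Suc m. cnj w ^ i * h i w)"
    using polyanalyticE[OF f(1)] by metis
  obtain x where x: "\<And>y. gauss_inner (fock_map m y) f = cin y x"
  proof (rule riesz_ell2[of "\<lambda>y. gauss_inner (fock_map m y) f" "gauss_norm f"])
    show "norm (gauss_inner (fock_map m y) f) \<le> gauss_norm f * norm y" for y
      using norm_gauss_inner_le[OF sqi_fock_map f(2), of m y] by (simp add: mult.commute)
  qed (simp_all add: fock_map_add fock_map_cscale gauss_inner_add_left gauss_inner_cmult_left sqi_fock_map f(2))
  have cx: "coef x p = gauss_inner f (fock_map m (unit_vec p))" for p
    using arg_cong[OF x[of "unit_vec p"], of cnj] by (simp add: gauss_inner_cnj cnj_cin cin_unit_vec)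
  have fl: "polyanalytic m (\<lambda>w. f w - cnj w ^ m * h m w)"
    using polyanalyticI[of h m] h by simp
  have "coef x p = of_real (sqrt (fact m)) * (deriv ^^ p) (h m) 0 / of_real (sqrt (fact p))" for p
    unfolding cx by (rule gauss_inner_fock_map_unit_vec[OF h(1) fl f(2)])
  then have "coef x p / of_real (sqrt (fact p)) * w ^ p = of_real (sqrt (fact m)) * ((deriv ^^ p) (h m) 0 / fact p * w ^ p)" for p w
    by (simp flip: of_real_sqrt_fact_mult)
  then have "(\<lambda>p. of_real (sqrt (fact m)) * ((deriv ^^ p) (h m) 0 / fact p * w ^ p)) sums fock_fun x w" for w
    using sums_fock_fun[of x w] by simp
  then have "of_real (sqrt (fact m)) * h m w = fock_fun x w" for w
    by (rule sums_unique2[OF sums_mult[OF entire_sums[OF h(1)]]])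
  then have hm: "fock_fun x w / of_real (sqrt (fact m)) = h m w" for w
    by (simp add: field_simps flip: \<open>\<And>w. of_real (sqrt (fact m)) * h m w = fock_fun x w\<close>)
  define r where "r = (\<lambda>w. f w - fock_map m x w)"
  have r: "square_integrable_gauss r"
    unfolding r_def by (intro sqi_diff f sqi_fock_map)
  have "r = (\<lambda>w. (f w - cnj w ^ m * h m w) - (fock_map m x w - cnj w ^ m * (fock_fun x w / of_real (sqrt (fact m)))))"
    unfolding r_def hm by simp
  then have "polyanalytic m r"
    using polyanalytic_diff[OF fl fock_map_leading] by simp
  have "r = (\<lambda>w. 0)"
  proof (cases "m = 0")
    case False
    have rm: "r \<in> polyfock m" using \<open>polyanalytic m r\<close> r by (simp add: mem_polyfock_iff)
    have "gauss_inner (fock_map m x) r = 0"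
      using fock_map_mem[of m x] rm False by (auto simp: true_polyfock_def)
    then have "gauss_inner r r = 0"
      using gauss_inner_diff_left[OF f(2) sqi_fock_map r, of m x] orth[OF rm] False by (simp add: r_def)
    then have "gauss_norm r = 0"
      by (simp add: gauss_inner_self del: of_real_power)
    then show ?thesis
      by (rule gauss_norm_eq_0_imp[OF r polyanalytic_continuous[OF \<open>polyanalytic m r\<close>]])
  qed (use \<open>polyanalytic m r\<close> in simp)
  then have "f = fock_map m x" by (auto simp: r_def fun_eq_iff)
  then show ?thesis by (rule that)
qed

lemma true_polyfock_eq: "true_polyfock (Suc m) = range (fock_map m)"
  using fock_map_mem fock_map_surj by blast

section \<open>The Weyl operators\<close>

lemma has_wirtinger_shift:
  assumes "has_wirtinger f a b (w - z)"
  shows "has_wirtinger (\<lambda>w. f (w - z)) a b w"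
proof -
  have "((\<lambda>w. w - z) has_derivative (\<lambda>v. v)) (at w)"
    by (auto intro!: derivative_eq_intros)
  from has_derivative_compose[OF this] show ?thesis
    using assms by (simp add: has_wirtinger_def)
qed

lemma has_wirtinger_weyl:
  assumes "f differentiable (at (w - z))"
  shows "has_wirtinger (weyl z f) (cnj z * weyl z f w + weyl z (d_z f) w) (weyl z (d_zbar f) w) w"
proof -
  have "((\<lambda>w. exp (w * cnj z - of_real ((norm z)\<^sup>2 / 2))) has_field_derivative
      cnj z * exp (w * cnj z - of_real ((norm z)\<^sup>2 / 2))) (at w)"
    by (auto intro!: derivative_eq_intros)
  from has_wirtinger_mult[OF has_wirtinger_holomorphic[OF this]
      has_wirtinger_shift[OF has_wirtinger_differentiable[OF assms]]]
  show ?thesis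
    by (simp add: weyl_def[abs_def] mult_ac)
qed

text \<open>Differentiating the exponential factor of the Weyl operator yields an extra
  \<open>cnj z\<close>, exactly what turns multiplication by \<open>cnj w\<close> into
  multiplication by \<open>cnj (w - z)\<close>.\<close>

lemma creation_weyl:
  assumes "\<And>w. f differentiable (at w)"
  shows "creation (weyl z f) = weyl z (creation f)"
proof
  fix w
  have "weyl z (creation f) w = - weyl z (d_z f) w + cnj (w - z) * weyl z f w"
    by (simp add: weyl_def creation_def algebra_simps)
  then show "creation (weyl z f) w = weyl z (creation f) w"
    unfolding creation_eqI[OF has_wirtinger_weyl[OF assms]] by (simp add: algebra_simps)
qed

lemma creation_power_weyl:
  assumes "polyanalytic n f"
  shows "(creation ^^ m) (weyl z f) = weyl z ((creation ^^ m) f)"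
proof (induction m)
  case (Suc m)
  have "(creation ^^ m) f differentiable (at w)" for w
    using polyanalytic_differentiable[OF polyanalytic_creation_power[OF assms]] .
  then show ?case using Suc by (simp add: creation_weyl)
qed simp

lemma weyl_measurable [measurable]: "f \<in> borel_measurable borel \<Longrightarrow> weyl z f \<in> borel_measurable borel"
  unfolding weyl_def[abs_def] using measurable_compose[of "\<lambda>w. w - z" borel borel f borel] by simp

lemma norm_diff_power2: "(norm (w - z))\<^sup>2 = (norm w)\<^sup>2 - 2 * Re (w * cnj z) + (norm z)\<^sup>2" for w z :: complex
  unfolding cmod_power2 by (simp add: power2_eq_square algebra_simps)

lemma weyl_kernel_mult:
  "exp (w * cnj z - of_real ((norm z)\<^sup>2 / 2)) * cnj (exp (w * cnj z - of_real ((norm z)\<^sup>2 / 2)))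
     = of_real (exp (2 * Re (w * cnj z) - (norm z)\<^sup>2))"
proof -
  have "exp (w * cnj z - of_real ((norm z)\<^sup>2 / 2)) * cnj (exp (w * cnj z - of_real ((norm z)\<^sup>2 / 2)))
     = exp ((w * cnj z - of_real ((norm z)\<^sup>2 / 2)) + cnj (w * cnj z - of_real ((norm z)\<^sup>2 / 2)))"
    by (simp only: exp_add exp_cnj)
  also have "(w * cnj z - of_real ((norm z)\<^sup>2 / 2)) + cnj (w * cnj z - of_real ((norm z)\<^sup>2 / 2))
     = of_real (2 * Re (w * cnj z) - (norm z)\<^sup>2)"
    by (simp add: complex_eq_iff)
  finally show ?thesis by (simp only: exp_of_real)
qed

text \<open>The exponential is the ratio of the Gaussian densities at w - z and at w. It is also the
  squared modulus of the factor in \<open>weyl\<close>, whence the unitarity of the Weyl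
  operators.\<close>

lemma gauss_translate:
  fixes F :: "complex \<Rightarrow> 'b::{banach, second_countable_topology}"
  assumes [measurable]: "F \<in> borel_measurable borel"
  shows "integrable gauss (\<lambda>w. exp (2 * Re (w * cnj z) - (norm z)\<^sup>2) *\<^sub>R F (w - z)) \<longleftrightarrow> integrable gauss F" (is ?I)
    and "(LINT w|gauss. exp (2 * Re (w * cnj z) - (norm z)\<^sup>2) *\<^sub>R F (w - z)) = (LINT w|gauss. F w)" (is ?E)
proof -
  let ?G = "\<lambda>w. exp (2 * Re (w * cnj z) - (norm z)\<^sup>2) *\<^sub>R F (w - z)"
  define H where "H = (\<lambda>w. (exp (- (norm w)\<^sup>2) / pi) *\<^sub>R F w)"
  have [measurable]: "H \<in> borel_measurable borel" unfolding H_def by measurable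
  have G [measurable]: "?G \<in> borel_measurable borel"
    using measurable_compose[of "\<lambda>w. w - z" borel borel F borel] by simp
  have e: "(\<lambda>w. (exp (- (norm w)\<^sup>2) / pi) *\<^sub>R ?G w) = (\<lambda>w. H (- z + w))"
  proof
    fix w
    have "exp (- (norm w)\<^sup>2) * exp (2 * Re (w * cnj z) - (norm z)\<^sup>2) = exp (- (norm (- z + w))\<^sup>2)"
      using norm_diff_power2[of w z] by (simp flip: exp_add)
    then show "(exp (- (norm w)\<^sup>2) / pi) *\<^sub>R ?G w = H (- z + w)"
      unfolding H_def by (simp only: scaleR_scaleR times_divide_eq_left) simp
  qed
  have "integrable gauss ?G \<longleftrightarrow> integrable lborel (\<lambda>w. H (- z + w))"
    unfolding e[symmetric] by (rule integrable_gauss_iff[OF G])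
  also have "\<dots> \<longleftrightarrow> integrable (distr lborel borel ((+) (- z))) H"
    by (subst integrable_distr_eq) auto
  also have "\<dots> \<longleftrightarrow> integrable gauss F"
    unfolding lborel_distr_plus H_def by (rule integrable_gauss_iff[OF assms, symmetric])
  finally show ?I .
  have "(LINT w|gauss. ?G w) = (LINT w|lborel. H (- z + w))"
    unfolding e[symmetric] by (rule integral_gauss_eq[OF G])
  also have "\<dots> = (LINT w|distr lborel borel ((+) (- z)). H w)"
    by (subst integral_distr) auto
  also have "\<dots> = (LINT w|gauss. F w)"
    unfolding lborel_distr_plus H_def by (rule integral_gauss_eq[OF assms, symmetric])
  finally show ?E .
qed

lemma norm_weyl_power2: "(norm (weyl z f w))\<^sup>2 = exp (2 * Re (w * cnj z) - (norm z)\<^sup>2) *\<^sub>R (norm (f (w - z)))\<^sup>2"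
proof -
  have "complex_of_real ((norm (exp (w * cnj z - of_real ((norm z)\<^sup>2 / 2))))\<^sup>2) = of_real (exp (2 * Re (w * cnj z) - (norm z)\<^sup>2))"
    unfolding weyl_kernel_mult[symmetric] complex_norm_square ..
  then have "(norm (exp (w * cnj z - of_real ((norm z)\<^sup>2 / 2))))\<^sup>2 = exp (2 * Re (w * cnj z) - (norm z)\<^sup>2)"
    by (simp only: of_real_eq_iff)
  then show ?thesis by (simp only: weyl_def norm_mult power_mult_distrib real_scaleR_def)
qed

lemma sqi_weyl:
  assumes "square_integrable_gauss f"
  shows "square_integrable_gauss (weyl z f)"
  using assms gauss_translate(1)[of "\<lambda>w. (norm (f w))\<^sup>2" z]
  by (auto simp: square_integrable_gauss_def norm_weyl_power2)

lemma gauss_inner_weyl: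
  assumes "square_integrable_gauss f" "square_integrable_gauss g"
  shows "gauss_inner (weyl z f) (weyl z g) = gauss_inner f g"
proof -
  note [measurable] = assms[THEN sqi_measurable]
  have "weyl z f w * cnj (weyl z g w) = exp (2 * Re (w * cnj z) - (norm z)\<^sup>2) *\<^sub>R (f (w - z) * cnj (g (w - z)))" for w
    unfolding weyl_def scaleR_conv_of_real weyl_kernel_mult[symmetric] complex_cnj_mult by (simp only: mult_ac)
  then show ?thesis
    using gauss_translate(2)[of "\<lambda>w. f w * cnj (g w)" z] by (simp add: gauss_inner_def)
qed

text \<open>The canonical commutation relation in exponential form. The phase is unimodular, so it
  cancels whenever the same product acts on both arguments of a sesquilinear form.\<close>

lemma weyl_weyl: "weyl u (weyl v f) = (\<lambda>w. cis (- Im (u * cnj v)) * weyl (u + v) f w)"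
proof
  fix w
  have "(w * cnj u - of_real ((norm u)\<^sup>2 / 2)) + ((w - u) * cnj v - of_real ((norm v)\<^sup>2 / 2))
      = \<i> * of_real (- Im (u * cnj v)) + (w * cnj (u + v) - of_real ((norm (u + v))\<^sup>2 / 2))"
    unfolding cmod_power2 by (simp add: complex_eq_iff power2_eq_square field_simps)
  then show "weyl u (weyl v f) w = cis (- Im (u * cnj v)) * weyl (u + v) f w"
    unfolding weyl_def cis_conv_exp mult.assoc[symmetric] exp_add[symmetric]
    by (simp add: diff_diff_eq)
qed

lemma ex_weyl_op: "\<exists>y. fock_fun y = weyl z (fock_fun x)"
proof -
  have "weyl z (fock_fun x) holomorphic_on UNIV"
    unfolding weyl_def[abs_def]
    by (intro holomorphic_intros holomorphic_on_compose_gen[OF _ fock_fun_holomorphic, unfolded o_def]) auto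
  moreover have "square_integrable_gauss (weyl z (fock_fun x))"
    using sqi_fock_map[of 0 x] by (intro sqi_weyl) (simp add: fock_map_0)
  ultimately have "weyl z (fock_fun x) \<in> true_polyfock (Suc 0)"
    by (simp add: true_polyfock_def mem_polyfock_iff polyanalytic_1)
  then show ?thesis
    by (metis fock_map_0 fock_map_surj)
qed

text \<open>The choice is unique because \<open>fock_fun\<close> is injective. One operator on
  sequences serves all levels: since \<open>creation\<close> commutes with \<open>weyl\<close>,
  every \<open>fock_map m\<close> intertwines it with the Weyl operator.\<close>

definition weyl_op :: "complex \<Rightarrow> ell2 \<Rightarrow> ell2" where
  "weyl_op z x = (SOME y. fock_fun y = weyl z (fock_fun x))"

lemma fock_fun_weyl_op: "fock_fun (weyl_op z x) = weyl z (fock_fun x)"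
  unfolding weyl_op_def by (rule someI_ex[OF ex_weyl_op])

lemma fock_map_weyl_op: "fock_map m (weyl_op z x) = weyl z (fock_map m x)"
proof -
  have "(creation ^^ m) (weyl z (fock_fun x)) = weyl z ((creation ^^ m) (fock_fun x))"
    by (rule creation_power_weyl[of "Suc 0"]) (simp add: polyanalytic_1 fock_fun_holomorphic)
  then show ?thesis
    by (simp add: fock_map_def[abs_def] fock_fun_weyl_op fun_eq_iff) (simp add: weyl_def)
qed

lemma fock_fun_eqI: "fock_fun x = fock_fun y \<Longrightarrow> x = y"
  using fock_map_eq_iff[of 0] by (simp add: fock_map_0)

lemma fock_fun_add: "fock_fun (x + y) = (\<lambda>w. fock_fun x w + fock_fun y w)"
  and fock_fun_cscale: "fock_fun (cscale c x) = (\<lambda>w. c * fock_fun x w)"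
  by (simp_all add: fock_fun_def[abs_def] cin_add_left cin_cscale_left)

lemma weyl_op_add: "weyl_op z (x + y) = weyl_op z x + weyl_op z y"
  and weyl_op_cscale: "weyl_op z (cscale c x) = cscale c (weyl_op z x)"
  by (rule fock_fun_eqI, simp add: fock_fun_weyl_op fock_fun_add fock_fun_cscale weyl_def fun_eq_iff algebra_simps)+

lemma cin_weyl_op: "cin (weyl_op z x) (weyl_op z y) = cin x y"
  using gauss_inner_weyl[OF sqi_fock_map sqi_fock_map, of z 0 x 0 y]
  by (simp add: gauss_inner_fock_map flip: fock_map_weyl_op)

lemma norm_weyl_op [simp]: "norm (weyl_op z x) = norm x"
proof -
  have "(norm (weyl_op z x))\<^sup>2 = (norm x)\<^sup>2"
    using cin_weyl_op[of z x x] by (simp add: cin_self del: of_real_power)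
  then show ?thesis by (rule power2_eq_imp_eq) auto
qed

lemma weyl_op_weyl_op: "weyl_op u (weyl_op v x) = cscale (cis (- Im (u * cnj v))) (weyl_op (u + v) x)"
  by (rule fock_fun_eqI) (simp add: fock_fun_weyl_op weyl_weyl fock_fun_cscale)

lemma weyl_op_0 [simp]: "weyl_op 0 x = x"
  by (rule fock_fun_eqI) (simp add: fock_fun_weyl_op weyl_def fun_eq_iff)

lemma weyl_op_inverse [simp]: "weyl_op (- z) (weyl_op z x) = x" "weyl_op z (weyl_op (- z) x) = x"
  by (simp_all add: weyl_op_weyl_op)

lemma cin_weyl_op_left: "cin (weyl_op z x) y = cin x (weyl_op (- z) y)"
  using cin_weyl_op[of z x "weyl_op (- z) y"] by simp

lemma weyl_op_kvec: "weyl_op u (kvec z) = cscale (exp (- u * cnj z - of_real ((norm u)\<^sup>2 / 2))) (kvec (z + u))"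
proof (rule fock_fun_eqI)
  have "exp (w * cnj u - of_real ((norm u)\<^sup>2 / 2)) * exp ((w - u) * cnj z)
      = exp (- u * cnj z - of_real ((norm u)\<^sup>2 / 2)) * exp (w * cnj (z + u))" for w
    unfolding exp_add[symmetric] by (rule arg_cong[where f=exp]) (simp add: algebra_simps)
  then show "fock_fun (weyl_op u (kvec z)) = fock_fun (cscale (exp (- u * cnj z - of_real ((norm u)\<^sup>2 / 2))) (kvec (z + u)))"
    unfolding fock_fun_weyl_op fock_fun_kvec fock_fun_cscale by (auto simp: weyl_def)
qed

text \<open>Fatou's lemma on the function side: the norm is lower semicontinuous under pointwise
  convergence of the associated entire functions.\<close>

lemma norm_le_of_pointwise_limit:
  assumes lim: "\<And>w. (\<lambda>n. fock_fun (v n) w) \<longlonglongrightarrow> fock_fun v' w" and C: "\<And>n. norm (v n) \<le> C"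
  shows "norm v' \<le> C"
proof -
  have [measurable]: "fock_fun x \<in> borel_measurable borel" for x
    using fock_map_measurable[of 0 x] by (simp add: fock_map_0)
  have int: "(\<integral>\<^sup>+w. ennreal ((norm (fock_fun x w))\<^sup>2) \<partial>gauss) = ennreal ((norm x)\<^sup>2)" for x
    unfolding gauss_norm_fock_map[of 0 x, symmetric] gauss_norm_power2 fock_map_0
    by (rule nn_integral_eq_integral) (use sqi_fock_map[of 0] in \<open>auto simp: fock_map_0 intro: integrable_sqi\<close>)
  have "ennreal ((norm v')\<^sup>2) = (\<integral>\<^sup>+w. liminf (\<lambda>n. ennreal ((norm (fock_fun (v n) w))\<^sup>2)) \<partial>gauss)"
    unfolding int[symmetric]
  proof (rule nn_integral_cong)
    fix w
    have "(\<lambda>n. ennreal ((norm (fock_fun (v n) w))\<^sup>2)) \<longlonglongrightarrow> ennreal ((norm (fock_fun v' w))\<^sup>2)"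
      by (intro tendsto_ennrealI tendsto_intros lim)
    then show "ennreal ((norm (fock_fun v' w))\<^sup>2) = liminf (\<lambda>n. ennreal ((norm (fock_fun (v n) w))\<^sup>2))"
      by (rule lim_imp_Liminf[OF sequentially_bot, symmetric])
  qed
  also have "\<dots> \<le> liminf (\<lambda>n. \<integral>\<^sup>+w. ennreal ((norm (fock_fun (v n) w))\<^sup>2) \<partial>gauss)"
    by (rule nn_integral_liminf) auto
  also have "\<dots> \<le> liminf (\<lambda>n::nat. ennreal (C\<^sup>2))"
    unfolding int by (intro Liminf_mono always_eventually allI ennreal_leI power_mono C) auto
  finally have "(norm v')\<^sup>2 \<le> C\<^sup>2" by (simp add: Liminf_const)
  moreover have "C \<ge> 0" using C[of 0] norm_ge_zero order_trans by blast
  ultimately show ?thesis by (rule power2_le_imp_le)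
qed

text \<open>By the parallelogram law, pointwise convergence of vectors of equal length is norm
  convergence.\<close>

lemma continuous_weyl_op: "continuous_on UNIV (\<lambda>u. weyl_op u x)"
proof (rule continuous_at_imp_continuous_on, rule ballI)
  fix u
  show "continuous (at u) (\<lambda>u. weyl_op u x)"
    unfolding continuous_at_sequentially o_def
  proof (intro allI impI, rule ccontr)
    fix X assume X: "X \<longlonglongrightarrow> u" and "\<not> (\<lambda>n. weyl_op (X n) x) \<longlonglongrightarrow> weyl_op u x"
    then obtain e where e: "e > 0" "\<not> (\<forall>\<^sub>F n in sequentially. dist (weyl_op (X n) x) (weyl_op u x) < e)"
      unfolding tendsto_iff by blast
    then obtain r :: "nat \<Rightarrow> nat" where r: "strict_mono r" "\<And>n. \<not> dist (weyl_op (X (r n)) x) (weyl_op u x) < e"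
      using not_eventually_sequentiallyD by blast
    define v where "v = (\<lambda>n. weyl_op (X (r n)) x + weyl_op u x)"
    \<comment> \<open>If the distances stay at least e, the parallelogram law bounds the norms of
      the sums \<open>v n\<close> by C, which is less than 2 |x|. But these sums converge pointwise
      to twice \<open>weyl_op u x\<close>, whose norm is 2 |x|.\<close>
    define C where "C = sqrt (4 * (norm x)\<^sup>2 - e\<^sup>2)"
    have vC: "(norm (v n))\<^sup>2 \<le> 4 * (norm x)\<^sup>2 - e\<^sup>2" for n
    proof -
      have "(norm (a + b))\<^sup>2 + (norm (a - b))\<^sup>2 = 2 * (norm a)\<^sup>2 + 2 * (norm b)\<^sup>2" for a b :: ell2
        by (simp add: power2_norm_eq_inner inner_simps inner_commute)
      from this[of "weyl_op (X (r n)) x" "weyl_op u x"]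
      have "(norm (v n))\<^sup>2 = 4 * (norm x)\<^sup>2 - (dist (weyl_op (X (r n)) x) (weyl_op u x))\<^sup>2"
        by (simp add: v_def dist_norm)
      moreover have "e\<^sup>2 \<le> (dist (weyl_op (X (r n)) x) (weyl_op u x))\<^sup>2"
        using r(2)[of n] e(1) by (intro power_mono) auto
      ultimately show ?thesis by simp
    qed
    then have pos: "4 * (norm x)\<^sup>2 - e\<^sup>2 \<ge> 0"
      using order_trans[OF zero_le_power2] by blast
    have "norm (weyl_op u x + weyl_op u x) \<le> C"
    proof (rule norm_le_of_pointwise_limit)
      fix w
      have Xr: "(\<lambda>n. X (r n)) \<longlonglongrightarrow> u"
        using LIMSEQ_subseq_LIMSEQ[OF X r(1)] by (simp add: o_def)
      have "isCont (fock_fun x) (w - u)"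
        using holomorphic_on_imp_continuous_on[OF fock_fun_holomorphic]
        by (simp add: continuous_on_eq_continuous_at)
      then have "(\<lambda>n. fock_fun x (w - X (r n))) \<longlonglongrightarrow> fock_fun x (w - u)"
        by (rule isCont_tendsto_compose) (intro tendsto_intros Xr)
      then have "(\<lambda>n. weyl (X (r n)) (fock_fun x) w + weyl u (fock_fun x) w) \<longlonglongrightarrow> weyl u (fock_fun x) w + weyl u (fock_fun x) w"
        unfolding weyl_def by (intro tendsto_intros Xr) auto
      then show "(\<lambda>n. fock_fun (v n) w) \<longlonglongrightarrow> fock_fun (weyl_op u x + weyl_op u x) w"
        by (simp add: v_def fock_fun_add fock_fun_weyl_op)
    next
      fix n show "norm (v n) \<le> C"
        unfolding C_def by (rule real_le_rsqrt[OF vC])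
    qed
    then have "2 * norm x \<le> C"
      by (simp flip: scaleR_2)
    then have "(2 * norm x)\<^sup>2 \<le> C\<^sup>2" by (intro power_mono) auto
    then show False
      using e(1) pos by (simp add: C_def power_mult_distrib)
  qed
qed

section \<open>Bounded sesquilinear forms\<close>

definition bounded_form :: "real \<Rightarrow> (ell2 \<Rightarrow> ell2 \<Rightarrow> complex) \<Rightarrow> bool" where
  "bounded_form C \<beta> \<longleftrightarrow>
     (\<forall>x y z. \<beta> (x + y) z = \<beta> x z + \<beta> y z) \<and> (\<forall>c x z. \<beta> (cscale c x) z = c * \<beta> x z) \<and>
     (\<forall>x y z. \<beta> z (x + y) = \<beta> z x + \<beta> z y) \<and> (\<forall>c x z. \<beta> z (cscale c x) = cnj c * \<beta> z x) \<and>
     0 \<le> C \<and> (\<forall>x y. norm (\<beta> x y) \<le> C * (norm x * norm y))"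

lemma bounded_formD:
  assumes "bounded_form C \<beta>"
  shows "\<beta> (x + y) z = \<beta> x z + \<beta> y z" "\<beta> (cscale c x) z = c * \<beta> x z"
    "\<beta> z (x + y) = \<beta> z x + \<beta> z y" "\<beta> z (cscale c x) = cnj c * \<beta> z x"
    "0 \<le> C" "norm (\<beta> x y) \<le> C * (norm x * norm y)"
  using assms unfolding bounded_form_def by blast+

lemma bounded_form_bilinear:
  assumes "bounded_form C \<beta>"
  shows "bounded_bilinear \<beta>"
proof
  note D = bounded_formD[OF assms]
  fix x y z :: ell2 and r :: real
  show "\<beta> (x + y) z = \<beta> x z + \<beta> y z" "\<beta> z (x + y) = \<beta> z x + \<beta> z y" by (rule D)+
  show "\<beta> (r *\<^sub>R x) y = r *\<^sub>R \<beta> x y" "\<beta> x (r *\<^sub>R y) = r *\<^sub>R \<beta> x y"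
    by (simp_all add: scaleR_ell2_def D scaleR_conv_of_real)
  show "\<exists>K. \<forall>x y. norm (\<beta> x y) \<le> norm x * norm y * K"
    using D(6) by (intro exI[of _ C]) (simp add: mult.commute)
qed

lemma bounded_form_cin: "bounded_form 1 cin"
  by (simp add: bounded_form_def cin_add_left cin_add_right cin_cscale_left cin_cscale_right norm_cin_le)

definition rank_one :: "ell2 \<Rightarrow> ell2 \<Rightarrow> ell2 \<Rightarrow> ell2 \<Rightarrow> complex" where
  "rank_one a b x y = cin x a * cin b y"

lemma bounded_form_rank_one: "bounded_form (norm a * norm b) (rank_one a b)"
proof -
  have "norm (rank_one a b x y) \<le> norm a * norm b * (norm x * norm y)" for x y
  proof -
    have "norm (rank_one a b x y) \<le> (norm x * norm a) * (norm b * norm y)"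
      unfolding rank_one_def norm_mult by (intro mult_mono norm_cin_le) auto
    then show ?thesis by (simp add: mult_ac)
  qed
  then show ?thesis
    by (simp add: bounded_form_def rank_one_def cin_add_left cin_add_right cin_cscale_left cin_cscale_right algebra_simps)
qed

text \<open>For the form of an operator B this is the form of W_u B W_(-u), because the adjoint of
  \<open>weyl_op u\<close> is \<open>weyl_op (- u)\<close>.\<close>

definition orbit :: "(ell2 \<Rightarrow> ell2 \<Rightarrow> complex) \<Rightarrow> ell2 \<Rightarrow> ell2 \<Rightarrow> complex \<Rightarrow> complex" where
  "orbit \<beta> x y u = \<beta> (weyl_op (- u) x) (weyl_op (- u) y)"

text \<open>The squared norm of \<open>kvec u\<close> is exp(|u|^2), so the prefactor normalizes the
  coherent state in both arguments.\<close>

definition berezin :: "(ell2 \<Rightarrow> ell2 \<Rightarrow> complex) \<Rightarrow> complex \<Rightarrow> complex" where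
  "berezin \<beta> u = of_real (exp (- (norm u)\<^sup>2)) * \<beta> (kvec u) (kvec u)"

lemma norm_orbit_le:
  assumes "bounded_form C \<beta>"
  shows "norm (orbit \<beta> x y u) \<le> C * (norm x * norm y)"
  using bounded_formD(6)[OF assms, of "weyl_op (- u) x" "weyl_op (- u) y"] by (simp add: orbit_def)

lemma orbit_measurable [measurable]:
  assumes "bounded_form C \<beta>"
  shows "orbit \<beta> x y \<in> borel_measurable borel"
proof (rule borel_measurable_continuous_onI)
  have "continuous_on UNIV (\<lambda>u. weyl_op (- u) x)" for x
    by (rule continuous_on_compose2[OF continuous_weyl_op]) (auto intro: continuous_intros)
  then show "continuous_on UNIV (orbit \<beta> x y)"
    unfolding orbit_def[abs_def] by (intro bounded_bilinear.continuous_on[OF bounded_form_bilinear[OF assms]])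
qed

lemma orbit_add: "bounded_form C \<beta> \<Longrightarrow> orbit \<beta> (x + y) z u = orbit \<beta> x z u + orbit \<beta> y z u"
    "bounded_form C \<beta> \<Longrightarrow> orbit \<beta> z (x + y) u = orbit \<beta> z x u + orbit \<beta> z y u"
  and orbit_cscale: "bounded_form C \<beta> \<Longrightarrow> orbit \<beta> (cscale c x) z u = c * orbit \<beta> x z u"
    "bounded_form C \<beta> \<Longrightarrow> orbit \<beta> z (cscale c x) u = cnj c * orbit \<beta> z x u"
  by (simp_all add: orbit_def weyl_op_add weyl_op_cscale bounded_formD)

lemma norm_berezin_le:
  assumes "bounded_form C \<beta>"
  shows "norm (berezin \<beta> u) \<le> C"
proof -
  have "norm (\<beta> (kvec u) (kvec u)) \<le> C * exp ((norm u)\<^sup>2)"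
    using bounded_formD(6)[OF assms, of "kvec u" "kvec u"] by (simp add: norm_kvec flip: exp_add)
  then have "exp (- (norm u)\<^sup>2) * norm (\<beta> (kvec u) (kvec u)) \<le> exp (- (norm u)\<^sup>2) * (C * exp ((norm u)\<^sup>2))"
    by (intro mult_left_mono) auto
  moreover have "exp (- (norm u)\<^sup>2) * (C * exp ((norm u)\<^sup>2)) = C"
    by (simp add: exp_minus)
  ultimately show ?thesis
    by (simp add: berezin_def norm_mult)
qed

lemma weyl_op_uminus_kvec: "weyl_op (- u) (kvec z) = cscale (exp (u * cnj z - of_real ((norm u)\<^sup>2 / 2))) (kvec (z - u))"
  using weyl_op_kvec[of "- u" z] by simp

text \<open>Covariance: Weyl operators permute the coherent states up to scalars. The phases cancel
  between the two arguments, and the moduli combine to the normalization at u - v.\<close>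

lemma berezin_orbit:
  assumes "bounded_form C \<beta>"
  shows "of_real (exp (- (norm u)\<^sup>2)) * orbit \<beta> (kvec u) (kvec u) v = berezin \<beta> (u - v)"
proof -
  have "orbit \<beta> (kvec u) (kvec u) v = of_real (exp (2 * Re (v * cnj u) - (norm v)\<^sup>2)) * \<beta> (kvec (u - v)) (kvec (u - v))"
  proof -
    have "exp (u * cnj v - of_real ((norm v)\<^sup>2 / 2)) = cnj (exp (v * cnj u - of_real ((norm v)\<^sup>2 / 2)))"
      "Re (v * cnj u) = Re (u * cnj v)"
      by (simp_all add: exp_cnj mult.commute)
    with weyl_kernel_mult[of u v] have "cnj (exp (v * cnj u - of_real ((norm v)\<^sup>2 / 2))) * exp (v * cnj u - of_real ((norm v)\<^sup>2 / 2))
       = of_real (exp (2 * Re (v * cnj u) - (norm v)\<^sup>2))"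
      by simp
    then show ?thesis
      unfolding orbit_def weyl_op_uminus_kvec bounded_formD(2,4)[OF assms] by (simp only: mult.assoc[symmetric])
  qed
  moreover have "exp (- (norm u)\<^sup>2) * exp (2 * Re (v * cnj u) - (norm v)\<^sup>2) = exp (- (norm (u - v))\<^sup>2)"
    using norm_diff_power2[of v u] by (simp add: norm_minus_commute flip: exp_add)
  ultimately show ?thesis
    unfolding berezin_def by (simp only: mult.assoc[symmetric] of_real_mult[symmetric])
qed

lemma berezin_measurable [measurable]:
  assumes "bounded_form C \<beta>"
  shows "berezin \<beta> \<in> borel_measurable borel"
proof -
  have e: "berezin \<beta> = (\<lambda>v. orbit \<beta> (kvec 0) (kvec 0) (- v))"
    using berezin_orbit[OF assms, of 0] by (auto simp: fun_eq_iff)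
  show ?thesis
    unfolding e using measurable_compose[OF _ orbit_measurable[OF assms], of uminus borel "kvec 0" "kvec 0"] by simp
qed

text \<open>The convolution of a function with an operator in the sense of quantum harmonic
  analysis, with the integral taken weakly.\<close>

definition conv :: "(complex \<Rightarrow> real) \<Rightarrow> (ell2 \<Rightarrow> ell2 \<Rightarrow> complex) \<Rightarrow> ell2 \<Rightarrow> ell2 \<Rightarrow> complex" where
  "conv \<phi> \<beta> x y = (LINT u|lborel. of_real (\<phi> u) * orbit \<beta> x y u)"

lemma integrable_conv:
  assumes "integrable lborel \<phi>" "bounded_form C \<beta>"
  shows "integrable lborel (\<lambda>u. of_real (\<phi> u) * orbit \<beta> x y u)"
proof (rule Bochner_Integration.integrable_bound)
  have [measurable]: "\<phi> \<in> borel_measurable borel" using borel_measurable_integrable[OF assms(1)] by simp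
  note [measurable] = orbit_measurable[OF assms(2)]
  show "integrable lborel (\<lambda>u. \<phi> u * (C * (norm x * norm y)))"
    using assms by simp
  show "(\<lambda>u. of_real (\<phi> u) * orbit \<beta> x y u) \<in> borel_measurable lborel" by measurable
  show "AE u in lborel. norm (of_real (\<phi> u) * orbit \<beta> x y u) \<le> norm (\<phi> u * (C * (norm x * norm y)))"
    using norm_orbit_le[OF assms(2), of x y] bounded_formD(5)[OF assms(2)]
    by (auto simp: norm_mult abs_mult intro!: mult_left_mono)
qed

lemma norm_conv_le:
  assumes "integrable lborel \<phi>" "bounded_form C \<beta>"
  shows "norm (conv \<phi> \<beta> x y) \<le> (LINT u|lborel. \<bar>\<phi> u\<bar>) * C * (norm x * norm y)"
proof -
  have "norm (conv \<phi> \<beta> x y) \<le> (LINT u|lborel. norm (of_real (\<phi> u) * orbit \<beta> x y u))"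
    unfolding conv_def by (rule integral_norm_bound)
  also have "\<dots> \<le> (LINT u|lborel. \<bar>\<phi> u\<bar> * (C * (norm x * norm y)))"
    by (rule integral_mono[OF integrable_norm[OF integrable_conv[OF assms]]])
       (use assms norm_orbit_le[OF assms(2), of x y] in \<open>auto simp: norm_mult intro!: mult_left_mono\<close>)
  finally show ?thesis by simp
qed

lemma bounded_form_conv:
  assumes "integrable lborel \<phi>" "bounded_form C \<beta>"
  shows "bounded_form ((LINT u|lborel. \<bar>\<phi> u\<bar>) * C) (conv \<phi> \<beta>)"
  unfolding bounded_form_def
proof (intro conjI allI)
  note I = integrable_conv[OF assms]
  fix x y z c
  show "conv \<phi> \<beta> (x + y) z = conv \<phi> \<beta> x z + conv \<phi> \<beta> y z"
    "conv \<phi> \<beta> z (x + y) = conv \<phi> \<beta> z x + conv \<phi> \<beta> z y"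
    unfolding conv_def by (simp_all add: orbit_add[OF assms(2)] distrib_left I)
  show "conv \<phi> \<beta> (cscale c x) z = c * conv \<phi> \<beta> x z"
    "conv \<phi> \<beta> z (cscale c x) = cnj c * conv \<phi> \<beta> z x"
    unfolding conv_def by (simp_all add: orbit_cscale[OF assms(2)] mult.left_commute flip: integral_mult_right_zero)
  show "0 \<le> (LINT u|lborel. \<bar>\<phi> u\<bar>) * C" using bounded_formD(5)[OF assms(2)] by simp
  show "norm (conv \<phi> \<beta> x y) \<le> (LINT u|lborel. \<bar>\<phi> u\<bar>) * C * (norm x * norm y)"
    by (rule norm_conv_le[OF assms])
qed

section \<open>Compact forms\<close>

text \<open>For the form of an operator B this says that the finite rank operators obtained by
  composing B with \<open>trunc N\<close> converge to B in norm. Truncating the first argument alone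
  is enough.\<close>

definition compact_form :: "(ell2 \<Rightarrow> ell2 \<Rightarrow> complex) \<Rightarrow> bool" where
  "compact_form \<beta> \<longleftrightarrow> (\<forall>e>0. \<exists>N0. \<forall>N\<ge>N0. \<forall>x y. norm (\<beta> (x - trunc N x) y) \<le> e * (norm x * norm y))"

lemma compact_form_limit:
  assumes "\<And>e. e > 0 \<Longrightarrow> \<exists>\<gamma>. compact_form \<gamma> \<and> (\<forall>x y. norm (\<beta> x y - \<gamma> x y) \<le> e * (norm x * norm y))"
  shows "compact_form \<beta>"
  unfolding compact_form_def
proof (intro allI impI)
  fix e :: real assume "e > 0"
  then obtain \<gamma> where \<gamma>: "compact_form \<gamma>" "\<And>x y. norm (\<beta> x y - \<gamma> x y) \<le> e/2 * (norm x * norm y)"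
    using assms[of "e/2"] by auto
  then obtain N0 where N0: "\<And>N x y. N \<ge> N0 \<Longrightarrow> norm (\<gamma> (x - trunc N x) y) \<le> e/2 * (norm x * norm y)"
    unfolding compact_form_def using \<open>e > 0\<close> by (meson half_gt_zero)
  have "norm (\<beta> (x - trunc N x) y) \<le> e * (norm x * norm y)" if "N \<ge> N0" for N x y
  proof -
    have "norm (\<beta> (x - trunc N x) y) \<le> norm (\<beta> (x - trunc N x) y - \<gamma> (x - trunc N x) y) + norm (\<gamma> (x - trunc N x) y)"
      using norm_triangle_ineq[of "\<beta> (x - trunc N x) y - \<gamma> (x - trunc N x) y" "\<gamma> (x - trunc N x) y"] by simp
    also have "\<dots> \<le> e/2 * (norm (x - trunc N x) * norm y) + e/2 * (norm x * norm y)"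
      by (intro add_mono \<gamma>(2) N0 that)
    also have "\<dots> \<le> e/2 * (norm x * norm y) + e/2 * (norm x * norm y)"
      using \<open>e > 0\<close> by (intro add_mono mult_left_mono mult_right_mono norm_diff_trunc_le) auto
    finally show ?thesis by simp
  qed
  then show "\<exists>N0. \<forall>N\<ge>N0. \<forall>x y. norm (\<beta> (x - trunc N x) y) \<le> e * (norm x * norm y)" by blast
qed

lemma compact_form_add:
  assumes "compact_form \<beta>" "compact_form \<gamma>"
  shows "compact_form (\<lambda>x y. \<beta> x y + \<gamma> x y)"
  unfolding compact_form_def
proof (intro allI impI)
  fix e :: real assume "e > 0"
  obtain N1 where N1: "\<And>N x y. N \<ge> N1 \<Longrightarrow> norm (\<beta> (x - trunc N x) y) \<le> e/2 * (norm x * norm y)"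
    using assms(1) \<open>e > 0\<close> unfolding compact_form_def by (meson half_gt_zero)
  obtain N2 where N2: "\<And>N x y. N \<ge> N2 \<Longrightarrow> norm (\<gamma> (x - trunc N x) y) \<le> e/2 * (norm x * norm y)"
    using assms(2) \<open>e > 0\<close> unfolding compact_form_def by (meson half_gt_zero)
  have "norm (\<beta> (x - trunc N x) y + \<gamma> (x - trunc N x) y) \<le> e * (norm x * norm y)" if "N \<ge> max N1 N2" for N x y
    using norm_triangle_ineq[of "\<beta> (x - trunc N x) y" "\<gamma> (x - trunc N x) y"] N1[of N x y] N2[of N x y] that by simp
  then show "\<exists>N0. \<forall>N\<ge>N0. \<forall>x y. norm (\<beta> (x - trunc N x) y + \<gamma> (x - trunc N x) y) \<le> e * (norm x * norm y)" by blast
qed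

lemma compact_form_cmult:
  assumes "compact_form \<beta>"
  shows "compact_form (\<lambda>x y. c * \<beta> x y)"
  unfolding compact_form_def
proof (intro allI impI)
  fix e :: real assume "e > 0"
  define d where "d = e / (norm c + 1)"
  have pos: "norm c + 1 > 0" using norm_ge_zero[of c] by linarith
  then have "d > 0" using \<open>e > 0\<close> by (simp add: d_def)
  then obtain N1 where N1: "\<And>N x y. N \<ge> N1 \<Longrightarrow> norm (\<beta> (x - trunc N x) y) \<le> d * (norm x * norm y)"
    using assms unfolding compact_form_def by meson
  have "norm c * d \<le> e"
    using pos \<open>e > 0\<close> by (simp add: d_def field_simps)
  have "norm (c * \<beta> (x - trunc N x) y) \<le> e * (norm x * norm y)" if "N \<ge> N1" for N x y
  proof -
    have "norm (c * \<beta> (x - trunc N x) y) \<le> norm c * (d * (norm x * norm y))"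
      unfolding norm_mult by (intro mult_left_mono N1 that) auto
    also have "\<dots> \<le> e * (norm x * norm y)"
      using mult_right_mono[OF \<open>norm c * d \<le> e\<close>, of "norm x * norm y"] by (simp add: mult.assoc)
    finally show ?thesis .
  qed
  then show "\<exists>N0. \<forall>N\<ge>N0. \<forall>x y. norm (c * \<beta> (x - trunc N x) y) \<le> e * (norm x * norm y)" by blast
qed

lemma compact_conv_lincomb:
  assumes "bounded_form C \<beta>" "integrable lborel \<phi>" "integrable lborel \<psi>"
    and "compact_form (conv \<phi> \<beta>)" "compact_form (conv \<psi> \<beta>)"
  shows "compact_form (conv (\<lambda>u. a * \<phi> u + b * \<psi> u) \<beta>)"
proof -
  have "conv (\<lambda>u. a * \<phi> u + b * \<psi> u) \<beta> x y = of_real a * conv \<phi> \<beta> x y + of_real b * conv \<psi> \<beta> x y" for x y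
    unfolding conv_def using integrable_conv[OF assms(2,1), of x y] integrable_conv[OF assms(3,1), of x y]
    by (simp add: distrib_right mult.assoc)
  then have "conv (\<lambda>u. a * \<phi> u + b * \<psi> u) \<beta> = (\<lambda>x y. of_real a * conv \<phi> \<beta> x y + of_real b * conv \<psi> \<beta> x y)"
    by blast
  then show ?thesis
    using assms(4,5) by (simp only:) (intro compact_form_add compact_form_cmult)
qed

lemma compact_conv_limit:
  assumes b: "bounded_form C \<beta>" and \<phi>: "integrable lborel \<phi>"
    and int: "\<And>n. integrable lborel (\<psi> n)" and cpt: "\<And>n. compact_form (conv (\<psi> n) \<beta>)"
    and lim: "(\<lambda>n. LINT u|lborel. \<bar>\<phi> u - \<psi> n u\<bar>) \<longlonglongrightarrow> 0"
  shows "compact_form (conv \<phi> \<beta>)"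
proof (rule compact_form_limit)
  fix e :: real assume "e > 0"
  have C: "C \<ge> 0" by (rule bounded_formD(5)[OF b])
  then have "e / (C + 1) > 0" using \<open>e > 0\<close> by simp
  then have "\<forall>\<^sub>F n in sequentially. (LINT u|lborel. \<bar>\<phi> u - \<psi> n u\<bar>) < e / (C + 1)"
    by (rule order_tendstoD(2)[OF lim])
  then obtain n where n: "(LINT u|lborel. \<bar>\<phi> u - \<psi> n u\<bar>) < e / (C + 1)"
    by (auto simp: eventually_sequentially)
  have "(LINT u|lborel. \<bar>\<phi> u - \<psi> n u\<bar>) * C \<le> (e / (C + 1)) * (C + 1)"
    using n C \<open>e > 0\<close> by (intro mult_mono) auto
  then have le: "(LINT u|lborel. \<bar>\<phi> u - \<psi> n u\<bar>) * C \<le> e" using C by simp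
  have "norm (conv \<phi> \<beta> x y - conv (\<psi> n) \<beta> x y) \<le> e * (norm x * norm y)" for x y
  proof -
    have "conv \<phi> \<beta> x y - conv (\<psi> n) \<beta> x y = conv (\<lambda>u. \<phi> u - \<psi> n u) \<beta> x y"
      unfolding conv_def using integrable_conv[OF \<phi> b, of x y] integrable_conv[OF int[of n] b, of x y]
      by (simp add: left_diff_distrib)
    then have "norm (conv \<phi> \<beta> x y - conv (\<psi> n) \<beta> x y) \<le> (LINT u|lborel. \<bar>\<phi> u - \<psi> n u\<bar>) * C * (norm x * norm y)"
      using norm_conv_le[OF _ b, of "\<lambda>u. \<phi> u - \<psi> n u" x y] \<phi> int[of n] by simp
    also have "\<dots> \<le> e * (norm x * norm y)" by (intro mult_right_mono le) auto
    finally show ?thesis .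
  qed
  then show "\<exists>\<gamma>. compact_form \<gamma> \<and> (\<forall>x y. norm (conv \<phi> \<beta> x y - \<gamma> x y) \<le> e * (norm x * norm y))"
    using cpt[of n] by blast
qed

section \<open>Toeplitz forms\<close>

definition toeplitz :: "(complex \<Rightarrow> complex) \<Rightarrow> ell2 \<Rightarrow> ell2 \<Rightarrow> complex" where
  "toeplitz s x y = (LINT u|gauss. s u * (fock_fun x u * cnj (fock_fun y u)))"

lemma sqi_fock_fun: "square_integrable_gauss (fock_fun x)"
  using sqi_fock_map[of 0] by (simp add: fock_map_0)

lemma gauss_norm_fock_fun: "gauss_norm (fock_fun x) = norm x"
  using gauss_norm_fock_map[of 0] by (simp add: fock_map_0)

lemma fock_fun_measurable [measurable]: "fock_fun x \<in> borel_measurable borel"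
  by (rule sqi_measurable[OF sqi_fock_fun])

lemma integral_fock_fun_mult_le: "(LINT u|gauss. norm (fock_fun x u) * norm (fock_fun y u)) \<le> norm x * norm y"
  using integral_norm_mult_le[OF sqi_fock_fun sqi_fock_fun, of x y] by (simp add: gauss_norm_fock_fun)

lemma integrable_toeplitz:
  assumes [measurable]: "s \<in> borel_measurable borel" and s: "\<And>u. norm (s u) \<le> B"
  shows "integrable gauss (\<lambda>u. s u * (fock_fun x u * cnj (fock_fun y u)))"
proof (rule Bochner_Integration.integrable_bound)
  show "integrable gauss (\<lambda>u. B * (norm (fock_fun x u) * norm (fock_fun y u)))"
    using integrable_sqi_mult[OF sqi_fock_fun sqi_fock_fun] by simp
  have "B \<ge> 0" using s norm_ge_zero order_trans by blast
  then show "AE u in gauss. norm (s u * (fock_fun x u * cnj (fock_fun y u)))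
      \<le> norm (B * (norm (fock_fun x u) * norm (fock_fun y u)))"
    using s by (auto simp: norm_mult abs_mult intro!: mult_right_mono)
qed measurable

text \<open>The coordinates of \<open>kvec u\<close> have moduli |u|^p / sqrt(p!), increasing in
  |u|, so the tail at the real point R controls the tails on the whole disc.\<close>

lemma trunc_kvec_antimono:
  assumes "norm u \<le> R" "R \<ge> 0"
  shows "norm (kvec u - trunc N (kvec u)) \<le> norm (kvec (of_real R) - trunc N (kvec (of_real R)))"
proof -
  have "norm (coef (kvec u) n) \<le> norm (coef (kvec (of_real R)) n)" for n
    using assms by (simp add: coef_kvec norm_divide norm_power divide_right_mono power_mono)
  then have "(norm (kvec u - trunc N (kvec u)))\<^sup>2 \<le> (norm (kvec (of_real R) - trunc N (kvec (of_real R))))\<^sup>2"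
    by (intro sums_le[OF _ sums_norm_power2 sums_norm_power2]) (auto simp: coef_trunc intro!: power_mono)
  then show ?thesis by (rule power2_le_imp_le) simp
qed

lemma integrable_gauss_const [simp]: "integrable gauss (\<lambda>u. c::real)"
  and measure_gauss_UNIV [simp]: "measure gauss UNIV = 1"
proof -
  have 1: "integrable gauss (\<lambda>u. 1::real)" "(LINT u|gauss. 1::real) = 1"
    using has_bochner_integral_gauss_moment[of 0] by (auto simp: has_bochner_integral_iff)
  show "integrable gauss (\<lambda>u. c::real)"
    using integrable_mult_right[of c gauss "\<lambda>u. 1::real"] 1(1) by simp
  show "measure gauss UNIV = 1"
    using 1(2) by simp
qed

text \<open>Outside a large disc the symbol is small. Inside it, the value of the tail of x at u is
  the pairing of x with the tail of \<open>kvec u\<close>, which tends to zero uniformly on the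
  disc.\<close>

lemma compact_toeplitz:
  assumes s [measurable]: "s \<in> borel_measurable borel" and B: "\<And>u. norm (s u) \<le> B"
    and vanish: "(s \<longlongrightarrow> 0) at_infinity"
  shows "compact_form (toeplitz s)"
  unfolding compact_form_def
proof (intro allI impI)
  fix e :: real assume "e > 0"
  obtain R where R: "R > 0" "\<And>u. norm u \<ge> R \<Longrightarrow> norm (s u) \<le> e/2"
  proof -
    obtain R where "\<And>u. norm u \<ge> R \<Longrightarrow> dist (s u) 0 < e/2"
      using vanish \<open>e > 0\<close> unfolding Lim_at_infinity by (meson half_gt_zero)
    then show ?thesis using that[of "max R 1"] by (force simp: less_imp_le)
  qed
  have B0: "B \<ge> 0" using B norm_ge_zero order_trans by blast
  \<comment> \<open>On the disc the symbol and the value of y contribute at most B exp(R^2/2) times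
    the norm of y; adding 1 keeps K positive when B = 0.\<close>
  define K where "K = B * exp (R\<^sup>2 / 2) + 1"
  have K: "K > 0" using B0 by (simp add: K_def add_nonneg_pos)
  have "(\<lambda>N. norm (kvec (of_real R) - trunc N (kvec (of_real R)))) \<longlonglongrightarrow> norm (kvec (of_real R) - kvec (of_real R))"
    by (intro tendsto_intros trunc_tendsto)
  then have "\<forall>\<^sub>F N in sequentially. norm (kvec (of_real R) - trunc N (kvec (of_real R))) < e / (2 * K)"
    by (rule order_tendstoD(2)) (use \<open>e > 0\<close> K in simp)
  then obtain N0 where N0: "\<And>N. N \<ge> N0 \<Longrightarrow> norm (kvec (of_real R) - trunc N (kvec (of_real R))) < e / (2 * K)"
    by (auto simp: eventually_sequentially)
  have "norm (toeplitz s (x - trunc N x) y) \<le> e * (norm x * norm y)" if N: "N \<ge> N0" for N x y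
  proof -
    define x' where "x' = x - trunc N x"
    have pt: "norm (s u * (fock_fun x' u * cnj (fock_fun y u)))
        \<le> e/2 * (norm x * norm y) + e/2 * (norm (fock_fun x' u) * norm (fock_fun y u))" for u
    proof (cases "norm u \<ge> R")
      case True
      then have "norm (s u) * (norm (fock_fun x' u) * norm (fock_fun y u)) \<le> e/2 * (norm (fock_fun x' u) * norm (fock_fun y u))"
        by (intro mult_right_mono R) auto
      then show ?thesis using \<open>e > 0\<close> by (simp add: norm_mult add_increasing)
    next
      case False
      then have u: "norm u \<le> R" by simp
      have "norm (fock_fun x' u) = norm (cin x (kvec u - trunc N (kvec u)))"
        by (simp add: x'_def fock_fun_def cin_diff_left cin_diff_right cin_trunc)
      also have "\<dots> \<le> norm x * norm (kvec u - trunc N (kvec u))"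
        by (rule norm_cin_le)
      also have "\<dots> \<le> norm x * (e / (2 * K))"
        using trunc_kvec_antimono[OF u, of N] N0[OF N] R(1) by (intro mult_left_mono) auto
      finally have 1: "norm (fock_fun x' u) \<le> norm x * (e / (2 * K))" .
      have "(norm u)\<^sup>2 \<le> R\<^sup>2" using u by (intro power_mono) auto
      then have "norm y * exp ((norm u)\<^sup>2 / 2) \<le> norm y * exp (R\<^sup>2 / 2)"
        by (intro mult_left_mono) auto
      then have 2: "norm (fock_fun y u) \<le> norm y * exp (R\<^sup>2 / 2)"
        using norm_fock_fun_le[of y u] by linarith
      have "norm (s u) * (norm (fock_fun x' u) * norm (fock_fun y u)) \<le> B * ((norm x * (e / (2 * K))) * (norm y * exp (R\<^sup>2 / 2)))"
        using B0 \<open>e > 0\<close> K by (intro mult_mono B 1 2 mult_nonneg_nonneg) auto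
      also have "\<dots> = (B * exp (R\<^sup>2 / 2)) / K * (e/2 * (norm x * norm y))"
        using K by (simp add: field_simps)
      also have "\<dots> \<le> 1 * (e/2 * (norm x * norm y))"
        using K \<open>e > 0\<close> by (intro mult_right_mono) (auto simp: K_def)
      finally show ?thesis using \<open>e > 0\<close> by (simp add: norm_mult add_increasing2)
    qed
    have int: "integrable gauss (\<lambda>u. norm (fock_fun x' u) * norm (fock_fun y u))"
      by (rule integrable_sqi_mult[OF sqi_fock_fun sqi_fock_fun])
    have "norm (toeplitz s x' y) \<le> (LINT u|gauss. norm (s u * (fock_fun x' u * cnj (fock_fun y u))))"
      unfolding toeplitz_def by (rule integral_norm_bound)
    also have "\<dots> \<le> (LINT u|gauss. e/2 * (norm x * norm y) + e/2 * (norm (fock_fun x' u) * norm (fock_fun y u)))"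
    proof (rule integral_mono)
      show "integrable gauss (\<lambda>u. norm (s u * (fock_fun x' u * cnj (fock_fun y u))))"
        by (intro integrable_norm integrable_toeplitz[OF s B])
      show "integrable gauss (\<lambda>u. e/2 * (norm x * norm y) + e/2 * (norm (fock_fun x' u) * norm (fock_fun y u)))"
        by (intro Bochner_Integration.integrable_add integrable_mult_right integrable_gauss_const int)
    qed (use pt in simp)
    also have "\<dots> = e/2 * (norm x * norm y) + e/2 * (LINT u|gauss. norm (fock_fun x' u) * norm (fock_fun y u))"
      using int by (subst Bochner_Integration.integral_add) auto
    also have "\<dots> \<le> e/2 * (norm x * norm y) + e/2 * (norm x * norm y)"
    proof -
      have "norm x' * norm y \<le> norm x * norm y"
        unfolding x'_def by (intro mult_right_mono norm_diff_trunc_le) auto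
      then show ?thesis
        using integral_fock_fun_mult_le[of x' y] \<open>e > 0\<close> by (intro add_mono mult_left_mono) auto
    qed
    finally show ?thesis by (simp add: x'_def)
  qed
  then show "\<exists>N0. \<forall>N\<ge>N0. \<forall>x y. norm (toeplitz s (x - trunc N x) y) \<le> e * (norm x * norm y)" by blast
qed

section \<open>Gaussian averages of a form are Toeplitz forms\<close>

lemma lborel_complex_scale:
  fixes f :: "complex \<Rightarrow> 'b::{banach, second_countable_topology}"
  assumes [measurable]: "f \<in> borel_measurable borel" and "c > 0"
  shows "integrable lborel f \<longleftrightarrow> integrable lborel (\<lambda>x. f (c *\<^sub>R x))" (is ?I)
    and "(LINT x|lborel. f x) = c\<^sup>2 *\<^sub>R (LINT x|lborel. f (c *\<^sub>R x))" (is ?E)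
proof -
  have l: "lborel = density (distr lborel borel (\<lambda>x::complex. c *\<^sub>R x)) (\<lambda>_. ennreal (c\<^sup>2))"
    using lborel_affine[of c "0::complex"] \<open>c > 0\<close> by simp
  have "integrable lborel f \<longleftrightarrow> integrable (density (distr lborel borel (\<lambda>x::complex. c *\<^sub>R x)) (\<lambda>_. ennreal (c\<^sup>2))) f"
    by (subst l) simp
  also have "\<dots> \<longleftrightarrow> integrable lborel (\<lambda>x. c\<^sup>2 *\<^sub>R f (c *\<^sub>R x))"
    using \<open>c > 0\<close> by (subst integrable_density) (auto simp: integrable_distr_eq)
  also have "\<dots> \<longleftrightarrow> integrable lborel (\<lambda>x. f (c *\<^sub>R x))"
    using \<open>c > 0\<close> integrable_scaleR_right[of "1 / c\<^sup>2" lborel "\<lambda>x. c\<^sup>2 *\<^sub>R f (c *\<^sub>R x)"]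
      integrable_scaleR_right[of "c\<^sup>2" lborel "\<lambda>x. f (c *\<^sub>R x)"] by auto
  finally show ?I .
  have "(LINT x|lborel. f x) = (LINT x|density (distr lborel borel (\<lambda>x::complex. c *\<^sub>R x)) (\<lambda>_. ennreal (c\<^sup>2)). f x)"
    by (subst l) simp
  also have "\<dots> = (LINT x|lborel. c\<^sup>2 *\<^sub>R f (c *\<^sub>R x))"
    using \<open>c > 0\<close> by (subst integral_density) (auto simp: integral_distr)
  finally show ?E by simp
qed

text \<open>The integrand is a coherent state times the conjugate of another one, so the isometry of
  \<open>fock_map 0\<close> gives the integral as an inner product of two kernels.\<close>

lemma gauss_exponential_integral:
  "integrable gauss (\<lambda>u. exp (u * a) * exp (cnj u * b))"
  "(LINT u|gauss. exp (u * a) * exp (cnj u * b)) = exp (a * b)"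
proof -
  have e: "(\<lambda>u. fock_fun (kvec (cnj a)) u * cnj (fock_fun (kvec b) u)) = (\<lambda>u. exp (u * a) * exp (cnj u * b))"
    by (simp add: fock_fun_kvec exp_cnj)
  show "integrable gauss (\<lambda>u. exp (u * a) * exp (cnj u * b))"
    using integrable_sqi_inner[OF sqi_fock_fun[of "kvec (cnj a)"] sqi_fock_fun[of "kvec b"]] unfolding e .
  have "gauss_inner (fock_fun (kvec (cnj a))) (fock_fun (kvec b)) = cin (kvec (cnj a)) (kvec b)"
    using gauss_inner_fock_map[of 0] by (simp add: fock_map_0)
  then show "(LINT u|gauss. exp (u * a) * exp (cnj u * b)) = exp (a * b)"
    unfolding gauss_inner_def e by (simp add: cin_kvec_kvec mult.commute)
qed

lemma gaussian_integral:
  assumes "c > 0"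
  shows "(LINT u|lborel. exp (- c * (norm u)\<^sup>2) *\<^sub>R (exp (u * a) * exp (cnj u * b))) = (pi / c) *\<^sub>R exp (a * b / c)" (is ?E)
    and "integrable lborel (\<lambda>u. exp (- c * (norm u)\<^sup>2) *\<^sub>R (exp (u * a) * exp (cnj u * b)))" (is ?I)
proof -
  define s where "s = 1 / sqrt c"
  have s: "s > 0" "s\<^sup>2 = 1 / c" "c * s\<^sup>2 = 1" using assms by (auto simp: s_def power_divide)
  let ?f = "\<lambda>u. exp (- c * (norm u)\<^sup>2) *\<^sub>R (exp (u * a) * exp (cnj u * b))"
  let ?g = "\<lambda>u. exp (u * (of_real s * a)) * exp (cnj u * (of_real s * b))"
  have [measurable]: "?f \<in> borel_measurable borel" by measurable
  have g [measurable]: "?g \<in> borel_measurable borel" by measurable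
  have e: "?f (s *\<^sub>R u) = pi *\<^sub>R ((exp (- (norm u)\<^sup>2) / pi) *\<^sub>R ?g u)" for u
  proof -
    have "c * (norm (s *\<^sub>R u))\<^sup>2 = (c * s\<^sup>2) * (norm u)\<^sup>2"
      by (simp add: power_mult_distrib)
    then have "exp (- c * (norm (s *\<^sub>R u))\<^sup>2) = exp (- (norm u)\<^sup>2)"
      by (simp only: s(3) mult_1_left mult_minus_left)
    moreover have "exp (s *\<^sub>R u * a) * exp (cnj (s *\<^sub>R u) * b) = ?g u"
      by (simp add: scaleR_conv_of_real mult_ac)
    ultimately show ?thesis by simp
  qed
  have "integrable lborel (\<lambda>u. (exp (- (norm u)\<^sup>2) / pi) *\<^sub>R ?g u)"
    using gauss_exponential_integral(1)[of "of_real s * a" "of_real s * b"]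
    by (subst (asm) integrable_gauss_iff) auto
  then have "integrable lborel (\<lambda>u. ?f (s *\<^sub>R u))"
    unfolding e by (rule integrable_scaleR_right)
  then show ?I
    by (subst lborel_complex_scale(1)[OF _ s(1)]) auto
  have "(LINT u|lborel. ?f u) = s\<^sup>2 *\<^sub>R (LINT u|lborel. ?f (s *\<^sub>R u))"
    by (rule lborel_complex_scale(2)[OF _ s(1)]) auto
  also have "\<dots> = s\<^sup>2 *\<^sub>R pi *\<^sub>R (LINT u|gauss. ?g u)"
    unfolding e by (simp only: integral_scaleR_right integral_gauss_eq[OF g])
  also have "(LINT u|gauss. ?g u) = exp (of_real s * a * (of_real s * b))"
    by (rule gauss_exponential_integral)
  also have "of_real s * a * (of_real s * b) = a * b / of_real c"
  proof -
    have "of_real s * a * (of_real s * b) = of_real (s\<^sup>2) * (a * b)" by (simp add: power2_eq_square)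
    then show ?thesis by (simp add: s(2))
  qed
  finally show ?E by (simp add: s(2))
qed

text \<open>The coherent states are total: pairing with all of them evaluates the entire function of
  the Riesz vector at every point.\<close>

lemma ell2_functional_zero:
  assumes add: "\<And>x y. f (x + y) = f x + f y" and cs: "\<And>c x. f (cscale c x) = c * f x"
    and bd: "\<And>x. norm (f x :: complex) \<le> C * norm x" and k: "\<And>z. f (kvec z) = 0"
  shows "f x = 0"
proof -
  obtain b where b: "\<And>x. f x = cin x b"
    by (rule riesz_ell2[of f, OF add cs bd]) (rule that)
  have "fock_fun b = fock_fun 0"
  proof
    fix w
    have "fock_fun b w = cnj (f (kvec w))" by (simp add: fock_fun_def b cnj_cin)
    then show "fock_fun b w = fock_fun 0 w"
      using fock_fun_cscale[of 0 0] cin_cscale_left[of 0 0 "kvec w"] by (simp add: k fock_fun_def cin_def)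
  qed
  then have "b = 0" by (rule fock_fun_eqI)
  then show ?thesis by (simp add: b cin_def)
qed

text \<open>The quantity to be shown to vanish. It is linear and bounded in x, so it is enough to
  test coherent states in that argument.\<close>

definition toeplitz_defect :: "(ell2 \<Rightarrow> ell2 \<Rightarrow> complex) \<Rightarrow> ell2 \<Rightarrow> ell2 \<Rightarrow> complex" where
  "toeplitz_defect \<beta> x y = (LINT u|gauss. orbit \<beta> x y u) - toeplitz (berezin \<beta>) x y"

lemma integrable_gauss_orbit:
  assumes "bounded_form C \<beta>"
  shows "integrable gauss (orbit \<beta> x y)"
proof (rule Bochner_Integration.integrable_bound)
  show "integrable gauss (\<lambda>u. C * (norm x * norm y))"
    by simp
  show "AE u in gauss. norm (orbit \<beta> x y u) \<le> norm (C * (norm x * norm y))"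
    using norm_orbit_le[OF assms, of x y] order_trans[OF norm_ge_zero] by (auto intro: order_trans[OF _ abs_ge_self])
qed (use orbit_measurable[OF assms] in simp)

lemma norm_toeplitz_defect_le:
  assumes "bounded_form C \<beta>"
  shows "norm (toeplitz_defect \<beta> x y) \<le> 2 * C * (norm x * norm y)"
proof -
  have C: "C \<ge> 0" by (rule bounded_formD(5)[OF assms])
  have "norm (LINT u|gauss. orbit \<beta> x y u) \<le> (LINT u|gauss. norm (orbit \<beta> x y u))"
    by (rule integral_norm_bound)
  also have "\<dots> \<le> (LINT u|gauss. C * (norm x * norm y))"
    by (rule integral_mono) (use norm_orbit_le[OF assms, of x y] integrable_gauss_orbit[OF assms] in auto)
  also have "\<dots> = C * (norm x * norm y)"
    by simp
  finally have 1: "norm (LINT u|gauss. orbit \<beta> x y u) \<le> C * (norm x * norm y)" .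
  have "norm (toeplitz (berezin \<beta>) x y) \<le> (LINT u|gauss. norm (berezin \<beta> u * (fock_fun x u * cnj (fock_fun y u))))"
    unfolding toeplitz_def by (rule integral_norm_bound)
  also have "\<dots> \<le> (LINT u|gauss. C * (norm (fock_fun x u) * norm (fock_fun y u)))"
    using norm_berezin_le[OF assms]
    by (intro integral_mono integrable_norm integrable_toeplitz[OF berezin_measurable[OF assms] norm_berezin_le[OF assms]]
        integrable_mult_right integrable_sqi_mult sqi_fock_fun) (auto simp: norm_mult intro!: mult_right_mono)
  also have "\<dots> \<le> C * (norm x * norm y)"
    using mult_left_mono[OF integral_fock_fun_mult_le[of x y] C] by simp
  finally have "norm (toeplitz (berezin \<beta>) x y) \<le> C * (norm x * norm y)" .
  then show ?thesis
    using 1 norm_triangle_ineq4[of "LINT u|gauss. orbit \<beta> x y u" "toeplitz (berezin \<beta>) x y"]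
    by (simp add: toeplitz_defect_def)
qed

lemma toeplitz_defect_linear:
  assumes "bounded_form C \<beta>"
  shows "toeplitz_defect \<beta> (x + y) z = toeplitz_defect \<beta> x z + toeplitz_defect \<beta> y z"
    and "toeplitz_defect \<beta> (cscale c x) z = c * toeplitz_defect \<beta> x z"
proof -
  note I = integrable_gauss_orbit[OF assms] integrable_toeplitz[OF berezin_measurable[OF assms] norm_berezin_le[OF assms]]
  show "toeplitz_defect \<beta> (x + y) z = toeplitz_defect \<beta> x z + toeplitz_defect \<beta> y z"
  proof -
    have "orbit \<beta> (x + y) z = (\<lambda>u. orbit \<beta> x z u + orbit \<beta> y z u)"
      by (intro ext orbit_add[OF assms])
    then show ?thesis
      unfolding toeplitz_defect_def toeplitz_def
      by (simp add: fock_fun_add distrib_left distrib_right I)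
  qed
  show "toeplitz_defect \<beta> (cscale c x) z = c * toeplitz_defect \<beta> x z"
  proof -
    have "(LINT u|gauss. berezin \<beta> u * (c * fock_fun x u * cnj (fock_fun z u)))
       = (LINT u|gauss. c * (berezin \<beta> u * (fock_fun x u * cnj (fock_fun z u))))"
      by (simp only: mult_ac)
    moreover have "orbit \<beta> (cscale c x) z = (\<lambda>u. c * orbit \<beta> x z u)"
      by (intro ext orbit_cscale[OF assms])
    ultimately show ?thesis
      unfolding toeplitz_defect_def toeplitz_def
      by (simp add: fock_fun_cscale right_diff_distrib)
  qed
qed

lemma toeplitz_defect_eq_0I:
  assumes "bounded_form C \<beta>" "\<And>z. toeplitz_defect \<beta> (kvec z) y = 0"
  shows "toeplitz_defect \<beta> x y = 0"
proof (rule ell2_functional_zero[where f="\<lambda>x. toeplitz_defect \<beta> x y"])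
  show "norm (toeplitz_defect \<beta> x y) \<le> (2 * C * norm y) * norm x" for x
    using norm_toeplitz_defect_le[OF assms(1), of x y] by (simp add: mult_ac)
qed (use assms toeplitz_defect_linear[OF assms(1)] in auto)

lemma cnj_toeplitz_defect_rank_one:
  "cnj (toeplitz_defect (rank_one a b) x y) = toeplitz_defect (rank_one b a) y x"
proof -
  have "cnj (orbit (rank_one a b) x y u) = orbit (rank_one b a) y x u" for u
    by (simp add: orbit_def rank_one_def cnj_cin mult.commute)
  moreover have "cnj (berezin (rank_one a b) u * (fock_fun x u * cnj (fock_fun y u)))
      = berezin (rank_one b a) u * (fock_fun y u * cnj (fock_fun x u))" for u
    by (simp add: berezin_def rank_one_def cnj_cin mult_ac)
  ultimately show ?thesis
    unfolding toeplitz_defect_def toeplitz_def complex_cnj_diff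
    by (simp only: Bochner_Integration.integral_cnj[symmetric])
qed

text \<open>Moving the Weyl operators from x, y to a, b replaces u by -u, which the Gaussian does
  not notice. Together with the previous symmetry this lets each of the four vectors take the place
  of x, where linearity and totality apply.\<close>

lemma cnj_toeplitz_defect_rank_one':
  "cnj (toeplitz_defect (rank_one a b) x y) = toeplitz_defect (rank_one x y) a b"
proof -
  have 1: "cnj (orbit (rank_one a b) x y u) = orbit (rank_one x y) a b (-1 * u)" for u
  proof -
    have "cin a (weyl_op (- u) x) = cin (weyl_op u a) x" "cin (weyl_op (- u) y) b = cin y (weyl_op u b)"
      by (simp_all add: cin_weyl_op_left)
    then show ?thesis
      by (simp add: orbit_def rank_one_def cnj_cin)
  qed
  have 2: "cnj (berezin (rank_one a b) u * (fock_fun x u * cnj (fock_fun y u)))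
      = berezin (rank_one x y) u * (fock_fun a u * cnj (fock_fun b u))" for u
    by (simp add: berezin_def rank_one_def fock_fun_def cnj_cin mult_ac)
  have "(LINT u|gauss. orbit (rank_one x y) a b (-1 * u)) = (LINT u|gauss. orbit (rank_one x y) a b u)"
    by (rule integral_gauss_rotate[OF orbit_measurable[OF bounded_form_rank_one]]) simp
  then show ?thesis
    unfolding toeplitz_defect_def toeplitz_def complex_cnj_diff
    by (simp only: Bochner_Integration.integral_cnj[symmetric] 1 2)
qed

text \<open>Both sides are Gaussian integrals, and they agree by the identity s z' + w t' + (z' -
  t')(w - s)/2 = (z' + t')(w + s)/2, where z' and t' stand for the conjugates of z and t.\<close>

lemma toeplitz_defect_rank_one_kvec:
  "toeplitz_defect (rank_one (kvec s) (kvec t)) (kvec z) (kvec w) = 0"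
proof -
  have 1: "orbit (rank_one (kvec s) (kvec t)) (kvec z) (kvec w) u
     = exp (s * cnj z + w * cnj t) * (exp (- 1 * (norm u)\<^sup>2) *\<^sub>R (exp (u * (cnj z - cnj t)) * exp (cnj u * (w - s))))" for u
  proof -
    have e: "cnj (exp (u * cnj w - of_real ((norm u)\<^sup>2 / 2))) = exp (cnj u * w - of_real ((norm u)\<^sup>2 / 2))"
      by (simp add: exp_cnj)
    have "orbit (rank_one (kvec s) (kvec t)) (kvec z) (kvec w) u
     = exp (u * cnj z - of_real ((norm u)\<^sup>2 / 2)) * exp (s * cnj (z - u))
       * (exp (cnj u * w - of_real ((norm u)\<^sup>2 / 2)) * exp ((w - u) * cnj t))"
      unfolding orbit_def rank_one_def weyl_op_uminus_kvec cin_cscale_left cin_cscale_right cin_kvec_kvec e ..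
    also have "\<dots> = exp (s * cnj z + w * cnj t) * (of_real (exp (- 1 * (norm u)\<^sup>2)) * (exp (u * (cnj z - cnj t)) * exp (cnj u * (w - s))))"
      unfolding exp_of_real[symmetric] exp_add[symmetric]
      by (rule arg_cong[where f=exp]) (simp add: algebra_simps)
    finally show ?thesis by (simp only: scaleR_conv_of_real)
  qed
  have 2: "berezin (rank_one (kvec s) (kvec t)) u * (fock_fun (kvec z) u * cnj (fock_fun (kvec w) u))
     = exp (- 1 * (norm u)\<^sup>2) *\<^sub>R (exp (u * (cnj z + cnj t)) * exp (cnj u * (w + s)))" for u
    by (simp add: berezin_def rank_one_def fock_fun_def cin_kvec_kvec cnj_cin distrib_left exp_add scaleR_conv_of_real exp_cnj mult.commute mult.left_commute)
  have g: "(LINT u|gauss. exp (- 1 * (norm u)\<^sup>2) *\<^sub>R (exp (u * a) * exp (cnj u * b))) = exp (a * b / 2) / 2" for a b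
  proof -
    have "(LINT u|gauss. exp (- 1 * (norm u)\<^sup>2) *\<^sub>R (exp (u * a) * exp (cnj u * b)))
      = (LINT u|lborel. (1 / pi) *\<^sub>R (exp (- 2 * (norm u)\<^sup>2) *\<^sub>R (exp (u * a) * exp (cnj u * b))))"
      by (subst integral_gauss_eq, measurable) (simp flip: exp_add)
    also have "\<dots> = (1 / pi) *\<^sub>R ((pi / 2) *\<^sub>R exp (a * b / 2))"
      using gaussian_integral(1)[of 2 a b] by (simp only: integral_scaleR_right) simp
    finally show ?thesis by (simp add: scaleR_conv_of_real)
  qed
  have "(LINT u|gauss. orbit (rank_one (kvec s) (kvec t)) (kvec z) (kvec w) u)
     = exp (s * cnj z + w * cnj t) * (exp ((cnj z - cnj t) * (w - s) / 2) / 2)"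
    unfolding 1 integral_mult_right_zero g ..
  also have "\<dots> = exp ((cnj z + cnj t) * (w + s) / 2) / 2"
    unfolding times_divide_eq_right exp_add[symmetric]
    by (rule arg_cong[where f="\<lambda>e. exp e / 2"]) (simp add: field_simps)
  finally show ?thesis
    unfolding toeplitz_defect_def toeplitz_def 2 g by simp
qed

text \<open>The coherent states are replaced by arbitrary vectors one slot at a time, in the order
  x, y, a, b, each slot being brought into the place of x by the two symmetries.\<close>

lemma toeplitz_defect_rank_one: "toeplitz_defect (rank_one a b) x y = 0"
proof -
  note b = bounded_form_rank_one
  note c1 = cnj_toeplitz_defect_rank_one
  note c2 = cnj_toeplitz_defect_rank_one'
  have 1: "toeplitz_defect (rank_one (kvec s) (kvec t)) x (kvec w) = 0" for s t x w
    by (rule toeplitz_defect_eq_0I[OF b toeplitz_defect_rank_one_kvec])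
  have 2: "toeplitz_defect (rank_one (kvec s) (kvec t)) x y = 0" for s t x y
  proof -
    have "toeplitz_defect (rank_one (kvec t) (kvec s)) (kvec z) x = 0" for z
      using c1[of "kvec s" "kvec t" x "kvec z"] by (simp add: 1)
    then have "toeplitz_defect (rank_one (kvec t) (kvec s)) y x = 0"
      by (rule toeplitz_defect_eq_0I[OF b])
    then show ?thesis using c1[of "kvec t" "kvec s" y x] by simp
  qed
  have 3: "toeplitz_defect (rank_one a (kvec t)) x y = 0" for a t x y
  proof -
    have "toeplitz_defect (rank_one x y) (kvec z) (kvec t) = 0" for z
      using c2[of "kvec z" "kvec t" x y] by (simp add: 2)
    then have "toeplitz_defect (rank_one x y) a (kvec t) = 0"
      by (rule toeplitz_defect_eq_0I[OF b])
    then show ?thesis using c2[of x y a "kvec t"] by simp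
  qed
  have "toeplitz_defect (rank_one y x) (kvec z) a = 0" for z
    using c1[of x y a "kvec z"] c2[of a "kvec z" x y] by (simp add: 3)
  then have "toeplitz_defect (rank_one y x) b a = 0"
    by (rule toeplitz_defect_eq_0I[OF b])
  then show ?thesis using c1[of y x b a] c2[of x y a b] by simp
qed

text \<open>Truncating both arguments makes the form a finite combination of rank one forms. The
  truncated forms converge only pointwise, but under the common bound C, so dominated convergence
  applies to both sides.\<close>

lemma gauss_average_eq_toeplitz:
  assumes b: "bounded_form C \<beta>"
  shows "(LINT u|gauss. orbit \<beta> x y u) = toeplitz (berezin \<beta>) x y"
proof -
  note D = bounded_formD[OF b]
  define e where "e = (\<lambda>m n. \<beta> (unit_vec m) (unit_vec n))"
  define \<gamma> where "\<gamma> = (\<lambda>N x y. \<beta> (trunc N x) (trunc N y))"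
  have \<gamma>: "bounded_form C (\<gamma> N)" for N
  proof -
    have "norm (\<gamma> N x y) \<le> C * (norm x * norm y)" for x y
      using D(6)[of "trunc N x" "trunc N y"] mult_left_mono[OF mult_mono[OF norm_trunc_le norm_trunc_le norm_ge_zero norm_ge_zero] D(5)]
      unfolding \<gamma>_def by (rule order_trans)
    then show ?thesis
      using D(1-5) by (simp add: bounded_form_def \<gamma>_def trunc_add trunc_cscale)
  qed
  have bil: "bounded_bilinear \<beta>" by (rule bounded_form_bilinear[OF b])
  have \<gamma>_sum: "\<gamma> N x y = (\<Sum>m<N. \<Sum>n<N. e m n * rank_one (unit_vec m) (unit_vec n) x y)" for N x y
  proof -
    have "\<gamma> N x y = (\<Sum>m<N. \<Sum>n<N. coef x m * (cnj (coef y n) * e m n))"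
      unfolding \<gamma>_def trunc_def bounded_bilinear.sum_left[OF bil]
      unfolding bounded_bilinear.sum_right[OF bil] by (simp add: D e_def mult.left_commute)
    then show ?thesis
      by (simp add: rank_one_def cin_unit_vec cnj_cin[of _ "unit_vec _", symmetric] mult_ac)
  qed
  have eq: "(LINT u|gauss. orbit (\<gamma> N) x y u) = toeplitz (berezin (\<gamma> N)) x y" for N
  proof -
    note r = bounded_form_rank_one
    have "(LINT u|gauss. orbit (\<gamma> N) x y u) = (\<Sum>m<N. \<Sum>n<N. e m n * (LINT u|gauss. orbit (rank_one (unit_vec m) (unit_vec n)) x y u))"
      unfolding orbit_def \<gamma>_sum
      using integrable_gauss_orbit[OF r] by (simp add: orbit_def[abs_def])
    also have "\<dots> = (\<Sum>m<N. \<Sum>n<N. e m n * toeplitz (berezin (rank_one (unit_vec m) (unit_vec n))) x y)"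
      using toeplitz_defect_rank_one by (simp add: toeplitz_defect_def)
    also have "\<dots> = toeplitz (berezin (\<gamma> N)) x y"
    proof -
      have "berezin (\<gamma> N) u * (fock_fun x u * cnj (fock_fun y u)) = (\<Sum>m<N. \<Sum>n<N. e m n *
          (berezin (rank_one (unit_vec m) (unit_vec n)) u * (fock_fun x u * cnj (fock_fun y u))))" for u
        unfolding berezin_def \<gamma>_sum by (simp add: sum_distrib_left sum_distrib_right mult_ac)
      then show ?thesis
        unfolding toeplitz_def
        using integrable_toeplitz[OF berezin_measurable[OF r] norm_berezin_le[OF r], where x=x and y=y] by simp
    qed
    finally show ?thesis .
  qed
  have lim: "(\<lambda>N. \<gamma> N x y) \<longlonglongrightarrow> \<beta> x y" for x y
    unfolding \<gamma>_def by (rule bounded_bilinear.tendsto[OF bil trunc_tendsto trunc_tendsto])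
  have "(\<lambda>N. LINT u|gauss. orbit (\<gamma> N) x y u) \<longlonglongrightarrow> (LINT u|gauss. orbit \<beta> x y u)"
  proof (rule integral_dominated_convergence[where w="\<lambda>u. C * (norm x * norm y)"])
    show "integrable gauss (\<lambda>u. C * (norm x * norm y))"
      by simp
    show "AE u in gauss. (\<lambda>N. orbit (\<gamma> N) x y u) \<longlonglongrightarrow> orbit \<beta> x y u"
      unfolding orbit_def by (intro AE_I2 lim)
    show "AE u in gauss. norm (orbit (\<gamma> N) x y u) \<le> C * (norm x * norm y)" for N
      using norm_orbit_le[OF \<gamma>] by simp
  qed (use orbit_measurable[OF b] orbit_measurable[OF \<gamma>] in simp_all)
  moreover have "(\<lambda>N. toeplitz (berezin (\<gamma> N)) x y) \<longlonglongrightarrow> toeplitz (berezin \<beta>) x y"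
    unfolding toeplitz_def
  proof (rule integral_dominated_convergence[where w="\<lambda>u. C * (norm (fock_fun x u) * norm (fock_fun y u))"])
    show "integrable gauss (\<lambda>u. C * (norm (fock_fun x u) * norm (fock_fun y u)))"
      by (intro integrable_mult_right integrable_sqi_mult sqi_fock_fun)
    show "AE u in gauss. (\<lambda>N. berezin (\<gamma> N) u * (fock_fun x u * cnj (fock_fun y u)))
        \<longlonglongrightarrow> berezin \<beta> u * (fock_fun x u * cnj (fock_fun y u))"
      unfolding berezin_def by (intro AE_I2 tendsto_intros lim)
    show "AE u in gauss. norm (berezin (\<gamma> N) u * (fock_fun x u * cnj (fock_fun y u)))
        \<le> C * (norm (fock_fun x u) * norm (fock_fun y u))" for N
      using norm_berezin_le[OF \<gamma>] by (auto simp: norm_mult intro!: mult_right_mono)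
    note [measurable] = berezin_measurable[OF b] berezin_measurable[OF \<gamma>]
    show "(\<lambda>u. berezin \<beta> u * (fock_fun x u * cnj (fock_fun y u))) \<in> borel_measurable gauss"
      "(\<lambda>u. berezin (\<gamma> N) u * (fock_fun x u * cnj (fock_fun y u))) \<in> borel_measurable gauss" for N
      by measurable
  qed
  ultimately show ?thesis
    unfolding eq by (rule LIMSEQ_unique)
qed

section \<open>From one Gaussian to all Gaussians\<close>

text \<open>Up to sign, the n-th derivative in c of exp(-c|u|^2); these weights are the coefficient
  functions of the expansion in the exponent.\<close>

definition rad :: "nat \<Rightarrow> real \<Rightarrow> complex \<Rightarrow> real" where
  "rad n c u = (norm u) ^ (2 * n) * exp (- c * (norm u)\<^sup>2)"

lemma rad_measurable [measurable]: "rad n c \<in> borel_measurable borel"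
  unfolding rad_def[abs_def] by measurable

lemma rad_nonneg [simp]: "rad n c u \<ge> 0"
  by (simp add: rad_def)

lemma has_bochner_integral_rad:
  assumes "c > 0"
  shows "has_bochner_integral lborel (rad n c) (pi * fact n / c ^ Suc n)"
  by (rule has_bochner_integral_nn_integral)
     (use assms nn_integral_radial_moment[OF assms, of n] in \<open>auto simp: rad_def[abs_def]\<close>)

lemma integrable_rad: "c > 0 \<Longrightarrow> integrable lborel (rad n c)"
  and integral_rad: "c > 0 \<Longrightarrow> (LINT u|lborel. rad n c u) = pi * fact n / c ^ Suc n"
  using has_bochner_integral_rad has_bochner_integral_iff by blast+

lemma compact_conv_rad_1:
  assumes "bounded_form C \<beta>" "(berezin \<beta> \<longlongrightarrow> 0) at_infinity"
  shows "compact_form (conv (rad 0 1) \<beta>)"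
proof -
  have "conv (rad 0 1) \<beta> x y = of_real pi * toeplitz (berezin \<beta>) x y" for x y
  proof -
    have "of_real (rad 0 1 u) * orbit \<beta> x y u = of_real pi * ((exp (- (norm u)\<^sup>2) / pi) *\<^sub>R orbit \<beta> x y u)" for u
      by (simp add: rad_def scaleR_conv_of_real)
    then have "conv (rad 0 1) \<beta> x y = of_real pi * (LINT u|lborel. (exp (- (norm u)\<^sup>2) / pi) *\<^sub>R orbit \<beta> x y u)"
      unfolding conv_def by (simp only: integral_mult_right_zero)
    also have "(LINT u|lborel. (exp (- (norm u)\<^sup>2) / pi) *\<^sub>R orbit \<beta> x y u) = toeplitz (berezin \<beta>) x y"
      unfolding gauss_average_eq_toeplitz[OF assms(1), symmetric]
      by (rule integral_gauss_eq[OF orbit_measurable[OF assms(1)], symmetric])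
    finally show ?thesis .
  qed
  then have "conv (rad 0 1) \<beta> = (\<lambda>x y. of_real pi * toeplitz (berezin \<beta>) x y)" by blast
  then show ?thesis
    using compact_form_cmult[OF compact_toeplitz[OF berezin_measurable[OF assms(1)] norm_berezin_le[OF assms(1)] assms(2)]]
    by simp
qed

lemma berezin_conv:
  assumes "bounded_form C \<beta>"
  shows "berezin (conv \<gamma> \<beta>) u = (LINT v|lborel. of_real (\<gamma> v) * berezin \<beta> (u - v))"
proof -
  have "berezin (conv \<gamma> \<beta>) u = (LINT v|lborel. of_real (exp (- (norm u)\<^sup>2)) * (of_real (\<gamma> v) * orbit \<beta> (kvec u) (kvec u) v))"
    unfolding berezin_def conv_def by (rule integral_mult_right_zero[symmetric])
  also have "\<dots> = (LINT v|lborel. of_real (\<gamma> v) * berezin \<beta> (u - v))"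
    by (intro Bochner_Integration.integral_cong refl) (simp add: mult.left_commute flip: berezin_orbit[OF assms])
  finally show ?thesis .
qed

text \<open>The Berezin transform of the average is the ordinary convolution of \<gamma> with the
  given one. Arguing by contradiction along a sequence tending to infinity makes dominated
  convergence available.\<close>

lemma berezin_conv_vanishes:
  assumes b: "bounded_form C \<beta>" and lim: "(berezin \<beta> \<longlongrightarrow> 0) at_infinity" and \<gamma>: "integrable lborel \<gamma>"
  shows "(berezin (conv \<gamma> \<beta>) \<longlongrightarrow> 0) at_infinity"
proof (rule ccontr)
  note [measurable] = berezin_measurable[OF b]
  have [measurable]: "\<gamma> \<in> borel_measurable borel" using borel_measurable_integrable[OF \<gamma>] by simp
  assume "\<not> (berezin (conv \<gamma> \<beta>) \<longlongrightarrow> 0) at_infinity"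
  then obtain e where e: "e > 0" "\<And>R. \<exists>u. norm u \<ge> R \<and> norm (berezin (conv \<gamma> \<beta>) u) \<ge> e"
    unfolding Lim_at_infinity by (auto simp: not_less)
  then have "\<forall>n. \<exists>u. norm u \<ge> real n \<and> norm (berezin (conv \<gamma> \<beta>) u) \<ge> e" by blast
  then obtain U where U: "\<And>n. norm (U n) \<ge> real n" "\<And>n. norm (berezin (conv \<gamma> \<beta>) (U n)) \<ge> e"
    by metis
  have "(\<lambda>n. LINT v|lborel. of_real (\<gamma> v) * berezin \<beta> (U n - v)) \<longlonglongrightarrow> (LINT v|(lborel :: complex measure). (0::complex))"
  proof (rule integral_dominated_convergence[where w="\<lambda>v. \<bar>\<gamma> v\<bar> * C"])
    show "AE v in lborel. (\<lambda>n. of_real (\<gamma> v) * berezin \<beta> (U n - v)) \<longlonglongrightarrow> 0"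
    proof (rule AE_I2)
      fix v
      have "filterlim (\<lambda>n. U n - v) at_infinity sequentially"
        unfolding filterlim_at_infinity[OF order_refl]
      proof (intro allI impI)
        fix r :: real
        obtain N :: nat where N: "r + norm v \<le> real N" using real_arch_simple by blast
        show "\<forall>\<^sub>F n in sequentially. r \<le> norm (U n - v)"
          using eventually_ge_at_top[of N]
        proof eventually_elim
          case (elim n)
          then show ?case
            using N U(1)[of n] norm_triangle_ineq2[of "U n" v] by simp
        qed
      qed
      from filterlim_compose[OF lim this] have "(\<lambda>n. berezin \<beta> (U n - v)) \<longlonglongrightarrow> 0" .
      then show "(\<lambda>n. of_real (\<gamma> v) * berezin \<beta> (U n - v)) \<longlonglongrightarrow> 0"
        by (rule tendsto_mult_right_zero)
    qed
    show "AE v in lborel. norm (of_real (\<gamma> v) * berezin \<beta> (U n - v)) \<le> \<bar>\<gamma> v\<bar> * C" for n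
      using norm_berezin_le[OF b] by (auto simp: norm_mult intro!: mult_left_mono)
    have "(\<lambda>v. berezin \<beta> (U n - v)) \<in> borel_measurable borel" for n
      using measurable_compose[of "\<lambda>v. U n - v" borel borel "berezin \<beta>" borel] by simp
    then show "(\<lambda>v. of_real (\<gamma> v) * berezin \<beta> (U n - v)) \<in> borel_measurable lborel" for n
      by simp
  qed (use \<gamma> in auto)
  then have "(\<lambda>n. berezin (conv \<gamma> \<beta>) (U n)) \<longlonglongrightarrow> 0"
    by (simp add: berezin_conv[OF b])
  then have "\<forall>\<^sub>F n in sequentially. norm (berezin (conv \<gamma> \<beta>) (U n)) < e"
    using e(1) by (simp add: tendsto_iff)
  then show False
    using U(2) by (auto simp: eventually_sequentially not_less[symmetric])
qed

lemma orbit_orbit: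
  assumes "bounded_form C \<beta>"
  shows "orbit \<beta> (weyl_op (- u) x) (weyl_op (- u) y) v = orbit \<beta> x y (u + v)"
proof -
  have "cis a * cnj (cis a) = 1" "cnj (cis a) * cis a = 1" for a by (simp_all add: cis_cnj cis_mult)
  then have "cis a * (cnj (cis a) * b) = b" "cnj (cis a) * (cis a * b) = b" for a b
    by (simp_all only: mult.assoc[symmetric] mult_1_left)
  then show ?thesis
    by (simp add: orbit_def weyl_op_weyl_op bounded_formD[OF assms] add.commute)
qed

text \<open>Completing the square: the widths of two Gaussians add, so the reciprocals of the
  exponents 1 and \<kappa> sum to the reciprocal of \<kappa>/(1+\<kappa>).\<close>

lemma rad_convolution:
  assumes "\<kappa> > 0"
  shows "(LINT u|lborel. rad 0 1 u * rad 0 \<kappa> (v - u)) = pi / (1 + \<kappa>) * rad 0 (\<kappa> / (1 + \<kappa>)) v"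
    and "integrable lborel (\<lambda>u. rad 0 1 u * rad 0 \<kappa> (v - u))"
proof -
  have "complex_of_real (rad 0 1 u * rad 0 \<kappa> (v - u)) = of_real (exp (- \<kappa> * (norm v)\<^sup>2)) *
     (exp (- (1 + \<kappa>) * (norm u)\<^sup>2) *\<^sub>R (exp (u * (of_real \<kappa> * cnj v)) * exp (cnj u * (of_real \<kappa> * v))))" for u
  proof -
    have "u * (of_real \<kappa> * cnj v) + cnj u * (of_real \<kappa> * v) = of_real (\<kappa> * (2 * Re (v * cnj u)))"
      by (simp add: complex_eq_iff algebra_simps)
    then have 1: "exp (u * (of_real \<kappa> * cnj v)) * exp (cnj u * (of_real \<kappa> * v)) = of_real (exp (\<kappa> * (2 * Re (v * cnj u))))"
      by (simp only: exp_add[symmetric] exp_of_real)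
    have "rad 0 1 u * rad 0 \<kappa> (v - u) = exp (- \<kappa> * (norm v)\<^sup>2) * (exp (- (1 + \<kappa>) * (norm u)\<^sup>2) * exp (\<kappa> * (2 * Re (v * cnj u))))"
      unfolding rad_def norm_diff_power2[of v u]
      by (simp add: algebra_simps flip: exp_add)
    then show ?thesis
      unfolding 1 by (simp only: scaleR_conv_of_real of_real_mult)
  qed
  note e = this
  note G = gaussian_integral[of "1 + \<kappa>" "of_real \<kappa> * cnj v" "of_real \<kappa> * v"]
  have "integrable lborel (\<lambda>u. complex_of_real (rad 0 1 u * rad 0 \<kappa> (v - u)))"
    unfolding e using assms by (intro integrable_mult_right G(2)) simp
  then show "integrable lborel (\<lambda>u. rad 0 1 u * rad 0 \<kappa> (v - u))"
    by (simp only: complex_of_real_integrable_eq)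
  have "complex_of_real (LINT u|lborel. rad 0 1 u * rad 0 \<kappa> (v - u)) = (LINT u|lborel. complex_of_real (rad 0 1 u * rad 0 \<kappa> (v - u)))"
    by (rule integral_complex_of_real[symmetric])
  also have "\<dots> = of_real (exp (- \<kappa> * (norm v)\<^sup>2)) * ((pi / (1 + \<kappa>)) *\<^sub>R exp ((of_real \<kappa> * cnj v) * (of_real \<kappa> * v) / (1 + \<kappa>)))"
    unfolding e integral_mult_right_zero using assms by (subst G(1)) auto
  also have "(of_real \<kappa> * cnj v) * (of_real \<kappa> * v) / (1 + \<kappa>) = complex_of_real (\<kappa>\<^sup>2 * (norm v)\<^sup>2 / (1 + \<kappa>))"
  proof -
    have "(of_real \<kappa> * cnj v) * (of_real \<kappa> * v) / (1 + \<kappa>) = of_real (\<kappa>\<^sup>2) * (v * cnj v) / of_real (1 + \<kappa>)"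
      by (simp add: power2_eq_square)
    then show ?thesis
      unfolding complex_norm_square[symmetric] by (simp only: of_real_mult of_real_divide)
  qed
  also have "of_real (exp (- \<kappa> * (norm v)\<^sup>2)) * ((pi / (1 + \<kappa>)) *\<^sub>R exp (complex_of_real (\<kappa>\<^sup>2 * (norm v)\<^sup>2 / (1 + \<kappa>))))
     = complex_of_real (pi / (1 + \<kappa>) * (exp (- \<kappa> * (norm v)\<^sup>2) * exp (\<kappa>\<^sup>2 * (norm v)\<^sup>2 / (1 + \<kappa>))))"
    by (simp only: exp_of_real scaleR_conv_of_real of_real_mult mult_ac)
  also have "exp (- \<kappa> * (norm v)\<^sup>2) * exp (\<kappa>\<^sup>2 * (norm v)\<^sup>2 / (1 + \<kappa>)) = rad 0 (\<kappa> / (1 + \<kappa>)) v"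
  proof -
    have "- \<kappa> * (norm v)\<^sup>2 + \<kappa>\<^sup>2 * (norm v)\<^sup>2 / (1 + \<kappa>) = - (\<kappa> / (1 + \<kappa>)) * (norm v)\<^sup>2"
      using assms by (simp add: field_simps power2_eq_square)
    then show ?thesis
      unfolding rad_def exp_add[symmetric] by simp
  qed
  finally show "(LINT u|lborel. rad 0 1 u * rad 0 \<kappa> (v - u)) = pi / (1 + \<kappa>) * rad 0 (\<kappa> / (1 + \<kappa>)) v"
    by (simp only: of_real_eq_iff)
qed

text \<open>By \<open>orbit_orbit\<close> the two translations combine into one by u + v. After a
  shift of variable Fubini's theorem leaves a single average against the convolution of the
  weights.\<close>

lemma conv_conv_rad:
  assumes b: "bounded_form C \<beta>" and k: "\<kappa> > 0"
  shows "conv (rad 0 1) (conv (rad 0 \<kappa>) \<beta>) x y = of_real (pi / (1 + \<kappa>)) * conv (rad 0 (\<kappa> / (1 + \<kappa>))) \<beta> x y"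
proof -
  define F where "F = (\<lambda>u v. of_real (rad 0 1 u * rad 0 \<kappa> (v - u)) * orbit \<beta> x y v)"
  note [measurable] = orbit_measurable[OF b]
  have C: "C \<ge> 0" by (rule bounded_formD(5)[OF b])
  have [measurable]: "(\<lambda>p. rad 0 \<kappa> (snd p - fst p)) \<in> borel_measurable (borel \<Otimes>\<^sub>M borel)"
    unfolding rad_def by measurable
  have Fm [measurable]: "(\<lambda>p. F (fst p) (snd p)) \<in> borel_measurable (lborel \<Otimes>\<^sub>M lborel)"
    unfolding F_def by measurable
  have rad_shift: "(LINT v|lborel. rad 0 \<kappa> (v - u)) = (LINT v|lborel. rad 0 \<kappa> v)"
      "integrable lborel (\<lambda>v. rad 0 \<kappa> (v - u))" for u
  proof -
    have "(LINT v|distr lborel borel ((+) (- u)). rad 0 \<kappa> v) = (LINT v|lborel. rad 0 \<kappa> (v - u))"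
      by (subst integral_distr) auto
    then show "(LINT v|lborel. rad 0 \<kappa> (v - u)) = (LINT v|lborel. rad 0 \<kappa> v)"
      by (simp add: lborel_distr_plus)
    have "integrable (distr lborel borel ((+) (- u))) (rad 0 \<kappa>)"
      unfolding lborel_distr_plus by (rule integrable_rad[OF k])
    then show "integrable lborel (\<lambda>v. rad 0 \<kappa> (v - u))"
      by (subst (asm) integrable_distr_eq) auto
  qed
  have Fle: "norm (F u v) \<le> (C * (norm x * norm y) * rad 0 1 u) * rad 0 \<kappa> (v - u)" for u v
    using mult_left_mono[OF norm_orbit_le[OF b, of x y v], of "rad 0 1 u * rad 0 \<kappa> (v - u)"]
    by (simp add: F_def norm_mult mult_ac)
  have Fu: "integrable lborel (F u)" for u
  proof (rule Bochner_Integration.integrable_bound)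
    show "integrable lborel (\<lambda>v. (C * (norm x * norm y) * rad 0 1 u) * rad 0 \<kappa> (v - u))"
      by (intro integrable_mult_right rad_shift)
    show "F u \<in> borel_measurable lborel"
      using measurable_compose[of "\<lambda>v. v - u" borel borel "rad 0 \<kappa>" borel] by (simp add: F_def)
    show "AE v in lborel. norm (F u v) \<le> norm ((C * (norm x * norm y) * rad 0 1 u) * rad 0 \<kappa> (v - u))"
      by (intro AE_I2 order_trans[OF Fle]) (simp only: real_norm_def abs_ge_self)
  qed
  have Fint: "integrable (lborel \<Otimes>\<^sub>M lborel) (\<lambda>(u, v). F u v)"
    unfolding case_prod_beta'
  proof (rule lborel_pair.Fubini_integrable[OF Fm])
    show "AE u in lborel. integrable lborel (\<lambda>v. F (fst (u, v)) (snd (u, v)))"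
      using Fu by simp
    show "integrable lborel (\<lambda>u. LINT v|lborel. norm (F (fst (u, v)) (snd (u, v))))"
    proof (rule Bochner_Integration.integrable_bound)
      show "integrable lborel (\<lambda>u. (C * (norm x * norm y) * (LINT v|lborel. rad 0 \<kappa> v)) * rad 0 1 u)"
        by (intro integrable_mult_right integrable_rad) simp
      show "(\<lambda>u. LINT v|lborel. norm (F (fst (u, v)) (snd (u, v)))) \<in> borel_measurable lborel"
        by measurable
      have "norm (LINT v|lborel. norm (F u v)) \<le> (C * (norm x * norm y) * (LINT v|lborel. rad 0 \<kappa> v)) * rad 0 1 u" for u
      proof -
        have "norm (LINT v|lborel. norm (F u v)) = (LINT v|lborel. norm (F u v))" by simp
        also have "\<dots> \<le> (LINT v|lborel. (C * (norm x * norm y) * rad 0 1 u) * rad 0 \<kappa> (v - u))"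
          by (intro integral_mono integrable_norm Fu integrable_mult_right rad_shift Fle)
        also have "\<dots> = (C * (norm x * norm y) * rad 0 1 u) * (LINT v|lborel. rad 0 \<kappa> v)"
          unfolding integral_mult_right_zero rad_shift ..
        finally show ?thesis by (simp only: mult_ac)
      qed
      then show "AE u in lborel. norm (LINT v|lborel. norm (F (fst (u, v)) (snd (u, v))))
         \<le> norm ((C * (norm x * norm y) * (LINT v|lborel. rad 0 \<kappa> v)) * rad 0 1 u)"
        unfolding fst_conv snd_conv real_norm_def[of "_ * rad 0 1 _"]
        by (intro AE_I2) (rule order_trans[OF _ abs_ge_self], blast)
    qed
  qed
  have "conv (rad 0 1) (conv (rad 0 \<kappa>) \<beta>) x y = (LINT u|lborel. LINT v|lborel. F u v)"
    unfolding conv_def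
  proof (rule Bochner_Integration.integral_cong[OF refl])
    fix u
    have "orbit (\<lambda>x y. LINT v|lborel. of_real (rad 0 \<kappa> v) * orbit \<beta> x y v) x y u
      = (LINT v|lborel. of_real (rad 0 \<kappa> v) * orbit \<beta> x y (u + v))"
      by (subst orbit_def) (simp add: orbit_orbit[OF b])
    also have "\<dots> = (LINT v|distr lborel borel ((+) u). of_real (rad 0 \<kappa> (v - u)) * orbit \<beta> x y v)"
      using measurable_compose[of "\<lambda>v. v - u" borel borel "rad 0 \<kappa>" borel] by (subst integral_distr) auto
    finally show "of_real (rad 0 1 u) * orbit (\<lambda>x y. LINT v|lborel. of_real (rad 0 \<kappa> v) * orbit \<beta> x y v) x y u
       = (LINT v|lborel. F u v)"
      unfolding lborel_distr_plus F_def by (simp add: mult.assoc)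
  qed
  also have "\<dots> = (LINT v|lborel. LINT u|lborel. F u v)"
    by (rule lborel_pair.Fubini_integral[OF Fint, symmetric])
  also have "\<dots> = (LINT v|lborel. of_real (pi / (1 + \<kappa>)) * (of_real (rad 0 (\<kappa> / (1 + \<kappa>)) v) * orbit \<beta> x y v))"
  proof (rule Bochner_Integration.integral_cong[OF refl])
    fix v
    have "(LINT u|lborel. F u v) = of_real (LINT u|lborel. rad 0 1 u * rad 0 \<kappa> (v - u)) * orbit \<beta> x y v"
      unfolding F_def integral_mult_left_zero integral_complex_of_real ..
    then show "(LINT u|lborel. F u v) = of_real (pi / (1 + \<kappa>)) * (of_real (rad 0 (\<kappa> / (1 + \<kappa>)) v) * orbit \<beta> x y v)"
      unfolding rad_convolution(1)[OF k] by (simp only: of_real_mult mult.assoc)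
  qed
  also have "\<dots> = of_real (pi / (1 + \<kappa>)) * conv (rad 0 (\<kappa> / (1 + \<kappa>))) \<beta> x y"
    unfolding conv_def by (rule integral_mult_right_zero)
  finally show ?thesis .
qed

lemma compact_conv_rad_less_1:
  assumes b: "bounded_form C \<beta>" and lim: "(berezin \<beta> \<longlongrightarrow> 0) at_infinity" and c: "0 < c" "c < 1"
  shows "compact_form (conv (rad 0 c) \<beta>)"
proof -
  \<comment> \<open>The solution of \<kappa>/(1+\<kappa>) = c, positive exactly because 0 < c <
    1.\<close>
  define \<kappa> where "\<kappa> = c / (1 - c)"
  have k: "\<kappa> > 0" "\<kappa> / (1 + \<kappa>) = c" using c by (auto simp: \<kappa>_def field_simps)
  have "compact_form (conv (rad 0 1) (conv (rad 0 \<kappa>) \<beta>))"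
    by (rule compact_conv_rad_1[OF bounded_form_conv[OF integrable_rad[OF k(1)] b]
          berezin_conv_vanishes[OF b lim integrable_rad[OF k(1)]]])
  then have "compact_form (\<lambda>x y. of_real ((1 + \<kappa>) / pi) * conv (rad 0 1) (conv (rad 0 \<kappa>) \<beta>) x y)"
    by (rule compact_form_cmult)
  moreover have "of_real ((1 + \<kappa>) / pi) * conv (rad 0 1) (conv (rad 0 \<kappa>) \<beta>) x y = conv (rad 0 c) \<beta> x y" for x y
  proof -
    have "complex_of_real ((1 + \<kappa>) / pi) * of_real (pi / (1 + \<kappa>)) = 1"
    proof -
      have "(1 + \<kappa>) / pi * (pi / (1 + \<kappa>)) = 1" using k(1) by simp
      then show ?thesis by (simp only: of_real_mult[symmetric] of_real_1)
    qed
    then show ?thesis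
      unfolding conv_conv_rad[OF b k(1)] k(2) by (simp only: mult.assoc[symmetric] mult_1_left)
  qed
  ultimately show ?thesis by simp
qed

text \<open>Supplies the majorant for differentiating exp(-c|u|^2) in c under the integral: with t =
  |u|^2 the error of the difference quotient costs only a factor exp(h t).\<close>

lemma exp_diff_quotient_bound:
  fixes t h :: real
  assumes "t \<ge> 0" "h > 0"
  shows "\<bar>(exp (h * t) - 1) / h - t\<bar> \<le> 2 * t * exp (h * t)"
proof -
  have 1: "t \<le> (exp (h * t) - 1) / h"
    using exp_ge_add_one_self[of "h * t"] assms by (simp add: field_simps)
  have "1 - h * t \<le> exp (- (h * t))"
    using exp_ge_add_one_self[of "- (h * t)"] by simp
  then have "(1 - h * t) * exp (h * t) \<le> exp (- (h * t)) * exp (h * t)"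
    by (rule mult_right_mono) simp
  then have "exp (h * t) - 1 \<le> h * t * exp (h * t)"
    by (simp add: algebra_simps flip: exp_add)
  then have 2: "(exp (h * t) - 1) / h \<le> t * exp (h * t)"
    using assms by (simp add: field_simps)
  have "t * exp (h * t) \<ge> 0" using assms by simp
  with 1 2 show ?thesis using assms by linarith
qed

text \<open>The difference quotient in the exponent is a combination of two weights with compact
  averages and converges in L^1 to the derivative, which carries one more factor |u|^2.\<close>

lemma compact_conv_rad_Suc:
  assumes b: "bounded_form C \<beta>" and cpt: "\<And>c. 0 < c \<Longrightarrow> c < c1 \<Longrightarrow> compact_form (conv (rad n c) \<beta>)"
    and c: "0 < c" "c < c1"
  shows "compact_form (conv (rad (Suc n) c) \<beta>)"
proof -
  \<comment> \<open>Steps of at most c/2 keep the shifted exponent c - h positive and leave the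
    majorant with exponent c/2.\<close>
  define h where "h = (\<lambda>k. c / 2 * (1 / real (Suc k)))"
  have h: "h k > 0" "h k \<le> c / 2" for k
    using c by (auto simp: h_def field_simps)
  have h0: "h \<longlonglongrightarrow> 0"
    unfolding h_def using tendsto_mult_right_zero[OF LIMSEQ_inverse_real_of_nat, of "c/2"] by (simp add: inverse_eq_divide)
  define \<psi> where "\<psi> = (\<lambda>k u. (1 / h k) * rad n (c - h k) u + (- (1 / h k)) * rad n c u)"
  have ch: "0 < c - h k" "c - h k < c1" for k
    using h[of k] c by auto
  have int: "integrable lborel (\<psi> k)" for k
    unfolding \<psi>_def using ch c by (intro Bochner_Integration.integrable_add integrable_mult_right integrable_rad) auto
  have rw: "\<psi> k u = rad n c u * ((exp (h k * (norm u)\<^sup>2) - 1) / h k)" for k u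
  proof -
    have "exp (- (c - h k) * (norm u)\<^sup>2) = exp (- c * (norm u)\<^sup>2) * exp (h k * (norm u)\<^sup>2)"
      by (simp add: algebra_simps flip: exp_add)
    then show ?thesis
      using h[of k] by (simp add: \<psi>_def rad_def field_simps)
  qed
  have rS: "rad (Suc n) c u = rad n c u * (norm u)\<^sup>2" for u
    by (simp add: rad_def power_add power2_eq_square)
  show ?thesis
  proof (rule compact_conv_limit[OF b integrable_rad[OF c(1)] int])
    show "compact_form (conv (\<psi> k) \<beta>)" for k
      unfolding \<psi>_def using ch c by (intro compact_conv_lincomb[OF b] integrable_rad cpt) auto
    have "(\<lambda>k. LINT u|lborel. \<bar>rad (Suc n) c u - \<psi> k u\<bar>) \<longlonglongrightarrow> (LINT u|(lborel :: complex measure). (0::real))"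
    proof (rule integral_dominated_convergence[where w="\<lambda>u. 2 * rad (Suc n) (c/2) u"])
      show "integrable lborel (\<lambda>u. 2 * rad (Suc n) (c/2) u)"
        using c by (intro integrable_mult_right integrable_rad) auto
      show "AE u in lborel. (\<lambda>k. \<bar>rad (Suc n) c u - \<psi> k u\<bar>) \<longlonglongrightarrow> 0"
      proof (rule AE_I2)
        fix u :: complex
        have "((\<lambda>h. (exp (h * (norm u)\<^sup>2) - 1) / h) \<longlongrightarrow> (norm u)\<^sup>2) (at 0)"
        proof -
          have "((\<lambda>h. exp (h * (norm u)\<^sup>2)) has_real_derivative exp (0 * (norm u)\<^sup>2) * (norm u)\<^sup>2) (at 0)"
            by (auto intro!: derivative_eq_intros)
          then show ?thesis by (simp add: has_field_derivative_iff)
        qed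
        moreover have "filterlim h (at 0) sequentially"
          using h0 h(1) by (auto simp: filterlim_at less_imp_neq[symmetric] intro!: always_eventually)
        ultimately have "(\<lambda>k. (exp (h k * (norm u)\<^sup>2) - 1) / h k) \<longlonglongrightarrow> (norm u)\<^sup>2"
          by (rule filterlim_compose)
        then have "(\<lambda>k. \<bar>rad (Suc n) c u - \<psi> k u\<bar>) \<longlonglongrightarrow> \<bar>rad (Suc n) c u - rad n c u * (norm u)\<^sup>2\<bar>"
          unfolding rw by (intro tendsto_intros)
        then show "(\<lambda>k. \<bar>rad (Suc n) c u - \<psi> k u\<bar>) \<longlonglongrightarrow> 0"
          by (simp add: rS)
      qed
      show "AE u in lborel. norm \<bar>rad (Suc n) c u - \<psi> k u\<bar> \<le> 2 * rad (Suc n) (c/2) u" for k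
      proof (rule AE_I2)
        fix u :: complex
        have "norm \<bar>rad (Suc n) c u - \<psi> k u\<bar> = rad n c u * \<bar>(exp (h k * (norm u)\<^sup>2) - 1) / h k - (norm u)\<^sup>2\<bar>"
        proof -
          have "rad (Suc n) c u - \<psi> k u = - (rad n c u * ((exp (h k * (norm u)\<^sup>2) - 1) / h k - (norm u)\<^sup>2))"
            unfolding rw rS by (simp add: right_diff_distrib)
          then show ?thesis by (simp only: real_norm_def abs_idempotent abs_minus_cancel abs_mult) simp
        qed
        also have "\<dots> \<le> rad n c u * (2 * (norm u)\<^sup>2 * exp (h k * (norm u)\<^sup>2))"
          by (intro mult_left_mono exp_diff_quotient_bound h) auto
        also have "\<dots> \<le> rad n c u * (2 * (norm u)\<^sup>2 * exp (c/2 * (norm u)\<^sup>2))"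
        proof -
          have "h k * (norm u)\<^sup>2 \<le> c/2 * (norm u)\<^sup>2" by (intro mult_right_mono h) simp
          then show ?thesis by (intro mult_left_mono) simp_all
        qed
        also have "\<dots> = 2 * rad (Suc n) (c/2) u"
        proof -
          have "exp (- c * (norm u)\<^sup>2) * exp (c/2 * (norm u)\<^sup>2) = exp (- (c/2) * (norm u)\<^sup>2)"
            by (simp add: algebra_simps flip: exp_add)
          then show ?thesis
            by (simp add: rad_def power_add power2_eq_square mult_ac)
        qed
        finally show "norm \<bar>rad (Suc n) c u - \<psi> k u\<bar> \<le> 2 * rad (Suc n) (c/2) u" .
      qed
      show "(\<lambda>u. \<bar>rad (Suc n) c u - \<psi> k u\<bar>) \<in> borel_measurable lborel" for k
        unfolding \<psi>_def by measurable
    qed simp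
    then show "(\<lambda>k. LINT u|lborel. \<bar>rad (Suc n) c u - \<psi> k u\<bar>) \<longlonglongrightarrow> 0" by simp
  qed
qed

lemma compact_conv_rad_all:
  assumes b: "bounded_form C \<beta>" and cpt: "\<And>c. 0 < c \<Longrightarrow> c < c1 \<Longrightarrow> compact_form (conv (rad 0 c) \<beta>)"
    and c: "0 < c" "c < c1"
  shows "compact_form (conv (rad n c) \<beta>)"
  using c
proof (induction n arbitrary: c)
  case (Suc n)
  show ?case by (rule compact_conv_rad_Suc[OF b Suc.IH Suc.prems])
qed (rule cpt)

text \<open>Expanding \<open>exp (- d |u|\<^sup>2)\<close> into its power series inside \<open>exp (- c |u|\<^sup>2)\<close> converges in
  \<open>L\<^sup>1\<close> as long as \<open>d < c\<close>; this doubles the admissible range of exponents.\<close>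

lemma compact_conv_rad_double:
  assumes b: "bounded_form C \<beta>" and cpt: "\<And>c. 0 < c \<Longrightarrow> c < c1 \<Longrightarrow> compact_form (conv (rad 0 c) \<beta>)"
    and c': "0 < c'" "c' < 2 * c1"
  shows "compact_form (conv (rad 0 c') \<beta>)"
proof -
  \<comment> \<open>The midpoint of c'/2 and c1: being below c1 it is an admissible exponent, and
    being above c'/2 it makes the increment d = c' - c smaller than c in modulus. The increment may
    be negative.\<close>
  define c where "c = (c'/2 + c1) / 2"
  define d where "d = c' - c"
  have c: "0 < c" "c < c1" "\<bar>d\<bar> < c" "c + d = c'"
    using c' by (auto simp: c_def d_def field_simps)
  define \<psi> where "\<psi> = (\<lambda>N u. \<Sum>n<N. (- d) ^ n / fact n * rad n c u)"
  have rw: "rad n c u = rad 0 c u * ((norm u)\<^sup>2) ^ n" for n u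
    by (simp add: rad_def power_mult)
  have \<psi>_rw: "\<psi> N u = rad 0 c u * (\<Sum>n<N. (- d * (norm u)\<^sup>2) ^ n / fact n)" for N u
    unfolding \<psi>_def sum_distrib_left
    by (intro sum.cong refl) (subst rw, simp only: power_mult_distrib times_divide_eq_left times_divide_eq_right mult_ac)
  have int: "integrable lborel (\<psi> N)" for N
    unfolding \<psi>_def by (intro Bochner_Integration.integrable_sum integrable_mult_right integrable_rad c)
  have cp: "compact_form (conv (\<psi> N) \<beta>)" for N
  proof (induction N)
    case 0
    have "conv (\<psi> 0) \<beta> = (\<lambda>x y. 0)" by (simp add: \<psi>_def conv_def fun_eq_iff)
    then show ?case by (auto simp: compact_form_def)
  next
    case (Suc N)
    have "\<psi> (Suc N) = (\<lambda>u. 1 * \<psi> N u + ((- d) ^ N / fact N) * rad N c u)"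
      by (simp add: \<psi>_def)
    then show ?case
      by (simp only:) (rule compact_conv_lincomb[OF b int integrable_rad[OF c(1)] Suc compact_conv_rad_all[OF b cpt c(1,2)]])
  qed
  have split: "rad 0 c' u = rad 0 c u * exp (- d * (norm u)\<^sup>2)" for u
    unfolding rad_def c(4)[symmetric] by (simp add: algebra_simps flip: exp_add)
  show ?thesis
  proof (rule compact_conv_limit[OF b integrable_rad[OF c'(1)] int cp])
    have "(\<lambda>N. LINT u|lborel. \<bar>rad 0 c' u - \<psi> N u\<bar>) \<longlonglongrightarrow> (LINT u|(lborel :: complex measure). (0::real))"
    \<comment> \<open>Every partial sum and the full exponential are at most exp(|d| |u|^2), so each
      difference is dominated by a Gaussian of the positive exponent c - |d|.\<close>
    proof (rule integral_dominated_convergence[where w="\<lambda>u. 2 * rad 0 (c - \<bar>d\<bar>) u"])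
      show "integrable lborel (\<lambda>u. 2 * rad 0 (c - \<bar>d\<bar>) u)"
        using c by (intro integrable_mult_right integrable_rad) auto
      show "AE u in lborel. (\<lambda>N. \<bar>rad 0 c' u - \<psi> N u\<bar>) \<longlonglongrightarrow> 0"
      proof (rule AE_I2)
        fix u :: complex
        have "(\<lambda>N. \<Sum>n<N. (- d * (norm u)\<^sup>2) ^ n / fact n) \<longlonglongrightarrow> exp (- d * (norm u)\<^sup>2)"
          using sums_exp_fact[of "- d * (norm u)\<^sup>2"] unfolding sums_def .
        then have "(\<lambda>N. \<bar>rad 0 c' u - \<psi> N u\<bar>) \<longlonglongrightarrow> \<bar>rad 0 c' u - rad 0 c u * exp (- d * (norm u)\<^sup>2)\<bar>"
          unfolding \<psi>_rw by (intro tendsto_intros)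
        then show "(\<lambda>N. \<bar>rad 0 c' u - \<psi> N u\<bar>) \<longlonglongrightarrow> 0"
          by (simp add: split)
      qed
      show "AE u in lborel. norm \<bar>rad 0 c' u - \<psi> N u\<bar> \<le> 2 * rad 0 (c - \<bar>d\<bar>) u" for N
      proof (rule AE_I2)
        fix u :: complex
        let ?t = "\<bar>d\<bar> * (norm u)\<^sup>2"
        have "\<bar>\<Sum>n<N. (- d * (norm u)\<^sup>2) ^ n / fact n\<bar> \<le> (\<Sum>n<N. ?t ^ n / fact n)"
          by (rule order_trans[OF sum_abs]) (simp add: abs_mult power_abs power_mult_distrib)
        also have "\<dots> \<le> exp ?t"
          using sum_le_suminf[OF sums_summable[OF sums_exp_fact[of ?t]], of "{..<N}"] sums_unique[OF sums_exp_fact[of ?t]] by simp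
        finally have 1: "\<bar>\<Sum>n<N. (- d * (norm u)\<^sup>2) ^ n / fact n\<bar> \<le> exp ?t" .
        have "- d * (norm u)\<^sup>2 \<le> ?t" by (intro mult_right_mono) auto
        then have 2: "exp (- d * (norm u)\<^sup>2) \<le> exp ?t" by simp
        have "norm \<bar>rad 0 c' u - \<psi> N u\<bar> = rad 0 c u * \<bar>exp (- d * (norm u)\<^sup>2) - (\<Sum>n<N. (- d * (norm u)\<^sup>2) ^ n / fact n)\<bar>"
          unfolding split \<psi>_rw right_diff_distrib[symmetric] by (simp only: real_norm_def abs_idempotent abs_mult) simp
        also have "\<dots> \<le> rad 0 c u * (2 * exp ?t)"
        proof -
          have "\<bar>p - q\<bar> \<le> 2 * E" if "p \<le> E" "0 < p" "\<bar>q\<bar> \<le> E" for p q E :: real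
            using that by linarith
          from this[OF 2 exp_gt_zero 1] show ?thesis
            by (rule mult_left_mono) simp
        qed
        also have "\<dots> = 2 * rad 0 (c - \<bar>d\<bar>) u"
          unfolding rad_def by (simp add: algebra_simps flip: exp_add)
        finally show "norm \<bar>rad 0 c' u - \<psi> N u\<bar> \<le> 2 * rad 0 (c - \<bar>d\<bar>) u" .
      qed
      show "(\<lambda>u. \<bar>rad 0 c' u - \<psi> N u\<bar>) \<in> borel_measurable lborel" for N
        unfolding \<psi>_def by measurable
    qed simp
    then show "(\<lambda>N. LINT u|lborel. \<bar>rad 0 c' u - \<psi> N u\<bar>) \<longlonglongrightarrow> 0" by simp
  qed
qed

text \<open>Starting from exponents below 1, n doublings reach all exponents below 2^n.\<close>

lemma compact_conv_rad:
  assumes b: "bounded_form C \<beta>" and lim: "(berezin \<beta> \<longlongrightarrow> 0) at_infinity" and c: "c > 0"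
  shows "compact_form (conv (rad 0 c) \<beta>)"
proof -
  have "\<forall>c. 0 < c \<longrightarrow> c < 2 ^ n \<longrightarrow> compact_form (conv (rad 0 c) \<beta>)" for n
  proof (induction n)
    case 0
    then show ?case using compact_conv_rad_less_1[OF b lim] by simp
  next
    case (Suc n)
    then show ?case using compact_conv_rad_double[OF b, of "2 ^ n"] by simp
  qed
  moreover obtain n :: nat where "c < 2 ^ n" using real_arch_pow[of 2 c] by auto
  ultimately show ?thesis using c by blast
qed

section \<open>The compactness criterion for forms\<close>

text \<open>Norm continuity at u = 0 of the conjugation by Weyl operators, expressed through the
  form.\<close>

definition orbit_continuous :: "(ell2 \<Rightarrow> ell2 \<Rightarrow> complex) \<Rightarrow> bool" where
  "orbit_continuous \<beta> \<longleftrightarrow> (\<forall>e>0. \<exists>d>0. \<forall>u x y. norm u < d \<longrightarrow>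
     norm (orbit \<beta> x y u - \<beta> x y) \<le> e * (norm x * norm y))"

lemma compact_form_if:
  assumes b: "bounded_form C \<beta>" and oc: "orbit_continuous \<beta>" and lim: "(berezin \<beta> \<longlongrightarrow> 0) at_infinity"
  shows "compact_form \<beta>"
proof (rule compact_form_limit)
  fix e :: real assume "e > 0"
  have C: "C \<ge> 0" by (rule bounded_formD(5)[OF b])
  obtain d where d: "d > 0" "\<And>u x y. norm u < d \<Longrightarrow> norm (orbit \<beta> x y u - \<beta> x y) \<le> e/2 * (norm x * norm y)"
    using oc \<open>e > 0\<close> unfolding orbit_continuous_def by (meson half_gt_zero)
  \<comment> \<open>Chosen so that the contribution 2C/(d^2 c) of the weight outside radius d is at
    most e/2; C + 1 in place of C keeps c positive when C = 0.\<close>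
  define c where "c = 4 * (C + 1) / (d\<^sup>2 * e)"
  have c: "c > 0" using C d \<open>e > 0\<close> by (simp add: c_def)
  have K: "2 * C / d\<^sup>2 / c \<le> e/2"
  proof -
    have "2 * C / d\<^sup>2 / c = e/2 * (C / (C + 1))"
      using C d \<open>e > 0\<close> by (simp add: c_def field_simps)
    also have "\<dots> \<le> e/2 * 1"
      using C \<open>e > 0\<close> by (intro mult_left_mono) auto
    finally show ?thesis by simp
  qed
  have cpt: "compact_form (\<lambda>x y. of_real (c / pi) * conv (rad 0 c) \<beta> x y)"
    by (rule compact_form_cmult[OF compact_conv_rad[OF b lim c]])
  have "norm (\<beta> x y - of_real (c / pi) * conv (rad 0 c) \<beta> x y) \<le> e * (norm x * norm y)" for x y
  proof -
    let ?M = "norm x * norm y"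
    note I = integrable_conv[OF integrable_rad[OF c] b, of 0 x y]
    have I1: "integrable lborel (\<lambda>u. of_real (rad 0 c u) * \<beta> x y)"
      using integrable_rad[OF c, of 0] by simp
    have "of_real (c / pi) * (LINT u|lborel. of_real (rad 0 c u) * \<beta> x y) = \<beta> x y"
    proof -
      have "(LINT u|lborel. of_real (rad 0 c u) * \<beta> x y) = of_real (pi / c) * \<beta> x y"
        unfolding integral_mult_left_zero integral_complex_of_real integral_rad[OF c] by simp
      then show ?thesis using c by simp
    qed
    then have "\<beta> x y - of_real (c / pi) * conv (rad 0 c) \<beta> x y
        = of_real (c / pi) * ((LINT u|lborel. of_real (rad 0 c u) * \<beta> x y) - (LINT u|lborel. of_real (rad 0 c u) * orbit \<beta> x y u))"
      by (simp only: conv_def right_diff_distrib)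
    also have "\<dots> = of_real (c / pi) * (LINT u|lborel. of_real (rad 0 c u) * (\<beta> x y - orbit \<beta> x y u))"
    proof -
      have "(LINT u|lborel. of_real (rad 0 c u) * (\<beta> x y - orbit \<beta> x y u))
         = (LINT u|lborel. of_real (rad 0 c u) * \<beta> x y) - (LINT u|lborel. of_real (rad 0 c u) * orbit \<beta> x y u)"
        by (simp only: right_diff_distrib Bochner_Integration.integral_diff[OF I1 I])
      then show ?thesis by (simp only:)
    qed
    finally have "norm (\<beta> x y - of_real (c / pi) * conv (rad 0 c) \<beta> x y)
        = c / pi * norm (LINT u|lborel. of_real (rad 0 c u) * (\<beta> x y - orbit \<beta> x y u))"
      using c by (simp add: norm_mult norm_divide)
    also have "\<dots> \<le> c / pi * (LINT u|lborel. norm (of_real (rad 0 c u) * (\<beta> x y - orbit \<beta> x y u)))"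
      using c by (intro mult_left_mono integral_norm_bound) auto
    also have "\<dots> \<le> c / pi * (LINT u|lborel. (e/2 * ?M) * rad 0 c u + (2 * C / d\<^sup>2 * ?M) * rad 1 c u)"
    proof (intro mult_left_mono integral_mono)
      show "integrable lborel (\<lambda>u. norm (of_real (rad 0 c u) * (\<beta> x y - orbit \<beta> x y u)))"
        unfolding right_diff_distrib by (intro integrable_norm Bochner_Integration.integrable_diff I I1)
      show "integrable lborel (\<lambda>u. (e/2 * ?M) * rad 0 c u + (2 * C / d\<^sup>2 * ?M) * rad 1 c u)"
        by (intro Bochner_Integration.integrable_add integrable_mult_right integrable_rad c)
      fix u :: complex
      \<comment> \<open>Chebyshev's device: outside radius d the trivial bound 2C is multiplied by
        |u|^2/d^2, which is at least 1 there and whose average is a known moment.\<close>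
      have "norm (\<beta> x y - orbit \<beta> x y u) \<le> e/2 * ?M + 2 * C / d\<^sup>2 * ?M * (norm u)\<^sup>2"
      proof (cases "norm u < d")
        case True
        have "2 * C / d\<^sup>2 * ?M * (norm u)\<^sup>2 \<ge> 0" using C by simp
        then show ?thesis using d(2)[OF True, of x y] by (simp add: norm_minus_commute)
      next
        case False
        then have "d\<^sup>2 \<le> (norm u)\<^sup>2" using d by (intro power_mono) auto
        then have "1 \<le> (norm u)\<^sup>2 / d\<^sup>2" using d by simp
        then have "2 * C * ?M * 1 \<le> 2 * C * ?M * ((norm u)\<^sup>2 / d\<^sup>2)"
          using C by (intro mult_left_mono) auto
        moreover have "norm (\<beta> x y - orbit \<beta> x y u) \<le> C * ?M + C * ?M"
          by (intro order_trans[OF norm_triangle_ineq4] add_mono bounded_formD(6)[OF b] norm_orbit_le[OF b])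
        moreover have "e/2 * ?M \<ge> 0" using \<open>e > 0\<close> by simp
        ultimately show ?thesis by simp
      qed
      then have "rad 0 c u * norm (\<beta> x y - orbit \<beta> x y u) \<le> rad 0 c u * (e/2 * ?M + 2 * C / d\<^sup>2 * ?M * (norm u)\<^sup>2)"
        by (rule mult_left_mono) simp
      also have "\<dots> = (e/2 * ?M) * rad 0 c u + (2 * C / d\<^sup>2 * ?M) * rad 1 c u"
        by (simp add: rad_def algebra_simps power2_eq_square)
      finally show "norm (of_real (rad 0 c u) * (\<beta> x y - orbit \<beta> x y u)) \<le> (e/2 * ?M) * rad 0 c u + (2 * C / d\<^sup>2 * ?M) * rad 1 c u"
        by (simp add: norm_mult)
    qed (use c in auto)
    also have "\<dots> = e/2 * ?M + (2 * C / d\<^sup>2 / c) * ?M"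
    proof -
      have "(LINT u|lborel. (e/2 * ?M) * rad 0 c u + (2 * C / d\<^sup>2 * ?M) * rad 1 c u)
          = (e/2 * ?M) * (pi / c) + (2 * C / d\<^sup>2 * ?M) * (pi / c\<^sup>2)"
        unfolding Bochner_Integration.integral_add[OF integrable_mult_right[OF integrable_rad[OF c]]
            integrable_mult_right[OF integrable_rad[OF c]]] integral_mult_right_zero integral_rad[OF c]
        by (simp add: power2_eq_square)
      then show ?thesis using c by (simp add: field_simps power2_eq_square)
    qed
    also have "\<dots> \<le> e/2 * ?M + e/2 * ?M"
      by (intro add_left_mono mult_right_mono K) auto
    finally show ?thesis by simp
  qed
  with cpt show "\<exists>\<gamma>. compact_form \<gamma> \<and> (\<forall>x y. norm (\<beta> x y - \<gamma> x y) \<le> e * (norm x * norm y))"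
    by blast
qed

lemma norm_coef_kvec_vanishes:
  "((\<lambda>u. exp (- (norm u)\<^sup>2 / 2) * norm (coef (kvec u) p)) \<longlongrightarrow> 0) at_infinity"
proof -
  have "((\<lambda>r::real. exp (- r\<^sup>2 / 2) * r ^ p) \<longlongrightarrow> 0) at_top"
    by real_asymp
  then have "((\<lambda>r::real. exp (- r\<^sup>2 / 2) * r ^ p / sqrt (fact p)) \<longlongrightarrow> 0) at_top"
    by (rule tendsto_divide_zero)
  from filterlim_compose[OF this filterlim_norm_at_top]
  have "((\<lambda>u::complex. exp (- (norm u)\<^sup>2 / 2) * norm u ^ p / sqrt (fact p)) \<longlongrightarrow> 0) at_infinity" .
  then show ?thesis
    by (simp add: coef_kvec norm_divide norm_power)
qed

lemma norm_trunc_le_sum: "norm (trunc N x) \<le> (\<Sum>n<N. norm (coef x n))"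
  unfolding trunc_def by (rule order_trans[OF norm_sum]) simp

lemma compact_form_berezin_vanishes:
  assumes b: "bounded_form C \<beta>" and cpt: "compact_form \<beta>"
  shows "(berezin \<beta> \<longlongrightarrow> 0) at_infinity"
  unfolding Lim_at_infinity
proof (intro allI impI)
  fix e :: real assume "e > 0"
  have C: "C \<ge> 0" by (rule bounded_formD(5)[OF b])
  obtain N where N: "\<And>x y. norm (\<beta> (x - trunc N x) y) \<le> e/2 * (norm x * norm y)"
    using cpt \<open>e > 0\<close> unfolding compact_form_def by (meson half_gt_zero order_refl)
  \<comment> \<open>Bounds the norm of the truncated normalized coherent state; it is a finite sum
    of coordinates, each of which vanishes at infinity.\<close>
  define g where "g = (\<lambda>u. \<Sum>n<N. exp (- (norm u)\<^sup>2 / 2) * norm (coef (kvec u) n))"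
  have "((\<lambda>u. C * g u) \<longlongrightarrow> C * (\<Sum>n<N. 0)) at_infinity"
    unfolding g_def by (intro tendsto_intros norm_coef_kvec_vanishes)
  then have "\<forall>\<^sub>F u in at_infinity. C * g u < e/2"
    by (rule order_tendstoD(2)) (use \<open>e > 0\<close> in simp)
  then obtain R where R: "\<And>u. norm u \<ge> R \<Longrightarrow> C * g u < e/2"
    unfolding eventually_at_infinity by blast
  have "dist (berezin \<beta> u) 0 < e" if "norm u \<ge> R" for u
  proof -
    let ?E = "exp (- (norm u)\<^sup>2)" and ?F = "exp (- (norm u)\<^sup>2 / 2)"
    have EF: "?E = ?F * ?F" "?F * norm (kvec u) = 1"
      unfolding norm_kvec by (simp_all flip: exp_add)
    have "\<beta> (kvec u) (kvec u) = \<beta> (kvec u - trunc N (kvec u)) (kvec u) + \<beta> (trunc N (kvec u)) (kvec u)"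
      using bounded_formD(1)[OF b, of "kvec u - trunc N (kvec u)" "trunc N (kvec u)" "kvec u"] by simp
    then have "norm (\<beta> (kvec u) (kvec u)) \<le> norm (\<beta> (kvec u - trunc N (kvec u)) (kvec u)) + norm (\<beta> (trunc N (kvec u)) (kvec u))"
      by (simp only: norm_triangle_ineq)
    also have "\<dots> \<le> e/2 * (norm (kvec u) * norm (kvec u)) + C * ((\<Sum>n<N. norm (coef (kvec u) n)) * norm (kvec u))"
      by (intro add_mono N order_trans[OF bounded_formD(6)[OF b]] mult_left_mono mult_right_mono norm_trunc_le_sum C) auto
    finally have "?E * norm (\<beta> (kvec u) (kvec u)) \<le> ?E * (e/2 * (norm (kvec u) * norm (kvec u)) + C * ((\<Sum>n<N. norm (coef (kvec u) n)) * norm (kvec u)))"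
      by (rule mult_left_mono) simp
    also have "\<dots> = e/2 * ((?F * norm (kvec u)) * (?F * norm (kvec u))) + C * (?F * (\<Sum>n<N. norm (coef (kvec u) n))) * (?F * norm (kvec u))"
      unfolding EF(1) by (simp only: distrib_left mult_ac)
    also have "\<dots> = e/2 + C * g u"
      unfolding EF(2) g_def by (simp add: sum_distrib_left)
    also have "\<dots> < e" using R[OF that] by simp
    finally show ?thesis by (simp add: berezin_def norm_mult)
  qed
  then show "\<exists>R. \<forall>u. R \<le> norm u \<longrightarrow> dist (berezin \<beta> u) 0 < e" by blast
qed

lemma weyl_op_near_0:
  assumes "e > 0"
  shows "\<exists>d>0. \<forall>u. norm u < d \<longrightarrow> norm (weyl_op u x - x) < e"
proof -
  have "isCont (\<lambda>u. weyl_op u x) 0"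
    using continuous_weyl_op continuous_on_eq_continuous_at by blast
  then show ?thesis
    using assms unfolding continuous_at_eps_delta by (auto simp: dist_norm)
qed

lemma weyl_op_near_0_finite:
  fixes x :: "nat \<Rightarrow> ell2"
  assumes "e > 0"
  shows "\<exists>d>0. \<forall>u n. norm u < d \<longrightarrow> n < N \<longrightarrow> norm (weyl_op u (x n) - x n) < e"
proof (induction N)
  case (Suc N)
  then obtain d where d: "d > 0" "\<And>u n. norm u < d \<Longrightarrow> n < N \<Longrightarrow> norm (weyl_op u (x n) - x n) < e" by blast
  obtain d' where d': "d' > 0" "\<And>u. norm u < d' \<Longrightarrow> norm (weyl_op u (x N) - x N) < e"
    using weyl_op_near_0[OF assms] by blast
  show ?case
    by (rule exI[of _ "min d d'"]) (use d d' in \<open>auto simp: less_Suc_eq\<close>)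
qed (auto intro: exI[of _ 1])

text \<open>Up to a small error a compact operator is of finite rank, and for a rank one operator
  continuity of the orbit is strong continuity of the Weyl operators.\<close>

lemma compact_form_orbit_continuous:
  assumes b: "bounded_form C (\<lambda>x y. cin (B x) y)" and cpt: "compact_form (\<lambda>x y. cin (B x) y)"
  shows "orbit_continuous (\<lambda>x y. cin (B x) y)"
  unfolding orbit_continuous_def
proof (intro allI impI)
  fix e :: real assume "e > 0"
  let ?\<beta> = "\<lambda>x y. cin (B x) y"
  have C: "C \<ge> 0" by (rule bounded_formD(5)[OF b])
  obtain N where N: "\<And>x y. norm (?\<beta> (x - trunc N x) y) \<le> e/4 * (norm x * norm y)"
    using cpt \<open>e > 0\<close> unfolding compact_form_def by (meson zero_less_divide_iff zero_less_numeral order_refl)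
  \<comment> \<open>Each rank one term involves two moving vectors, \<open>unit_vec n\<close> of
    norm 1 and its image under B; perturbing one costs the norm of the other, hence 1 +
    \<open>norm (B (unit_vec n))\<close>.\<close>
  define M where "M = (\<Sum>n<N. 1 + norm (B (unit_vec n)))"
  have M0: "M \<ge> 0" unfolding M_def by (intro sum_nonneg) (simp add: add_nonneg_nonneg)
  define \<epsilon> where "\<epsilon> = e / (2 * (M + 1))"
  have \<epsilon>: "\<epsilon> > 0" "M * \<epsilon> \<le> e/2"
    using M0 \<open>e > 0\<close> by (auto simp: \<epsilon>_def field_simps)
  obtain d1 where d1: "d1 > 0" "\<And>u n. norm u < d1 \<Longrightarrow> n < N \<Longrightarrow> norm (weyl_op u (unit_vec n) - unit_vec n) < \<epsilon>"
    using weyl_op_near_0_finite[OF \<epsilon>(1), of N unit_vec] by blast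
  obtain d2 where d2: "d2 > 0" "\<And>u n. norm u < d2 \<Longrightarrow> n < N \<Longrightarrow> norm (weyl_op u (B (unit_vec n)) - B (unit_vec n)) < \<epsilon>"
    using weyl_op_near_0_finite[OF \<epsilon>(1), of N "\<lambda>n. B (unit_vec n)"] by blast
  have fin: "?\<beta> (trunc N x) y = (\<Sum>n<N. cin x (unit_vec n) * cin (B (unit_vec n)) y)" for x y
    unfolding trunc_def using bounded_bilinear.sum_left[OF bounded_form_bilinear[OF b], of _ "{..<N}" y]
    by (simp add: bounded_formD(2)[OF b] cin_unit_vec)
  have "norm (orbit ?\<beta> x y u - ?\<beta> x y) \<le> e * (norm x * norm y)" if u: "norm u < min d1 d2" for u x y
  proof -
    let ?P = "norm x * norm y"
    let ?x = "weyl_op (- u) x" and ?y = "weyl_op (- u) y"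
    have t: "norm (cin ?x (unit_vec n) * cin (B (unit_vec n)) ?y - cin x (unit_vec n) * cin (B (unit_vec n)) y)
        \<le> (1 + norm (B (unit_vec n))) * \<epsilon> * ?P" if n: "n < N" for n
    proof -
      let ?b = "B (unit_vec n)"
      \<comment> \<open>Taking adjoints moves the Weyl operators from the arbitrary x and y onto
        finitely many fixed vectors, so strong continuity becomes uniform in x and y.\<close>
      have "cin ?x (unit_vec n) = cin x (weyl_op u (unit_vec n))" "cin ?b ?y = cin (weyl_op u ?b) y"
        by (simp_all add: cin_weyl_op_left)
      then have "cin ?x (unit_vec n) * cin ?b ?y - cin x (unit_vec n) * cin ?b y
         = cin x (weyl_op u (unit_vec n)) * cin (weyl_op u ?b - ?b) y + cin x (weyl_op u (unit_vec n) - unit_vec n) * cin ?b y"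
        by (simp add: cin_diff_left cin_diff_right algebra_simps)
      also have "norm \<dots> \<le> (norm x * norm (weyl_op u (unit_vec n))) * (norm (weyl_op u ?b - ?b) * norm y)
          + (norm x * norm (weyl_op u (unit_vec n) - unit_vec n)) * (norm ?b * norm y)"
        by (rule order_trans[OF norm_triangle_ineq]) (unfold norm_mult, intro add_mono mult_mono norm_cin_le; simp)
      also have "\<dots> \<le> (norm x * norm (weyl_op u (unit_vec n))) * (\<epsilon> * norm y) + (norm x * \<epsilon>) * (norm ?b * norm y)"
        using d1(2)[of u n] d2(2)[of u n] u n
        by (intro add_mono mult_left_mono mult_right_mono) auto
      also have "\<dots> = (1 + norm ?b) * \<epsilon> * ?P"
        by (simp add: algebra_simps)
      finally show ?thesis .
    qed
    have split: "?\<beta> z w = ?\<beta> (z - trunc N z) w + ?\<beta> (trunc N z) w" for z w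
      using bounded_formD(1)[OF b, of "z - trunc N z" "trunc N z" w] by simp
    have "orbit ?\<beta> x y u - ?\<beta> x y = (?\<beta> (?x - trunc N ?x) ?y - ?\<beta> (x - trunc N x) y)
       + (\<Sum>n<N. cin ?x (unit_vec n) * cin (B (unit_vec n)) ?y - cin x (unit_vec n) * cin (B (unit_vec n)) y)"
      unfolding orbit_def split[of ?x ?y] split[of x y] fin sum_subtractf by simp
    also have "norm \<dots> \<le> (e/4 * ?P + e/4 * ?P) + (\<Sum>n<N. (1 + norm (B (unit_vec n))) * \<epsilon> * ?P)"
      using N[of ?x ?y] N[of x y]
      by (intro order_trans[OF norm_triangle_ineq] add_mono order_trans[OF norm_triangle_ineq4] order_trans[OF norm_sum] sum_mono t) auto
    also have "(\<Sum>n<N. (1 + norm (B (unit_vec n))) * \<epsilon> * ?P) = M * \<epsilon> * ?P"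
      by (simp only: M_def sum_distrib_right)
    also have "\<dots> \<le> e/2 * ?P"
      by (intro mult_right_mono \<epsilon>) simp
    finally show ?thesis by simp
  qed
  then show "\<exists>d>0. \<forall>u x y. norm u < d \<longrightarrow> norm (orbit ?\<beta> x y u - ?\<beta> x y) \<le> e * (norm x * norm y)"
    using d1(1) d2(1) by (intro exI[of _ "min d1 d2"]) auto
qed

text \<open>Weak sequential compactness of the unit ball. The coordinate sequences lie in a
  countable product of discs, compact by Tychonoff's theorem; finite partial sums show that the
  limit has norm at most 1.\<close>

lemma ell2_weak_compact:
  assumes "\<And>i. norm (x i) \<le> 1"
  obtains r y where "strict_mono (r :: nat \<Rightarrow> nat)" "norm y \<le> 1" "\<And>p. (\<lambda>i. coef (x (r i)) p) \<longlonglongrightarrow> coef y p"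
proof -
  define K where "K = Pi\<^sub>E UNIV (\<lambda>_::nat. cball (0::complex) 1)"
  have "compactin (product_topology (\<lambda>_. euclidean) UNIV) K"
    unfolding K_def by (auto simp: compactin_PiE)
  then have seq: "seq_compact K"
    by (intro compact_imp_seq_compact) (simp add: euclidean_product_topology)
  have "\<forall>i. coef (x i) \<in> K"
    using order_trans[OF norm_coef_le assms] by (auto simp: K_def)
  then obtain l r where lr: "strict_mono (r :: nat \<Rightarrow> nat)" "((\<lambda>i. coef (x i)) \<circ> r) \<longlonglongrightarrow> l"
    using seq[unfolded seq_compact_def, THEN spec[of _ "\<lambda>i. coef (x i)"]] by blast
  have lim: "(\<lambda>i. coef (x (r i)) p) \<longlonglongrightarrow> l p" for p
  proof -
    have "isCont (\<lambda>f. f p) l"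
      using continuous_on_product_coordinates[of p] continuous_on_eq_continuous_at[OF open_UNIV] by blast
    from isCont_tendsto_compose[OF this lr(2)] show ?thesis by (simp add: o_def)
  qed
  have le: "(\<Sum>p<N. (norm (l p))\<^sup>2) \<le> 1" for N
  proof (rule tendsto_upperbound)
    show "(\<lambda>i. \<Sum>p<N. (norm (coef (x (r i)) p))\<^sup>2) \<longlonglongrightarrow> (\<Sum>p<N. (norm (l p))\<^sup>2)"
      by (intro tendsto_intros lim)
    have "(\<Sum>p<N. (norm (coef (x (r i)) p))\<^sup>2) \<le> 1" for i
    proof -
      have "(\<Sum>p<N. (norm (coef (x (r i)) p))\<^sup>2) \<le> (norm (x (r i)))\<^sup>2"
        using sum_le_suminf[OF summable_coef_power2, of "{..<N}" "x (r i)"] sums_norm_power2[of "x (r i)"] by (simp add: sums_iff)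
      also have "\<dots> \<le> 1" using assms[of "r i"] by (simp add: power_le_one)
      finally show ?thesis .
    qed
    then show "\<forall>\<^sub>F i in sequentially. (\<Sum>p<N. (norm (coef (x (r i)) p))\<^sup>2) \<le> 1" by simp
  qed simp
  have sm: "summable (\<lambda>p. (norm (l p))\<^sup>2)"
    by (rule bounded_imp_summable[where B=1]) (simp, simp only: lessThan_Suc_atMost[symmetric] le)
  define y where "y = Abs_ell2 l"
  have cy: "coef y = l" unfolding y_def by (rule coef_Abs_ell2[OF sm])
  have "(norm y)\<^sup>2 \<le> 1"
    using suminf_le_const[OF sm le] sums_norm_power2[of y] by (simp add: cy sums_iff)
  then have "norm y \<le> 1" using power2_le_imp_le[of "norm y" 1] by simp
  then show ?thesis
    using that[of r y] lr(1) lim by (simp add: cy)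
qed

section \<open>Transfer from forms to operators between the function spaces\<close>

lemma Metric_space_fock: "Metric_space (range (fock_map n)) gauss_dist"
proof
  fix f g h
  show "0 \<le> gauss_dist f g" by (simp add: gauss_dist_def)
  show "gauss_dist f g = gauss_dist g f"
    by (simp add: gauss_dist_def gauss_norm_def norm_minus_commute)
  show "(gauss_dist f g = 0) = (f = g)" if "f \<in> range (fock_map n)" "g \<in> range (fock_map n)"
    using that by (auto simp: gauss_dist_fock_map)
  show "gauss_dist f h \<le> gauss_dist f g + gauss_dist g h"
    if "f \<in> range (fock_map n)" "g \<in> range (fock_map n)" "h \<in> range (fock_map n)"
    using that by (auto simp: gauss_dist_fock_map dist_triangle)
qed

lemma norm_le_if_cin_le:
  assumes "\<And>y. norm (cin x y) \<le> c * norm y"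
  shows "norm x \<le> c"
proof (cases "x = 0")
  case True
  then show ?thesis
    using order_trans[OF norm_ge_zero assms[of "unit_vec 0"]] by simp
next
  case False
  have "norm x * norm x \<le> c * norm x"
    using assms[of x] by (simp add: cin_self power2_eq_square norm_mult)
  then show ?thesis using False by (simp add: mult_le_cancel_right)
qed

lemma cscale_of_real: "cscale (of_real r) x = r *\<^sub>R x"
  by (simp add: scaleR_ell2_def)

text \<open>B is the operator A seen on sequences. As m and n count creation operators, A maps level
  \<open>Suc m\<close> to level \<open>Suc n\<close>; only its values on that level are
  constrained.\<close>

locale fock_operator =
  fixes m n :: nat and A :: "(complex \<Rightarrow> complex) \<Rightarrow> complex \<Rightarrow> complex" and B :: "ell2 \<Rightarrow> ell2" and C :: real
  assumes A_fock_map: "A (fock_map m x) = fock_map n (B x)"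
    and A_bounded: "A \<in> bounded_ops (true_polyfock (Suc m)) (true_polyfock (Suc n))"
    and norm_B_le: "norm (B x) \<le> C * norm x"
begin

lemma B_add: "B (x + y) = B x + B y"
proof -
  have "A (\<lambda>w. fock_map m x w + fock_map m y w) = (\<lambda>w. A (fock_map m x) w + A (fock_map m y) w)"
    using A_bounded fock_map_mem[of m] by (auto simp: bounded_ops_def)
  then have "fock_map n (B (x + y)) = fock_map n (B x + B y)"
    by (simp add: fock_map_add flip: A_fock_map)
  then show ?thesis by (simp add: fock_map_eq_iff)
qed

lemma B_cscale: "B (cscale c x) = cscale c (B x)"
proof -
  have "A (\<lambda>w. c * fock_map m x w) = (\<lambda>w. c * A (fock_map m x) w)"
    using A_bounded fock_map_mem[of m] by (auto simp: bounded_ops_def)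
  then have "fock_map n (B (cscale c x)) = fock_map n (cscale c (B x))"
    by (simp add: fock_map_cscale flip: A_fock_map)
  then show ?thesis by (simp add: fock_map_eq_iff)
qed

lemma C_nonneg: "C \<ge> 0"
  using order_trans[OF norm_ge_zero norm_B_le[of "unit_vec 0"]] by simp

lemma form: "bounded_form C (\<lambda>x y. cin (B x) y)"
proof -
  have "norm (cin (B x) y) \<le> C * (norm x * norm y)" for x y
    using norm_cin_le[of "B x" y] mult_right_mono[OF norm_B_le[of x], of "norm y"] by (simp add: mult.assoc)
  then show ?thesis
    using C_nonneg by (simp add: bounded_form_def B_add B_cscale cin_add_left cin_add_right cin_cscale_left cin_cscale_right)
qed

lemma B_diff: "B (x - y) = B x - B y"
  using B_add[of "x - y" y] by simp

lemma B_scaleR: "B (r *\<^sub>R x) = r *\<^sub>R B x"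
  using B_cscale[of "of_real r" x] by (simp add: cscale_of_real)

lemma compact_form_iff:
  "compact_form (\<lambda>x y. cin (B x) y) \<longleftrightarrow> (\<forall>e>0. \<exists>N0. \<forall>N\<ge>N0. \<forall>x. norm (B (x - trunc N x)) \<le> e * norm x)"
proof -
  have "(\<forall>x y. norm (cin (B (x - trunc N x)) y) \<le> e * (norm x * norm y)) \<longleftrightarrow> (\<forall>x. norm (B (x - trunc N x)) \<le> e * norm x)" for e N
  proof safe
    fix x assume "\<forall>x y. norm (cin (B (x - trunc N x)) y) \<le> e * (norm x * norm y)"
    then show "norm (B (x - trunc N x)) \<le> e * norm x"
      by (intro norm_le_if_cin_le) (simp add: mult.assoc)
  next
    fix x y :: ell2 assume "\<forall>x. norm (B (x - trunc N x)) \<le> e * norm x"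
    then have "norm (B (x - trunc N x)) * norm y \<le> e * norm x * norm y"
      by (intro mult_right_mono) auto
    then show "norm (cin (B (x - trunc N x)) y) \<le> e * (norm x * norm y)"
      using norm_cin_le[of "B (x - trunc N x)" y] by (simp add: mult.assoc)
  qed
  then show ?thesis unfolding compact_form_def by simp
qed

lemma unit_ball_eq: "unit_ball (true_polyfock (Suc m)) = fock_map m ` cball 0 1"
  by (auto simp: unit_ball_def true_polyfock_eq)

lemma image_unit_ball: "A ` unit_ball (true_polyfock (Suc m)) = fock_map n ` B ` cball 0 1"
  by (simp add: unit_ball_eq image_image A_fock_map)

interpretation M: Metric_space "true_polyfock (Suc n)" gauss_dist
  unfolding true_polyfock_eq by (rule Metric_space_fock)

lemma limitin_fock_map:
  "limitin M.mtopology (\<lambda>i. fock_map n (f i)) (fock_map n y) sequentially \<longleftrightarrow> f \<longlonglongrightarrow> y"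
  unfolding M.limitin_metric_dist_null tendsto_dist_iff[of f y]
  by (auto simp: gauss_dist_fock_map fock_map_mem)

text \<open>The image of the ball is itself compact, hence closed and equal to its closure: a
  sequence in the ball has a coordinatewise limit inside the ball, and B takes it to a norm limit,
  since up to a small error B sees only finitely many coordinates.\<close>

lemma compact_operator_if:
  assumes "compact_form (\<lambda>x y. cin (B x) y)"
  shows "compact_operator (true_polyfock (Suc m)) (true_polyfock (Suc n)) A"
proof -
  let ?S = "A ` unit_ball (true_polyfock (Suc m))"
  have cpt: "compactin M.mtopology ?S"
    unfolding M.compactin_sequentially
  proof (intro conjI allI impI)
    show "?S \<subseteq> true_polyfock (Suc n)"
      unfolding image_unit_ball using fock_map_mem by auto
    fix \<sigma> :: "nat \<Rightarrow> complex \<Rightarrow> complex" assume "range \<sigma> \<subseteq> ?S"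
    then have mem: "\<sigma> i \<in> fock_map n ` B ` cball 0 1" for i
      unfolding image_unit_ball by (rule range_subsetD)
    have "\<forall>i. \<exists>x. \<sigma> i = fock_map n (B x) \<and> x \<in> cball 0 1"
    proof
      fix i show "\<exists>x. \<sigma> i = fock_map n (B x) \<and> x \<in> cball 0 1"
        using mem[of i] unfolding image_image by (rule imageE) (rule exI, rule conjI)
    qed
    from choice[OF this] obtain x where x': "\<forall>i. \<sigma> i = fock_map n (B (x i)) \<and> x i \<in> cball 0 1" ..
    have x: "\<sigma> i = fock_map n (B (x i))" "norm (x i) \<le> 1" for i
      using x'[rule_format, of i] by simp_all
    obtain r y where r: "strict_mono r" "norm y \<le> 1" "\<And>p. (\<lambda>i. coef (x (r i)) p) \<longlonglongrightarrow> coef y p"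
      by (rule ell2_weak_compact[where x=x, OF x(2)]) (rule that)
    have "(\<lambda>i. B (x (r i))) \<longlonglongrightarrow> B y"
      unfolding tendsto_iff
    proof (intro allI impI)
      fix e :: real assume "e > 0"
      \<comment> \<open>The differences v below have norm at most 2, so e/4 leaves e/2 for the
        finitely many coordinates.\<close>
      obtain N where N: "\<And>v. norm (B (v - trunc N v)) \<le> e/4 * norm v"
        using assms \<open>e > 0\<close> unfolding compact_form_iff by (meson zero_less_divide_iff zero_less_numeral order_refl)
      have "(\<lambda>i. C * (\<Sum>p<N. norm (coef (x (r i)) p - coef y p))) \<longlonglongrightarrow> C * (\<Sum>p<N. norm (coef y p - coef y p))"
        by (intro tendsto_intros r)
      then have "\<forall>\<^sub>F i in sequentially. C * (\<Sum>p<N. norm (coef (x (r i)) p - coef y p)) < e/2"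
        by (rule order_tendstoD(2)) (use \<open>e > 0\<close> in simp)
      then show "\<forall>\<^sub>F i in sequentially. dist (B (x (r i))) (B y) < e"
      proof eventually_elim
        case (elim i)
        define v where "v = x (r i) - y"
        have "norm v \<le> 2"
          using norm_triangle_ineq4[of "x (r i)" y] x(2)[of "r i"] r(2) by (simp add: v_def)
        then have "e/4 * norm v \<le> e/4 * 2" using \<open>e > 0\<close> by (intro mult_left_mono) auto
        have "dist (B (x (r i))) (B y) = norm (B (v - trunc N v) + B (trunc N v))"
          by (simp add: dist_norm v_def B_diff)
        also have "\<dots> \<le> e/4 * norm v + C * (\<Sum>p<N. norm (coef v p))"
          by (intro order_trans[OF norm_triangle_ineq] add_mono N order_trans[OF norm_B_le] mult_left_mono norm_trunc_le_sum C_nonneg)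
        also have "\<dots> < e"
          using elim \<open>e/4 * norm v \<le> e/4 * 2\<close> by (simp add: v_def)
        finally show ?case .
      qed
    qed
    then have "limitin M.mtopology (\<sigma> \<circ> r) (fock_map n (B y)) sequentially"
      using limitin_fock_map[of "\<lambda>i. B (x (r i))" "B y"] by (simp add: o_def x(1))
    moreover have "fock_map n (B y) \<in> ?S"
      unfolding image_unit_ball using r(2) by auto
    ultimately show "\<exists>l r. l \<in> ?S \<and> strict_mono r \<and> limitin M.mtopology (\<sigma> \<circ> r) l sequentially"
      using r(1) by blast
  qed
  have "closedin M.mtopology ?S"
    by (rule compactin_imp_closedin[OF M.Hausdorff_space_mtopology cpt])
  then show ?thesis
    using cpt A_bounded by (simp add: compact_operator_def norm_topology_def closure_of_closedin)
qed

text \<open>If the tails of B do not tend to zero, unit vectors have tails z with |B z| > e. The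
  tails tend weakly to zero, yet by compactness their images accumulate in norm at some y; that y is
  orthogonal to itself, contradicting |y| \<ge> e.\<close>

lemma compact_operator_imp:
  assumes "compact_operator (true_polyfock (Suc m)) (true_polyfock (Suc n)) A"
  shows "compact_form (\<lambda>x y. cin (B x) y)"
proof (rule ccontr)
  let ?S = "A ` unit_ball (true_polyfock (Suc m))"
  have cpt: "compactin M.mtopology (M.mtopology closure_of ?S)"
    using assms by (simp add: compact_operator_def norm_topology_def)
  have S: "?S \<subseteq> M.mtopology closure_of ?S"
    by (rule closure_of_subset) (use fock_map_mem in \<open>auto simp: image_unit_ball\<close>)
  assume "\<not> compact_form (\<lambda>x y. cin (B x) y)"
  then obtain e where e: "e > 0"
    "\<not> (\<exists>N0. \<forall>N\<ge>N0. \<forall>x. norm (B (x - trunc N x)) \<le> e * norm x)"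
    unfolding compact_form_iff by blast
  have "\<exists>N x. N \<ge> N0 \<and> norm x = 1 \<and> norm (B (x - trunc N x)) > e" for N0
  proof -
    obtain N x where "N \<ge> N0" "\<not> norm (B (x - trunc N x)) \<le> e * norm x" using e(2) by blast
    then have Nx: "N \<ge> N0" "norm (B (x - trunc N x)) > e * norm x" by simp_all
    have "x \<noteq> 0"
    proof
      assume "x = 0"
      then have "x - trunc N x = 0" by (intro ell2_eqI) (simp add: coef_trunc)
      then show False using Nx(2) \<open>x = 0\<close> B_diff[of 0 0] by simp
    qed
    define x' where "x' = (1 / norm x) *\<^sub>R x"
    have "x' - trunc N x' = (1 / norm x) *\<^sub>R (x - trunc N x)"
      by (rule ell2_eqI) (simp add: x'_def coef_trunc algebra_simps)
    then have "norm (B (x' - trunc N x')) = norm (B (x - trunc N x)) / norm x"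
      by (simp add: B_scaleR)
    then have "norm (B (x' - trunc N x')) > e"
      using Nx(2) \<open>x \<noteq> 0\<close> by (simp add: pos_less_divide_eq)
    moreover have "norm x' = 1" using \<open>x \<noteq> 0\<close> by (simp add: x'_def)
    ultimately show ?thesis using Nx(1) by blast
  qed
  then obtain N x where Nx: "\<And>i. N i \<ge> i" "\<And>i. norm (x i) = 1" "\<And>i. norm (B (x i - trunc (N i) (x i))) > e"
    by metis
  define z where "z = (\<lambda>i. x i - trunc (N i) (x i))"
  have "norm (z i) \<le> 1" for i
    using norm_diff_trunc_le[of "x i" "N i"] Nx(2)[of i] by (simp add: z_def)
  then have "range (\<lambda>i. fock_map n (B (z i))) \<subseteq> ?S"
    unfolding image_unit_ball by auto
  then have "range (\<lambda>i. fock_map n (B (z i))) \<subseteq> M.mtopology closure_of ?S"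
    using S by blast
  then obtain l r where lr: "l \<in> M.mtopology closure_of ?S" "strict_mono r"
    "limitin M.mtopology ((\<lambda>i. fock_map n (B (z i))) \<circ> r) l sequentially"
    using cpt unfolding M.compactin_sequentially by blast
  have "l \<in> true_polyfock (Suc n)"
    by (rule M.limitin_mspace[OF lr(3)])
  then obtain y where y: "l = fock_map n y" using fock_map_surj by blast
  have lim: "(\<lambda>i. B (z (r i))) \<longlonglongrightarrow> y"
    using lr(3) unfolding y o_def limitin_fock_map .
  \<comment> \<open>b is the adjoint of B applied to y; pairing with it moves the truncation onto
    this fixed vector.\<close>
  obtain b where b: "\<And>x. cin (B x) y = cin x b"
  proof (rule riesz_ell2[of "\<lambda>x. cin (B x) y" "C * norm y"])
    show "norm (cin (B x) y) \<le> C * norm y * norm x" for x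
      using bounded_formD(6)[OF form, of x y] by (simp add: mult_ac)
  qed (use bounded_formD(1,2)[OF form] in auto)
  have "(\<lambda>i. cin (B (z (r i))) y) \<longlonglongrightarrow> 0"
  proof (rule Lim_null_comparison[OF always_eventually])
    show "\<forall>i. norm (cin (B (z (r i))) y) \<le> norm (b - trunc (N (r i)) b)"
    proof
      fix i
      have "cin (B (z (r i))) y = cin (x (r i)) (b - trunc (N (r i)) b)"
        unfolding b z_def by (simp add: cin_diff_left cin_diff_right cin_trunc)
      then show "norm (cin (B (z (r i))) y) \<le> norm (b - trunc (N (r i)) b)"
        using norm_cin_le[of "x (r i)" "b - trunc (N (r i)) b"] Nx(2) by simp
    qed
    have "filterlim (\<lambda>i. N (r i)) at_top sequentially"
    proof (rule filterlim_at_top_mono[OF filterlim_subseq[OF lr(2)]])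
      show "\<forall>\<^sub>F i in sequentially. r i \<le> N (r i)" using Nx(1) by simp
    qed
    from filterlim_compose[OF trunc_tendsto this]
    have "(\<lambda>i. norm (b - trunc (N (r i)) b)) \<longlonglongrightarrow> norm (b - b)"
      by (intro tendsto_intros)
    then show "(\<lambda>i. norm (b - trunc (N (r i)) b)) \<longlonglongrightarrow> 0" by simp
  qed
  moreover have "(\<lambda>i. cin (B (z (r i))) y) \<longlonglongrightarrow> cin y y"
    by (rule bounded_bilinear.tendsto[OF bounded_form_bilinear[OF bounded_form_cin] lim tendsto_const])
  ultimately have "cin y y = 0" by (rule LIMSEQ_unique[rotated])
  then have "y = 0" by (simp add: cin_self)
  have "(\<lambda>i. norm (B (z (r i)))) \<longlonglongrightarrow> norm y" by (intro tendsto_intros lim)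
  then have "e \<le> norm y"
    by (rule tendsto_lowerbound) (use Nx(3) in \<open>auto simp: z_def less_imp_le\<close>)
  then show False using \<open>y = 0\<close> e(1) by simp
qed

text \<open>The supremum in \<open>op_norm\<close> is the best constant in the estimate of W_u B
  W_(-u) - B, and testing against all y turns the norm estimate into one for the form.\<close>

lemma C_1_iff: "A \<in> C_1 (Suc m) (Suc n) \<longleftrightarrow> orbit_continuous (\<lambda>x y. cin (B x) y)"
proof -
  define T where "T = (\<lambda>u x. weyl_op u (B (weyl_op (- u) x)) - B x)"
  have TA: "gauss_norm (\<lambda>w. weyl u (A (weyl (- u) (fock_map m x))) w - A (fock_map m x) w) = norm (T u x)" for u x
  proof -
    have "(\<lambda>w. weyl u (A (weyl (- u) (fock_map m x))) w - A (fock_map m x) w) = fock_map n (T u x)"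
      by (simp add: T_def fock_map_diff A_fock_map flip: fock_map_weyl_op)
    then show ?thesis by simp
  qed
  define op where "op = (\<lambda>u. op_norm (true_polyfock (Suc m)) (\<lambda>f w. weyl u (A (weyl (- u) f)) w - A f w))"
  have op: "op u = (SUP x\<in>cball 0 1. norm (T u x))" for u
    by (simp add: op_def op_norm_def unit_ball_eq image_image TA)
  have Tb: "norm (T u x) \<le> 2 * C * norm x" for u x
    using norm_triangle_ineq4[of "weyl_op u (B (weyl_op (- u) x))" "B x"] norm_B_le[of "weyl_op (- u) x"] norm_B_le[of x]
    by (simp add: T_def)
  have bdd: "bdd_above ((\<lambda>x. norm (T u x)) ` cball 0 1)" for u
  proof (rule bdd_aboveI2)
    fix x :: ell2 assume "x \<in> cball 0 1"
    then have "2 * C * norm x \<le> 2 * C * 1" using C_nonneg by (intro mult_left_mono) auto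
    then show "norm (T u x) \<le> 2 * C" using Tb[of u x] by simp
  qed
  have T_scaleR: "T u (r *\<^sub>R x) = r *\<^sub>R T u x" for u r x
    unfolding T_def scaleR_ell2_def weyl_op_cscale B_cscale by (rule ell2_eqI) (simp add: algebra_simps)
  have T_op: "norm (T u x) \<le> op u * norm x" for u x
  proof (cases "x = 0")
    case True
    then show ?thesis using Tb[of u x] by simp
  next
    case False
    have "norm (T u ((1 / norm x) *\<^sub>R x)) \<le> op u"
      unfolding op using False by (intro cSUP_upper bdd) auto
    then show ?thesis
      using False by (simp add: T_scaleR divide_le_eq)
  qed
  have op_le: "op u \<le> e" if "\<And>x. norm (T u x) \<le> e * norm x" "e \<ge> 0" for u e
    unfolding op
  proof (rule cSUP_least)
    fix x :: ell2 assume "x \<in> cball 0 1"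
    then have "e * norm x \<le> e * 1" using that(2) by (intro mult_left_mono) auto
    then show "norm (T u x) \<le> e" using that(1)[of x] by simp
  qed simp
  have op0: "op u \<ge> 0" for u
    unfolding op by (rule cSUP_upper2[OF bdd, where x=0]) auto
  have orb: "orbit (\<lambda>x y. cin (B x) y) x y u - cin (B x) y = cin (T u x) y" for x y u
    by (simp add: orbit_def T_def cin_diff_left cin_weyl_op_left)
  have oc: "orbit_continuous (\<lambda>x y. cin (B x) y) \<longleftrightarrow> (\<forall>e>0. \<exists>d>0. \<forall>u. norm u < d \<longrightarrow> op u \<le> e)"
  proof
    assume L: "orbit_continuous (\<lambda>x y. cin (B x) y)"
    show "\<forall>e>0. \<exists>d>0. \<forall>u. norm u < d \<longrightarrow> op u \<le> e"
    proof (intro allI impI)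
      fix e :: real assume "e > 0"
      then obtain d where d: "d > 0" "\<And>u x y. norm u < d \<Longrightarrow> norm (cin (T u x) y) \<le> e * (norm x * norm y)"
        using L unfolding orbit_continuous_def orb by blast
      have "op u \<le> e" if "norm u < d" for u
        by (rule op_le[OF norm_le_if_cin_le]) (use d(2)[OF that] \<open>e > 0\<close> in \<open>auto simp: mult.assoc\<close>)
      then show "\<exists>d>0. \<forall>u. norm u < d \<longrightarrow> op u \<le> e" using d(1) by blast
    qed
  next
    assume R: "\<forall>e>0. \<exists>d>0. \<forall>u. norm u < d \<longrightarrow> op u \<le> e"
    show "orbit_continuous (\<lambda>x y. cin (B x) y)"
      unfolding orbit_continuous_def orb
    proof (intro allI impI)
      fix e :: real assume "e > 0"
      then obtain d where d: "d > 0" "\<And>u. norm u < d \<Longrightarrow> op u \<le> e" using R by blast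
      have "norm (cin (T u x) y) \<le> e * (norm x * norm y)" if "norm u < d" for u x y
      proof -
        have "norm (cin (T u x) y) \<le> norm (T u x) * norm y" by (rule norm_cin_le)
        also have "\<dots> \<le> (op u * norm x) * norm y" by (intro mult_right_mono T_op) simp
        also have "\<dots> \<le> (e * norm x) * norm y" by (intro mult_right_mono d(2) that) auto
        finally show ?thesis by (simp add: mult.assoc)
      qed
      then show "\<exists>d>0. \<forall>u x y. norm u < d \<longrightarrow> norm (cin (T u x) y) \<le> e * (norm x * norm y)"
        using d(1) by blast
    qed
  qed
  \<comment> \<open>The filter \<open>at 0\<close> omits u = 0 while \<open>orbit_continuous\<close>
    includes it; this value reconciles the two.\<close>
  have op_zero: "op 0 = 0"
    using op_le[of 0 0] op0[of 0] by (simp add: T_def)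
  have "A \<in> C_1 (Suc m) (Suc n) \<longleftrightarrow> (op \<longlongrightarrow> 0) (at 0)"
    using A_bounded by (simp add: C_1_def op_def)
  also have "\<dots> \<longleftrightarrow> (\<forall>e>0. \<exists>d>0. \<forall>u. norm u < d \<longrightarrow> op u \<le> e)"
  proof
    assume "(op \<longlongrightarrow> 0) (at 0)"
    then have "\<exists>d>0. \<forall>u. u \<noteq> 0 \<and> norm u < d \<longrightarrow> \<bar>op u\<bar> < e" if "e > 0" for e
      using that unfolding LIM_eq by auto
    then show "\<forall>e>0. \<exists>d>0. \<forall>u. norm u < d \<longrightarrow> op u \<le> e"
      using op_zero by (metis abs_of_nonneg less_imp_le op0)
  next
    assume R: "\<forall>e>0. \<exists>d>0. \<forall>u. norm u < d \<longrightarrow> op u \<le> e"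
    show "(op \<longlongrightarrow> 0) (at 0)"
      unfolding LIM_eq
    proof (intro allI impI)
      fix e :: real assume "e > 0"
      then obtain d where "d > 0" "\<And>u. norm u < d \<Longrightarrow> op u \<le> e/2" using R by (meson half_gt_zero)
      then show "\<exists>d>0. \<forall>u. u \<noteq> 0 \<and> norm (u - 0) < d \<longrightarrow> norm (op u - 0) < e"
        using \<open>e > 0\<close> op0 by (intro exI[of _ d]) force
    qed
  qed
  finally show ?thesis using oc by simp
qed

text \<open>The normalized kernel is \<open>kvec z\<close> scaled by exp(-|z|^2/2). The factor
  appears once in each argument, which gives the prefactor of \<open>berezin\<close>.\<close>

lemma gauss_inner_l_fun:
  "gauss_inner (A (l_fun z (Suc m))) (l_fun z (Suc n)) = berezin (\<lambda>x y. cin (B x) y) z"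
proof -
  define c where "c = exp (- (norm z)\<^sup>2 / 2)"
  have "fock_kernel z = fock_fun (cscale (of_real c) (kvec z))"
    unfolding fock_fun_cscale fock_fun_kvec c_def
    by (auto simp: fock_kernel_def fun_eq_iff simp flip: exp_of_real exp_add)
  then have l: "l_fun z (Suc k) = fock_map k (cscale (of_real c) (kvec z))" for k
    by (simp add: l_fun_def fock_unitary_fock_fun)
  have "c * c = exp (- (norm z)\<^sup>2)" by (simp add: c_def flip: exp_add)
  then show ?thesis
    unfolding l A_fock_map gauss_inner_fock_map B_cscale cin_cscale_left cin_cscale_right berezin_def
    by (simp flip: mult.assoc of_real_mult)
qed

end

theorem theorem3p6:
  fixes j k :: nat
    and A :: "(complex \<Rightarrow> complex) \<Rightarrow> (complex \<Rightarrow> complex)"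
  assumes "j \<ge> 1" and "k \<ge> 1"
    and "A \<in> bounded_ops (true_polyfock j) (true_polyfock k)"
  shows "compact_operator (true_polyfock j) (true_polyfock k) A \<longleftrightarrow>
    A \<in> C_1 j k \<and>
    ((\<lambda>z. gauss_inner (A (l_fun z j)) (l_fun z k)) \<longlongrightarrow> 0) at_infinity"
proof -
  \<comment> \<open>Levels start at 1, whereas \<open>fock_map\<close> is indexed from 0.\<close>
  obtain m n where mn: "j = Suc m" "k = Suc n"
    using assms(1,2) by (metis Suc_le_D One_nat_def)
  note A = assms(3)[unfolded mn]
  have "\<exists>y. A (fock_map m x) = fock_map n y" for x
    using A fock_map_mem[of m x] fock_map_surj by (metis (no_types, lifting) bounded_ops_def mem_Collect_eq)
  then obtain B where B: "\<And>x. A (fock_map m x) = fock_map n (B x)" by metis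
  obtain C where C: "\<And>f. f \<in> true_polyfock (Suc m) \<Longrightarrow> gauss_norm (A f) \<le> C * gauss_norm f"
    using A unfolding bounded_ops_def by blast
  have "norm (B x) \<le> C * norm x" for x
    using C[OF fock_map_mem, of x] by (simp add: B)
  then interpret fock_operator m n A B C
    by unfold_locales (use B A in auto)
  show ?thesis
    unfolding mn C_1_iff gauss_inner_l_fun
    using compact_operator_if compact_operator_imp compact_form_if[OF form]
      compact_form_orbit_continuous[OF form] compact_form_berezin_vanishes[OF form] by blast
qed

end
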